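(* Let $w:[n]\to[C]$ be a word in the colours $[C]$, and let $X_1,\dots,X_n$ be $N\times N$ quaternionic random matrices such that the families $\{X_k:w(k)=c\}$, $c\in[C]$, are symplectically invariant and symplectically in general position. Then for all $\iota:\pm[n]\to[N]$ and $\eta:\pm[n]\to\{1,-1\}$, $$\mathbb{E}\big(X^{(1)}_{\iota_1\iota_{-1};\eta_1\eta_{-1}}\cdots X^{(n)}_{\iota_n\iota_{-n};\eta_n\eta_{-n}}\big)=\sum_{\substack{\alpha\in\mathrm{PM}(n)\\ \iota=\iota\circ\delta\alpha\\ \mathrm{sgn}\cdot\eta=(\mathrm{sgn}\circ\alpha)\cdot(\eta\circ\delta\alpha)}}(2N)^{\#(\alpha)/2-n}\Big[\prod_{\substack{k\in[n]\\ -k\in\mathrm{FD}(\alpha)}}\eta_k\eta_{-k}\Big]f(\alpha),$$ where $f:\mathrm{PM}(n)\to\mathbb{C}$ vanishes unless $\alpha=\alpha_1\cdots\alpha_C$ with $\alpha_c\in\mathrm{PM}(w^{-1}(c))$, in which case $$f(\alpha)=\sum_{\substack{\pi=\pi_1\cdots\pi_C\\ \pi_c\in\mathrm{PM}(w^{-1}(c))}}(-2N)^{\chi(\alpha,\pi)-\#(\alpha)}\,\mathrm{wg}(\delta\alpha_1,\delta\pi_1)\cdots\mathrm{wg}(\delta\alpha_C,\delta\pi_C)\,\mathbb{E}\big(\mathrm{Re}_{\pi}\mathrm{tr}_{\pi}(X_1,\dots,X_n)\big).$$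
   Context: $\mathrm{Sp}(N)$ is the group of $N\times N$ quaternionic matrices $U$ with $U^*U=I_N$ ($^*$ the conjugate transpose). Families of random matrices are symplectically invariant and symplectically in general position if the joint distribution of all the matrices is unchanged when each family is conjugated by its own arbitrary symplectic matrix: for all $U_1,\dots,U_C\in\mathrm{Sp}(N)$, $(U_{w(k)}^*X_kU_{w(k)})_{k\in[n]}$ has the same joint distribution as $(X_k)_{k\in[n]}$. All expectations written are assumed to exist. The quaternion $a+bi+cj+dk$ is represented by the $2\times2$ complex matrix $\begin{pmatrix}a+bi&c+di\\-c+di&a-bi\end{pmatrix}$, rows and columns indexed by $1,-1$ in this order; $A_{\iota_1\iota_2;\eta_1\eta_2}$ is the $(\eta_1,\eta_2)$ entry of the matrix representing the quaternion $A_{\iota_1\iota_2}$. Write $A^{(k)}$ for $A_k$ and $A^{(-k)}$ for $A_k^*$ when indices are attached. $[n]=\{1,\dots,n\}$, $\pm I=I\cup(-I)$, $\delta:k\mapsto-k$, $\mathrm{sgn}(k)$ is the sign of the integer $k$, $\cdot$ is pointwise multiplication of functions, $\#$ is the number of orbits of a permutation or blocks of a set partition, and permutations act right to left. For $I\subseteq[n]$, $\mathrm{PM}(I)$ is the set of permutations $\pi$ of $\pm I$ with $\delta\pi\delta=\pi^{-1}$ and no $k,-k$ in the same cycle; $\mathrm{PM}(n)=\mathrm{PM}([n])$. The cycles come in pairs (order and signs reversed); $\mathrm{FD}(\pi)$ is the product of those cycles, one from each pair, in which the element of smallest absolute value is positive, and also denotes the set of elements of those cycles; so $\#(\mathrm{FD}(\pi))=\#(\pi)/2$.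 For $\alpha,\pi\in\mathrm{PM}(n)$, the Euler characteristic is $\chi(\alpha,\pi)=\#(\alpha)/2+\#(\pi)/2+\#(\alpha^{-1}\pi^{-1})/2-n$. For $\pi\in\mathrm{PM}(n)$ and $N\times N$ quaternionic matrices $A_1,\dots,A_n$, $\mathrm{Re}_\pi\mathrm{tr}_\pi$ stands for $$\mathrm{Re}_{\mathrm{FD}(\pi)}\mathrm{tr}_{\mathrm{FD}(\pi)}(A_1,\dots,A_n)=2^{-\#(\mathrm{FD}(\pi))}N^{-\#(\mathrm{FD}(\pi))}\sum_{\substack{i:\mathrm{FD}(\pi)\to[N]\\ h:\mathrm{FD}(\pi)\to\{1,-1\}}}\ \prod_{k\in\mathrm{FD}(\pi)}A^{(k)}_{i_k,i_{\pi(k)};h_k,h_{\pi(k)}}.$$ Weingarten function. For a finite set $J$ with $|J|=2m$, let $\mathcal{P}_2(J)$ be the set of pairings of $J$ (partitions into two-element blocks, equivalently fixed-point-free involutions). Let $\mathrm{Gr}$ be the matrix indexed by $\mathcal{P}_2(J)$ with entries $\mathrm{Gr}(\pi_+,\pi_-)=(-1)^m(-2N)^{\#(\pi_+\vee\pi_-)}$ ($\vee$ the join of set partitions), let $\mathrm{Wg}$ be its inverse (or pseudoinverse), and let the normalized Weingarten function be $\mathrm{wg}(\pi_+,\pi_-)=(-2N)^{2m-\#(\pi_+\vee\pi_-)}\,\mathrm{Wg}(\pi_+,\pi_-)$. In the factor for colour $c$, $J=\pm w^{-1}(c)$, $m=|w^{-1}(c)|$, and $\delta\alpha_c$, $\delta\pi_c$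 are regarded as pairings of $J$.
   Formalization: The formula for f(α) is corrected: a factor (-1)^n is added (as printed it fails for n=1, X_1=I, giving -1 instead of 1), and wg(δα_c,δπ_c) is replaced by wg(δα_c,δπ_c^{-1}) (as printed it fails for n=3, X_k=I, even up to sign). *)

theory Defs
  imports "HOL-Probability.Probability" "HOL-Combinatorics.Orbits"
begin

section \<open>Quaternions\<close>

(* Quat a b c d is a + bi + cj + dk *)
datatype quat = Quat (Re0: real) (Im1: real) (Im2: real) (Im3: real)

lemma quat_eqI:
  "Re0 p = Re0 q \<Longrightarrow> Im1 p = Im1 q \<Longrightarrow> Im2 p = Im2 q \<Longrightarrow> Im3 p = Im3 q \<Longrightarrow> p = q"
  by (cases p; cases q) simp

instantiation quat :: ring_1
begin

definition "0 = Quat 0 0 0 0"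

definition "1 = Quat 1 0 0 0"

definition "p + q = Quat (Re0 p + Re0 q) (Im1 p + Im1 q) (Im2 p + Im2 q) (Im3 p + Im3 q)"

definition "- q = Quat (- Re0 q) (- Im1 q) (- Im2 q) (- Im3 q)"

definition "p - q = Quat (Re0 p - Re0 q) (Im1 p - Im1 q) (Im2 p - Im2 q) (Im3 p - Im3 q)"

definition "p * q = Quat
  (Re0 p * Re0 q - Im1 p * Im1 q - Im2 p * Im2 q - Im3 p * Im3 q)
  (Re0 p * Im1 q + Im1 p * Re0 q + Im2 p * Im3 q - Im3 p * Im2 q)
  (Re0 p * Im2 q - Im1 p * Im3 q + Im2 p * Re0 q + Im3 p * Im1 q)
  (Re0 p * Im3 q + Im1 p * Im2 q - Im2 p * Im1 q + Im3 p * Re0 q)"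

instance
  by standard
    (simp_all add: zero_quat_def one_quat_def plus_quat_def uminus_quat_def minus_quat_def
      times_quat_def algebra_simps)

end

instantiation quat :: real_inner
begin

definition "r *\<^sub>R q = Quat (r * Re0 q) (r * Im1 q) (r * Im2 q) (r * Im3 q)"

definition "p \<bullet> q = Re0 p * Re0 q + Im1 p * Im1 q + Im2 p * Im2 q + Im3 p * Im3 q"

definition "norm (q::quat) = sqrt (q \<bullet> q)"

definition "sgn (q::quat) = inverse (norm q) *\<^sub>R q"

definition "dist p q = norm (p - q :: quat)"

definition "(uniformity :: (quat \<times> quat) filter)
  = (INF e\<in>{0<..}. principal {(x, y). dist x y < e})"

definition "open (U :: quat set)
  \<longleftrightarrow> (\<forall>x\<in>U. eventually (\<lambda>(x', y). x' = x \<longrightarrow> y \<in> U) uniformity)"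

instance
proof
  fix x :: quat
  show "x \<bullet> x = 0 \<longleftrightarrow> x = 0"
    by (cases x) (auto simp: inner_quat_def zero_quat_def add_nonneg_eq_0_iff)
qed (simp_all add: zero_quat_def plus_quat_def uminus_quat_def minus_quat_def
      scaleR_quat_def inner_quat_def norm_quat_def sgn_quat_def dist_quat_def
      uniformity_quat_def open_quat_def algebra_simps)

end

instantiation quat :: euclidean_space
begin

definition "Basis = {Quat 1 0 0 0, Quat 0 1 0 0, Quat 0 0 1 0, Quat 0 0 0 1}"

instance
  by standard
    (auto simp: Basis_quat_def inner_quat_def zero_quat_def intro: quat_eqI)

end

definition qcnj :: "quat \<Rightarrow> quat" where
  "qcnj q = Quat (Re0 q) (- Im1 q) (- Im2 q) (- Im3 q)"

(* Entry of the 2x2 complex matrix representing q; the row h and the column h' range over {1, -1}. *)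
definition quat_entry :: "quat \<Rightarrow> int \<Rightarrow> int \<Rightarrow> complex" where
  "quat_entry q h h' =
    (if h = 1
     then (if h' = 1 then Complex (Re0 q) (Im1 q) else Complex (Im2 q) (Im3 q))
     else (if h' = 1 then Complex (- Im2 q) (Im3 q) else Complex (Re0 q) (- Im1 q)))"


section \<open>Quaternionic matrices\<close>

type_synonym 'n qmat = "quat ^ 'n ^ 'n"

definition qadj :: "'n qmat \<Rightarrow> 'n::finite qmat" where
  "qadj A = (\<chi> i j. qcnj (A $ j $ i))"

definition Sp :: "'n::finite qmat set" where
  "Sp = {U. qadj U ** U = mat 1}"

definition qmat_entry :: "'n::finite qmat \<Rightarrow> 'n \<Rightarrow> 'n \<Rightarrow> int \<Rightarrow> int \<Rightarrow> complex" where
  "qmat_entry A i j h h' = quat_entry (A $ i $ j) h h'"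

(* the matrix written with superscript (k): A_k for k > 0, and the adjoint of A_{-k} for k < 0 *)
definition signed_mat :: "(int \<Rightarrow> 'n::finite qmat) \<Rightarrow> int \<Rightarrow> 'n qmat" where
  "signed_mat A k = (if 0 < k then A k else qadj (A (- k)))"


section \<open>Symplectic invariance\<close>

definition joint_law :: "'a measure \<Rightarrow> nat \<Rightarrow> (int \<Rightarrow> 'a \<Rightarrow> 'n::finite qmat)
    \<Rightarrow> (int \<Rightarrow> 'n qmat) measure" where
  "joint_law M n X =
    distr M (\<Pi>\<^sub>M k\<in>{1..int n}. borel) (\<lambda>\<omega>. \<lambda>k\<in>{1..int n}. X k \<omega>)"

definition sympl_general_position ::
    "'a measure \<Rightarrow> nat \<Rightarrow> nat \<Rightarrow> (int \<Rightarrow> nat) \<Rightarrow> (int \<Rightarrow> 'a \<Rightarrow> 'n::finite qmat) \<Rightarrow> bool" where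
  "sympl_general_position M n C w X \<longleftrightarrow>
    (\<forall>U. (\<forall>c\<in>{1..C}. U c \<in> Sp) \<longrightarrow>
      joint_law M n (\<lambda>k \<omega>. qadj (U (w k)) ** X k \<omega> ** U (w k)) = joint_law M n X)"


section \<open>Permutations of signed sets\<close>

definition pm :: "int set \<Rightarrow> int set" where
  "pm I = I \<union> uminus ` I"

definition PM :: "int set \<Rightarrow> (int \<Rightarrow> int) set" where
  "PM I = {\<pi>. \<pi> permutes pm I \<and> uminus \<circ> \<pi> \<circ> uminus = inv \<pi> \<and>
               (\<forall>k\<in>pm I. - k \<notin> orbit \<pi> k)}"

definition num_orbits :: "int set \<Rightarrow> (int \<Rightarrow> int) \<Rightarrow> nat" where
  "num_orbits S \<pi> = card (orbit \<pi> ` S)"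

(* the set of elements of the chosen cycles; the chosen cycles are the restriction of \<pi> to it *)
definition FD :: "int set \<Rightarrow> (int \<Rightarrow> int) \<Rightarrow> int set" where
  "FD I \<pi> = {k \<in> pm I. \<exists>m\<in>orbit \<pi> k. 0 < m \<and> (\<forall>j\<in>orbit \<pi> k. \<bar>m\<bar> \<le> \<bar>j\<bar>)}"

(* The halves are exact: for \<alpha>, \<pi> in PM, the cycles of \<alpha> and of \<pi> come in pairs, and so do those of
   inv \<alpha> \<circ> inv \<pi> = (\<delta> \<alpha>) (\<pi> \<delta>) with \<delta> = uminus, a product of two fixed-point-free involutions. *)
definition euler_char :: "nat \<Rightarrow> (int \<Rightarrow> int) \<Rightarrow> (int \<Rightarrow> int) \<Rightarrow> int" where
  "euler_char n \<alpha> \<pi> =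
    int (num_orbits (pm {1..int n}) \<alpha>) div 2
    + int (num_orbits (pm {1..int n}) \<pi>) div 2
    + int (num_orbits (pm {1..int n}) (inv \<alpha> \<circ> inv \<pi>)) div 2
    - int n"

definition Re_tr :: "nat \<Rightarrow> (int \<Rightarrow> int) \<Rightarrow> (int \<Rightarrow> 'n::finite qmat) \<Rightarrow> complex" where
  "Re_tr n \<pi> A =
    (let F = FD {1..int n} \<pi>; r = num_orbits F \<pi> in
      2 powi (- int r) * of_nat CARD('n) powi (- int r) *
      (\<Sum>i \<in> F \<rightarrow>\<^sub>E (UNIV :: 'n set). \<Sum>h \<in> F \<rightarrow>\<^sub>E {1, -1}.
        \<Prod>k\<in>F. qmat_entry (signed_mat A k) (i k) (i (\<pi> k)) (h k) (h (\<pi> k))))"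


section \<open>Weingarten function\<close>

(* pairings, as fixed-point-free involutions *)
definition pairings :: "int set \<Rightarrow> (int \<Rightarrow> int) set" where
  "pairings J = {p. p permutes J \<and> p \<circ> p = id \<and> (\<forall>k\<in>J. p k \<noteq> k)}"

(* number of blocks of the join of two pairings of J *)
definition join_blocks :: "int set \<Rightarrow> (int \<Rightarrow> int) \<Rightarrow> (int \<Rightarrow> int) \<Rightarrow> nat" where
  "join_blocks J p q = card (J // ({(k, p k) |k. k \<in> J} \<union> {(k, q k) |k. k \<in> J})\<^sup>*)"

definition Gr :: "nat \<Rightarrow> int set \<Rightarrow> (int \<Rightarrow> int) \<Rightarrow> (int \<Rightarrow> int) \<Rightarrow> real" where
  "Gr N J p q = (- 1) ^ (card J div 2) * (- 2 * real N) ^ join_blocks J p q"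

definition mat_prod :: "'i set \<Rightarrow> ('i \<Rightarrow> 'i \<Rightarrow> real) \<Rightarrow> ('i \<Rightarrow> 'i \<Rightarrow> real) \<Rightarrow> 'i \<Rightarrow> 'i \<Rightarrow> real" where
  "mat_prod S A B p q = (\<Sum>r\<in>S. A p r * B r q)"

(* Moore-Penrose conditions for real matrices indexed by S, which determine the pseudoinverse;
   it is the inverse when A is invertible. W is set to 0 off S x S so that it is unique. *)
definition is_pseudoinverse :: "'i set \<Rightarrow> ('i \<Rightarrow> 'i \<Rightarrow> real) \<Rightarrow> ('i \<Rightarrow> 'i \<Rightarrow> real) \<Rightarrow> bool" where
  "is_pseudoinverse S A W \<longleftrightarrow>
    (\<forall>p\<in>S. \<forall>q\<in>S.
      mat_prod S (mat_prod S A W) A p q = A p q \<and>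
      mat_prod S (mat_prod S W A) W p q = W p q \<and>
      mat_prod S A W p q = mat_prod S A W q p \<and>
      mat_prod S W A p q = mat_prod S W A q p) \<and>
    (\<forall>p q. p \<notin> S \<or> q \<notin> S \<longrightarrow> W p q = 0)"

definition Wg :: "nat \<Rightarrow> int set \<Rightarrow> (int \<Rightarrow> int) \<Rightarrow> (int \<Rightarrow> int) \<Rightarrow> real" where
  "Wg N J = (THE W. is_pseudoinverse (pairings J) (Gr N J) W)"

definition wg :: "nat \<Rightarrow> int set \<Rightarrow> (int \<Rightarrow> int) \<Rightarrow> (int \<Rightarrow> int) \<Rightarrow> real" where
  "wg N J p q = (- 2 * real N) powi (int (card J) - int (join_blocks J p q)) * Wg N J p q"


section \<open>The coefficient of a permutation\<close>

definition colour_class :: "nat \<Rightarrow> (int \<Rightarrow> nat) \<Rightarrow> nat \<Rightarrow> int set" where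
  "colour_class n w c = {k \<in> {1..int n}. w k = c}"

definition perm_prod :: "nat \<Rightarrow> (nat \<Rightarrow> int \<Rightarrow> int) \<Rightarrow> int \<Rightarrow> int" where
  "perm_prod C P = foldr (\<lambda>c g. P c \<circ> g) [1..<Suc C] id"

definition colour_families :: "nat \<Rightarrow> nat \<Rightarrow> (int \<Rightarrow> nat) \<Rightarrow> (nat \<Rightarrow> int \<Rightarrow> int) set" where
  "colour_families n C w = (\<Pi>\<^sub>E c\<in>{1..C}. PM (colour_class n w c))"

(* The function f of the expansion. The factors have disjoint supports, so a permutation arises from
   at most one family: THE picks the factors of \<alpha>, and summing over \<pi> amounts to summing over its
   family P of factors.

   Two details are not as one finds them when this formula is written with the factors
   wg(\<delta> \<alpha>_c, \<delta> \<pi>_c) only, a form which fails for odd n, respectively for n = 3.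
   - The sign (-1)^n is the product over the colours of the signs (-1)^(card J div 2) of Gr. They survive
     in wg: wg(p, p) = (-1)^(card J div 2) + O(1/N). For n = 1 and X_1 the identity matrix, wg = -1,
     while the expectation of a diagonal entry is 1.
   - The pairing that belongs to \<pi> is \<delta> inv \<pi> = \<pi> \<delta> rather than \<delta> \<pi>: the permutation inv \<alpha> inv \<pi>
     in euler_char is the product (\<delta> \<alpha>) (\<delta> inv \<pi>) of these two pairings, so that the powers of -2N in
     euler_char and in wg refer to the same join. *)
definition f_coeff :: "'a measure \<Rightarrow> nat \<Rightarrow> nat \<Rightarrow> (int \<Rightarrow> nat) \<Rightarrow> (int \<Rightarrow> 'a \<Rightarrow> 'n::finite qmat)
    \<Rightarrow> (int \<Rightarrow> int) \<Rightarrow> complex" where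
  "f_coeff M n C w X \<alpha> =
    (if \<exists>A\<in>colour_families n C w. \<alpha> = perm_prod C A
     then
       (let A = (THE A. A \<in> colour_families n C w \<and> \<alpha> = perm_prod C A) in
         \<Sum>P\<in>colour_families n C w.
           (let \<pi> = perm_prod C P in
             (- 1) ^ n *
             (- 2 * of_nat CARD('n)) powi
               (euler_char n \<alpha> \<pi> - int (num_orbits (pm {1..int n}) \<alpha>)) *
             (\<Prod>c\<in>{1..C}.
               (let J = pm (colour_class n w c) in
                 of_real (wg CARD('n) J
                   (restrict_id (uminus \<circ> A c) J)
                   (restrict_id (uminus \<circ> inv (P c)) J)))) *
             (\<integral>\<omega>. Re_tr n \<pi> (\<lambda>k. X k \<omega>) \<partial>M)))
     else 0)"

end

theory Submission
  imports Defs
begin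

text \<open>The expectation of a product of matrix entries, as a function of all its indices, is a tensor with
  two slots for each matrix: slot \<open>k > 0\<close> for the row and slot \<open>-k\<close> for the column of \<open>X k\<close>. An index
  is a vector of the standard basis of \<open>C^(2N)\<close>. Once the row indices are transposed with the
  symplectic form, conjugation by \<open>U\<close> acts on both slots through the same representation of \<open>Sp(N)\<close>,
  so symplectic invariance in general position says that the tensor is invariant, for each colour,
  under \<open>Sp(N)\<close> acting on the slots of that colour. The theorem is the expansion of an invariant tensor
  in the tensors built from the symplectic form by pairing up the slots, where permutations in \<open>PM\<close>
  are pairings composed with \<open>k \<mapsto> -k\<close>.

  That pairing tensors span the invariants is proved without representation theory. Differentiating
  along one-parameter subgroups turns invariance into \<open>E\<^sub>x\<^sub>y T = \<plusminus> E\<^sub>y\<^sub>'\<^sub>x\<^sub>' T\<close> for the derivation action of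
  the matrix units, where the prime is the symplectic partner of a basis vector
  (\<open>lie_zero_imp_sp_invariant\<close>). Take the sum of \<open>(E\<^sub>x\<^sub>y T)\<^sup>2\<close> over \<open>x\<close>, \<open>y\<close> and all indices, and rewrite one
  factor with this relation: the products of a slot with itself give minus a sum of squares of entries
  of \<open>T\<close>, and each product of two different slots contains a contraction of \<open>T\<close> with the form. So an
  invariant tensor with vanishing contractions is zero (\<open>sp_invariant_no_contractions_zero\<close>), and by
  induction on the number of slots so is an invariant tensor orthogonal to all pairing tensors
  (\<open>sp_invariant_orthogonal_zero\<close>).

  Consequently \<open>T\<close> is its own orthogonal projection to the span of the pairing tensors, and the
  projection is given by any generalized inverse of their Gram matrix. This works for all \<open>n\<close> and \<open>N\<close>,
  also where the Gram matrix is singular; it only has to be known that the Moore-Penrose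
  conditions do determine \<open>Wg\<close> (\<open>is_pseudoinverse_The\<close>). The colours are treated one after the other
  (\<open>Weingarten_expansion_colours\<close>).

  The Gram matrix is \<open>Gr\<close> for suitable signs of the pairing tensors. Two pairing tensors are
  simultaneously nonzero at \<open>(2N)\<close> to the number of blocks of the join many indices
  (\<open>card_pairing_tensor_support\<close>). That the sign there does not depend on the index, and is the one in
  \<open>Gr\<close>, is a parity statement on three pairings, the third being \<open>k \<mapsto> -k\<close>; it is obtained by
  comparing orientations of pairings by signs of permutations (\<open>three_pairings_parity\<close>).

  Finally, the traces are contractions with pairing tensors, because the column index at \<open>k\<close> is the row
  index at \<open>\<pi> k\<close> (\<open>Re_tr_eq\<close>). What remains is to pass from pairings to permutations, from families of
  permutations to their products, and to collect the powers of \<open>-2N\<close>.\<close>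

section \<open>The pseudoinverse of a symmetric matrix\<close>

definition mat_add :: "('i \<Rightarrow> 'i \<Rightarrow> real) \<Rightarrow> ('i \<Rightarrow> 'i \<Rightarrow> real) \<Rightarrow> 'i \<Rightarrow> 'i \<Rightarrow> real" where
  "mat_add A B p q = A p q + B p q"

definition mat_transpose :: "('i \<Rightarrow> 'i \<Rightarrow> real) \<Rightarrow> 'i \<Rightarrow> 'i \<Rightarrow> real" where
  "mat_transpose A p q = A q p"

text \<open>Matrices that vanish off \<open>S \<times> S\<close> form a ring under \<open>mat_prod S\<close>, in which equations are
  equations of functions.\<close>

definition supported_on :: "'i set \<Rightarrow> ('i \<Rightarrow> 'i \<Rightarrow> real) \<Rightarrow> bool" where
  "supported_on S A \<longleftrightarrow> (\<forall>p q. p \<notin> S \<or> q \<notin> S \<longrightarrow> A p q = 0)"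

lemma mat_prod_assoc: "mat_prod S (mat_prod S A B) C = mat_prod S A (mat_prod S B C)"
  unfolding mat_prod_def fun_eq_iff
  by (auto simp: sum_distrib_left sum_distrib_right mult.assoc intro: sum.swap)

lemma mat_transpose_mat_prod:
  "mat_transpose (mat_prod S A B) = mat_prod S (mat_transpose B) (mat_transpose A)"
  by (simp add: fun_eq_iff mat_transpose_def mat_prod_def mult.commute)

lemma mat_transpose_transpose [simp]: "mat_transpose (mat_transpose A) = A"
  by (simp add: fun_eq_iff mat_transpose_def)

lemma supported_on_mat_prod:
  "supported_on S A \<Longrightarrow> supported_on S B \<Longrightarrow> supported_on S (mat_prod S A B)"
  by (auto simp: supported_on_def mat_prod_def)

lemma supported_on_transpose: "supported_on S A \<Longrightarrow> supported_on S (mat_transpose A)"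
  by (auto simp: supported_on_def mat_transpose_def)

text \<open>Elimination of one row and one column at a time: if \<open>A r c \<noteq> 0\<close>, subtracting
  \<open>A p c * A r q / A r c\<close> clears row \<open>r\<close> and column \<open>c\<close>, and a generalized inverse of the
  remainder, cut down to the other rows and columns and completed by \<open>1 / A r c\<close> at \<open>(c, r)\<close>,
  is one of \<open>A\<close>.\<close>

lemma generalized_inverse_exists:
  assumes "finite S" "supported_on S A"
  shows "\<exists>B. supported_on S B \<and> mat_prod S (mat_prod S A B) A = A"
  using assms
proof (induction "card {p\<in>S. \<exists>q\<in>S. A p q \<noteq> 0}" arbitrary: A rule: less_induct)
  case less
  show ?case
  proof (cases "\<exists>r\<in>S. \<exists>c\<in>S. A r c \<noteq> 0")
    case False
    then have "A = (\<lambda>p q. 0)"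
      using less.prems(2) unfolding supported_on_def by (metis ext)
    then show ?thesis
      by (intro exI[of _ A]) (simp add: supported_on_def mat_prod_def fun_eq_iff)
  next
    case True
    then obtain r c where rc: "r \<in> S" "c \<in> S" "A r c \<noteq> 0"
      by auto
    let ?a = "A r c"
    define A' where "A' p q = A p q - A p c * A r q / ?a" for p q
    have supp': "supported_on S A'"
      using less.prems(2) by (auto simp: supported_on_def A'_def)
    have row0: "A' r q = 0" for q
      using rc by (simp add: A'_def)
    have col0: "A' p c = 0" for p
      using rc by (simp add: A'_def)
    have "{p\<in>S. \<exists>q\<in>S. A' p q \<noteq> 0} \<subseteq> {p\<in>S. \<exists>q\<in>S. A p q \<noteq> 0} - {r}"
    proof safe
      fix p q assume "p \<in> S" "q \<in> S" "A' p q \<noteq> 0"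
      then have "A p q \<noteq> 0 \<or> A p c \<noteq> 0"
        by (auto simp: A'_def)
      then show "\<exists>q\<in>S. A p q \<noteq> 0"
        using \<open>q \<in> S\<close> rc by auto
    next
      fix q assume "A' r q \<noteq> 0"
      then show False
        using row0 by simp
    qed
    then have "card {p\<in>S. \<exists>q\<in>S. A' p q \<noteq> 0} \<le> card ({p\<in>S. \<exists>q\<in>S. A p q \<noteq> 0} - {r})"
      using less.prems(1) by (intro card_mono) auto
    also have "\<dots> < card {p\<in>S. \<exists>q\<in>S. A p q \<noteq> 0}"
      using rc less.prems(1) by (intro card_Diff1_less) auto
    finally have "card {p\<in>S. \<exists>q\<in>S. A' p q \<noteq> 0} < card {p\<in>S. \<exists>q\<in>S. A p q \<noteq> 0}"
      .
    then obtain B' where B': "supported_on S B'" "mat_prod S (mat_prod S A' B') A' = A'"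
      using less.hyps[OF _ less.prems(1) supp'] by blast
    define e where "e x y = (if x = y then 1 else 0 :: real)" for x y :: 'a
    \<comment> \<open>\<open>A P = Q A = A'\<close>: the two factors remove the pivot column and the pivot row.\<close>
    define P where "P p q = (if p \<in> S \<and> q \<in> S then e p q else 0) - e p c * A r q / ?a" for p q
    define Q where "Q p q = (if p \<in> S \<and> q \<in> S then e p q else 0) - A p c * e q r / ?a" for p q
    define E where "E p q = e p c * e q r / ?a" for p q
    have zero: "A p q = 0" if "p \<notin> S \<or> q \<notin> S" for p q
      using that less.prems(2) by (auto simp: supported_on_def)
    have sum_e: "(\<Sum>x\<in>S. f x * e x y) = (if y \<in> S then f y else 0)" for f :: "'a \<Rightarrow> real" and y
      using less.prems(1) by (simp add: e_def if_distrib[of "\<lambda>t. _ * t"] cong: if_cong)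
    have sum_e': "(\<Sum>x\<in>S. e y x * f x) = (if y \<in> S then f y else 0)" for f :: "'a \<Rightarrow> real" and y
      using less.prems(1) by (simp add: e_def if_distrib[of "\<lambda>t. t * _"] cong: if_cong)
    have e_sym: "e x y = e y x" for x y
      by (simp add: e_def)
    have AP: "mat_prod S A P = A'"
    proof (intro ext)
      fix p q
      have "mat_prod S A P p q
          = (\<Sum>x\<in>S. A p x * (if q \<in> S then e x q else 0)) - (\<Sum>x\<in>S. A p x * e x c) * (A r q / ?a)"
        unfolding mat_prod_def P_def sum_distrib_right sum_subtractf[symmetric]
        by (intro sum.cong) (auto simp: algebra_simps)
      also have "(\<Sum>x\<in>S. A p x * (if q \<in> S then e x q else 0)) = A p q"
        using zero by (cases "q \<in> S") (auto simp: sum_e)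
      finally show "mat_prod S A P p q = A' p q"
        using rc by (simp add: sum_e A'_def)
    qed
    have QA: "mat_prod S Q A = A'"
    proof (intro ext)
      fix p q
      have "mat_prod S Q A p q
          = (\<Sum>x\<in>S. (if p \<in> S then e p x else 0) * A x q) - (A p c / ?a) * (\<Sum>x\<in>S. e r x * A x q)"
        unfolding mat_prod_def Q_def sum_distrib_left sum_subtractf[symmetric]
        by (intro sum.cong) (auto simp: algebra_simps e_sym)
      also have "(\<Sum>x\<in>S. (if p \<in> S then e p x else 0) * A x q) = A p q"
        using zero by (cases "p \<in> S") (auto simp: sum_e')
      finally show "mat_prod S Q A p q = A' p q"
        using rc by (simp add: sum_e' A'_def)
    qed
    have AEA: "mat_prod S (mat_prod S A E) A p q = A p c * A r q / ?a" for p q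
    proof -
      have AE: "mat_prod S A E p x = A p c * (e r x / ?a)" for x
      proof -
        have "mat_prod S A E p x = (\<Sum>y\<in>S. A p y * e y c) * (e r x / ?a)"
          unfolding mat_prod_def E_def sum_distrib_right by (simp add: e_sym mult.assoc)
        then show ?thesis
          using rc by (simp add: sum_e)
      qed
      have "mat_prod S (mat_prod S A E) A p q = (\<Sum>x\<in>S. e r x * A x q) * (A p c / ?a)"
        unfolding mat_prod_def[of S "mat_prod S A E"] AE sum_distrib_right
        by (intro sum.cong) (auto simp: algebra_simps)
      then show ?thesis
        using rc by (simp add: sum_e')
    qed
    define B where "B = mat_add (mat_prod S P (mat_prod S B' Q)) E"
    have "supported_on S P" "supported_on S Q" "supported_on S E"
      using zero rc by (auto simp: supported_on_def P_def Q_def E_def e_def)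
    then have "supported_on S B"
      using supported_on_mat_prod[of S P, OF _ supported_on_mat_prod[of S B' Q]] B'(1)
      by (auto simp: B_def supported_on_def mat_add_def)
    moreover have "mat_prod S (mat_prod S A B) A = A"
    proof (intro ext)
      fix p q
      have "mat_prod S (mat_prod S A B) A p q
          = mat_prod S (mat_prod S A (mat_prod S P (mat_prod S B' Q))) A p q
            + mat_prod S (mat_prod S A E) A p q"
        by (simp add: B_def mat_prod_def mat_add_def algebra_simps sum.distrib
            sum_distrib_left sum_distrib_right)
      also have "mat_prod S (mat_prod S A (mat_prod S P (mat_prod S B' Q))) A
          = mat_prod S (mat_prod S (mat_prod S A P) B') (mat_prod S Q A)"
        by (simp add: mat_prod_assoc)
      also have "\<dots> = A'"
        using B'(2) by (simp add: AP QA)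
      finally show "mat_prod S (mat_prod S A B) A p q = A p q"
        by (simp add: AEA A'_def)
    qed
    ultimately show ?thesis
      by blast
  qed
qed

text \<open>If \<open>G\<close> is symmetric and \<open>G (G d) = 0\<close>, then \<open>G d\<close> is orthogonal to itself.\<close>

lemma symmetric_cancel_left:
  assumes "finite S" "supported_on S G" "mat_transpose G = G"
    and X: "mat_prod S G (mat_prod S G X) = mat_prod S G (mat_prod S G Y)"
  shows "mat_prod S G X = mat_prod S G Y"
proof (intro ext)
  fix p q
  define d where "d x = X x q - Y x q" for x
  define g where "g x = (\<Sum>y\<in>S. G x y * d y)" for x
  have sym: "G x y = G y x" for x y
    using assms(3) by (metis mat_transpose_def)
  have GG: "(\<Sum>x\<in>S. G y x * g x) = 0" for y
    using fun_cong[OF fun_cong[OF X, of y], of q]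
    by (simp add: mat_prod_def g_def d_def algebra_simps sum_subtractf)
  have "(\<Sum>x\<in>S. g x * g x) = (\<Sum>x\<in>S. \<Sum>y\<in>S. g x * (G x y * d y))"
    by (simp add: g_def sum_distrib_left)
  also have "\<dots> = (\<Sum>y\<in>S. \<Sum>x\<in>S. g x * (G x y * d y))"
    by (rule sum.swap)
  also have "\<dots> = (\<Sum>y\<in>S. (\<Sum>x\<in>S. G y x * g x) * d y)"
    by (intro sum.cong refl) (simp add: sum_distrib_left sum_distrib_right mult_ac sym)
  also have "\<dots> = 0"
    by (simp add: GG)
  finally have "(\<Sum>x\<in>S. g x * g x) = 0" .
  then have "g x = 0" if "x \<in> S" for x
    using that assms(1) by (subst (asm) sum_nonneg_eq_0_iff) auto
  moreover have "g x = 0" if "x \<notin> S" for x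
    using that assms(2) by (simp add: g_def supported_on_def)
  ultimately have "g p = 0"
    by blast
  then show "mat_prod S G X p q = mat_prod S G Y p q"
    by (simp add: g_def d_def mat_prod_def algebra_simps sum_subtractf)
qed

lemma symmetric_cancel_right:
  assumes "finite S" "supported_on S G" "mat_transpose G = G"
    and X: "mat_prod S (mat_prod S X G) G = mat_prod S (mat_prod S Y G) G"
  shows "mat_prod S X G = mat_prod S Y G"
proof -
  have "mat_prod S G (mat_prod S G (mat_transpose X)) = mat_prod S G (mat_prod S G (mat_transpose Y))"
    using arg_cong[OF X, of mat_transpose] assms(3) by (simp add: mat_transpose_mat_prod)
  from symmetric_cancel_left[OF assms(1-3) this]
  have "mat_transpose (mat_prod S G (mat_transpose X)) = mat_transpose (mat_prod S G (mat_transpose Y))"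
    by simp
  then show ?thesis
    using assms(3) by (simp add: mat_transpose_mat_prod)
qed

text \<open>With \<open>K\<close> any generalized inverse of \<open>G\<^sup>3\<close>, the matrix \<open>G K G\<close> satisfies the Moore-Penrose
  conditions for \<open>G\<close>, because powers of a symmetric matrix can be cancelled down to \<open>G\<close>.\<close>

lemma pseudoinverse_exists:
  assumes fin: "finite S" and supp: "supported_on S G" and sym: "mat_transpose G = G"
  shows "\<exists>W. is_pseudoinverse S G W"
proof -
  define prd (infixl "\<cdot>" 70) where "prd = mat_prod S"
  note assoc = mat_prod_assoc[of S, folded prd_def]
  note cancel_l = symmetric_cancel_left[OF fin supp sym, folded prd_def]
  note cancel_r = symmetric_cancel_right[OF fin supp sym, folded prd_def]
  note tr = mat_transpose_mat_prod[of S, folded prd_def]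
  have "supported_on S (G \<cdot> (G \<cdot> G))"
    unfolding prd_def by (intro supported_on_mat_prod supp)
  from generalized_inverse_exists[OF fin this, folded prd_def]
  obtain K where K: "supported_on S K" "G \<cdot> (G \<cdot> G) \<cdot> K \<cdot> (G \<cdot> (G \<cdot> G)) = G \<cdot> (G \<cdot> G)"
    by blast
  define W where "W = G \<cdot> (K \<cdot> G)"
  define I where "I p q = (if p = q then 1 else 0 :: real)" for p q :: 'a
  have G_I: "G \<cdot> I = G" "I \<cdot> G = G"
    using fin supp
    by (auto simp: prd_def mat_prod_def I_def fun_eq_iff supported_on_def
        if_distrib[of "\<lambda>t. _ * t"] if_distrib[of "\<lambda>t. t * _"] cong: if_cong)
  \<comment> \<open>Cancelling \<open>G\<close> from \<open>G\<^sup>3 K G\<^sup>3 = G\<^sup>3\<close>, twice on one side or once on each.\<close>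
  have GKG3: "G \<cdot> (K \<cdot> (G \<cdot> (G \<cdot> G))) = G"
  proof -
    have "G \<cdot> (G \<cdot> (G \<cdot> (K \<cdot> (G \<cdot> (G \<cdot> G))))) = G \<cdot> (G \<cdot> G)"
      using K(2) by (simp add: assoc)
    then have "G \<cdot> (G \<cdot> (G \<cdot> (K \<cdot> (G \<cdot> (G \<cdot> G))))) = G \<cdot> (G \<cdot> (G \<cdot> I))"
      by (simp add: G_I)
    from cancel_l[OF cancel_l[OF this]] show ?thesis
      by (simp add: G_I)
  qed
  have G3KG: "G \<cdot> (G \<cdot> (G \<cdot> (K \<cdot> G))) = G"
  proof -
    have "(G \<cdot> (G \<cdot> (G \<cdot> K)) \<cdot> G \<cdot> G) \<cdot> G = (I \<cdot> G \<cdot> G) \<cdot> G"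
      using K(2) by (simp add: assoc G_I)
    then have "((G \<cdot> (G \<cdot> (G \<cdot> K)) \<cdot> G) \<cdot> G) \<cdot> G = ((I \<cdot> G) \<cdot> G) \<cdot> G"
      by simp
    from cancel_r[OF this] have "(G \<cdot> (G \<cdot> (G \<cdot> K)) \<cdot> G) \<cdot> G = (I \<cdot> G) \<cdot> G" .
    from cancel_r[OF this] show ?thesis
      by (simp add: assoc G_I)
  qed
  have G2KG2: "G \<cdot> (G \<cdot> (K \<cdot> (G \<cdot> G))) = G"
  proof -
    have "(G \<cdot> (G \<cdot> (K \<cdot> G)) \<cdot> G) \<cdot> G = (I \<cdot> G) \<cdot> G"
      using GKG3 by (simp add: assoc G_I)
    from cancel_r[OF this] show ?thesis
      by (simp add: assoc G_I)
  qed
  have GWG: "G \<cdot> W \<cdot> G = G"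
    using G2KG2 by (simp add: W_def assoc)
  have WGW: "W \<cdot> G \<cdot> W = W"
    using arg_cong[OF GKG3, of "\<lambda>x. x \<cdot> (K \<cdot> G)"] by (simp add: W_def assoc)
  have sym_GW: "mat_transpose (G \<cdot> W) = G \<cdot> W"
  proof -
    have "mat_transpose (G \<cdot> W) \<cdot> (G \<cdot> W) = mat_transpose (G \<cdot> W)"
      using arg_cong[OF G3KG, of "\<lambda>x. G \<cdot> (mat_transpose K \<cdot> (G \<cdot> x))"]
      by (simp add: W_def assoc tr sym)
    then show ?thesis
      using tr[of "mat_transpose (G \<cdot> W)" "G \<cdot> W"] by simp
  qed
  have sym_WG: "mat_transpose (W \<cdot> G) = W \<cdot> G"
  proof -
    have "(W \<cdot> G) \<cdot> mat_transpose (W \<cdot> G) = mat_transpose (W \<cdot> G)"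
      using arg_cong[OF GKG3, of "\<lambda>x. x \<cdot> (G \<cdot> (mat_transpose K \<cdot> G))"]
      by (simp add: W_def assoc tr sym)
    then show ?thesis
      using tr[of "W \<cdot> G" "mat_transpose (W \<cdot> G)"] by simp
  qed
  have "supported_on S W"
    unfolding W_def prd_def by (intro supported_on_mat_prod supp K)
  moreover have "(G \<cdot> W) p q = (G \<cdot> W) q p" "(W \<cdot> G) p q = (W \<cdot> G) q p" for p q
    using fun_cong[OF fun_cong[OF sym_GW, of p], of q] fun_cong[OF fun_cong[OF sym_WG, of p], of q]
    by (simp_all add: mat_transpose_def)
  ultimately have "is_pseudoinverse S G W"
    using GWG WGW unfolding is_pseudoinverse_def supported_on_def prd_def by simp
  then show ?thesis
    by blast
qed

lemma pseudoinverse_unique: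
  assumes G: "supported_on S G" and V: "is_pseudoinverse S G V" and W: "is_pseudoinverse S G W"
  shows "V = W"
proof -
  define prd (infixl "\<cdot>" 70) where "prd = mat_prod S"
  note assoc = mat_prod_assoc[of S, folded prd_def]
  note tr = mat_transpose_mat_prod[of S, folded prd_def]
  have eqI: "A = B" if "supported_on S A" "supported_on S B" "\<forall>p\<in>S. \<forall>q\<in>S. A p q = B p q" for A B
    using that unfolding supported_on_def by (metis ext)
  have laws: "supported_on S X \<and> G \<cdot> X \<cdot> G = G \<and> X \<cdot> G \<cdot> X = X \<and>
      mat_transpose (G \<cdot> X) = G \<cdot> X \<and> mat_transpose (X \<cdot> G) = X \<cdot> G"
    if X: "is_pseudoinverse S G X" for X
  proof -
    have suppX: "supported_on S X"
      using X by (auto simp: is_pseudoinverse_def supported_on_def)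
    note [intro!] = eqI supported_on_mat_prod supported_on_transpose G suppX
    show ?thesis
      using X suppX unfolding is_pseudoinverse_def prd_def by (auto simp: mat_transpose_def)
  qed
  note V = laws[OF V] and W = laws[OF W]
  have "G \<cdot> V = (G \<cdot> W) \<cdot> (G \<cdot> V)"
    by (simp add: assoc[symmetric] W)
  also have "\<dots> = mat_transpose ((G \<cdot> V) \<cdot> (G \<cdot> W))"
    using V W tr[of "G \<cdot> V" "G \<cdot> W"] by simp
  also have "\<dots> = G \<cdot> W"
    by (simp add: assoc[symmetric] V W)
  finally have GV: "G \<cdot> V = G \<cdot> W" .
  have "V \<cdot> G = (V \<cdot> G) \<cdot> (W \<cdot> G)"
    using W by (simp add: assoc)
  also have "\<dots> = mat_transpose ((W \<cdot> G) \<cdot> (V \<cdot> G))"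
    using V W tr[of "W \<cdot> G" "V \<cdot> G"] by simp
  also have "\<dots> = W \<cdot> G"
    using V W by (simp add: assoc)
  finally have VG: "V \<cdot> G = W \<cdot> G" .
  have "V = W \<cdot> G \<cdot> V"
    using V VG by simp
  also have "\<dots> = W \<cdot> G \<cdot> W"
    using GV by (simp add: assoc)
  finally show "V = W"
    using W by simp
qed

lemma pseudoinverse_cong:
  assumes "\<And>p q. p \<in> S \<Longrightarrow> q \<in> S \<Longrightarrow> A p q = B p q"
  shows "is_pseudoinverse S A W = is_pseudoinverse S B W"
proof -
  have "mat_prod S (mat_prod S A W) A p q = mat_prod S (mat_prod S B W) B p q"
    "mat_prod S (mat_prod S W A) W p q = mat_prod S (mat_prod S W B) W p q"
    "mat_prod S A W p q = mat_prod S B W p q" "mat_prod S W A p q = mat_prod S W B p q"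
    if "p \<in> S" "q \<in> S" for p q
    using that assms by (auto simp: mat_prod_def intro!: sum.cong)
  then show ?thesis
    using assms unfolding is_pseudoinverse_def by auto
qed

text \<open>The conditions read \<open>G\<close> only on \<open>S \<times> S\<close>, so \<open>G\<close> may be cut off outside.\<close>

lemma is_pseudoinverse_The:
  assumes fin: "finite S" and sym: "\<And>p q. p \<in> S \<Longrightarrow> q \<in> S \<Longrightarrow> G p q = G q p"
  shows "is_pseudoinverse S G (THE W. is_pseudoinverse S G W)"
proof -
  define G0 where "G0 p q = (if p \<in> S \<and> q \<in> S then G p q else 0)" for p q
  have G0: "supported_on S G0" "mat_transpose G0 = G0"
    using sym by (auto simp: G0_def supported_on_def mat_transpose_def fun_eq_iff)
  have eq: "is_pseudoinverse S G W = is_pseudoinverse S G0 W" for W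
    by (rule pseudoinverse_cong) (simp add: G0_def)
  have "\<exists>!W. is_pseudoinverse S G0 W"
    using pseudoinverse_exists[OF fin G0] pseudoinverse_unique[OF G0(1)] by blast
  then show ?thesis
    unfolding eq by (rule theI')
qed

section \<open>Invariant tensors of the symplectic group\<close>

text \<open>A basis vector of \<open>C^(2N)\<close> is a quaternionic coordinate together with a sign, \<open>True\<close> standing for
  \<open>+1\<close>. The symplectic form \<open>sform\<close> pairs it with its flip only.\<close>

definition flip :: "'n \<times> bool \<Rightarrow> 'n \<times> bool" where
  "flip x = (fst x, \<not> snd x)"

definition bsgn :: "'n \<times> bool \<Rightarrow> real" where
  "bsgn x = (if snd x then 1 else - 1)"

definition sform :: "'n \<times> bool \<Rightarrow> 'n \<times> bool \<Rightarrow> real" where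
  "sform x y = (if y = flip x then bsgn x else 0)"

text \<open>Index functions are total. The sums over the indices at the slots \<open>J\<close> run over the functions that
  agree with a background function elsewhere; the other slots then act as parameters, which allows
  one to contract the slots of one colour while those of the other colours stay open.\<close>

definition agree_off :: "int set \<Rightarrow> (int \<Rightarrow> 'b) \<Rightarrow> (int \<Rightarrow> 'b) set" where
  "agree_off J z = {y. \<forall>k. k \<notin> J \<longrightarrow> y k = z k}"

text \<open>The derivation by which a matrix unit acts on the tensor factors in \<open>J\<close>.\<close>

definition elem_act :: "int set \<Rightarrow> 'b \<Rightarrow> 'b \<Rightarrow> ((int \<Rightarrow> 'b) \<Rightarrow> real) \<Rightarrow> (int \<Rightarrow> 'b) \<Rightarrow> real" where
  "elem_act J x y T z = (\<Sum>k\<in>J. if z k = x then T (z(k := y)) else 0)"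

text \<open>Annihilation by the complexified Lie algebra of \<open>Sp(N)\<close>, which is spanned by the differences of
  matrix units \<open>E\<^sub>x\<^sub>y - s\<^sub>x s\<^sub>y E\<^sub>y\<^sub>'\<^sub>x\<^sub>'\<close>.\<close>

definition sp_invariant :: "int set \<Rightarrow> ((int \<Rightarrow> 'n \<times> bool) \<Rightarrow> real) \<Rightarrow> bool" where
  "sp_invariant J T \<longleftrightarrow> (\<forall>x y z. elem_act J x y T z
    = bsgn x * bsgn y * elem_act J (flip y) (flip x) T z)"

definition contract :: "int \<Rightarrow> int \<Rightarrow> ((int \<Rightarrow> 'n \<times> bool) \<Rightarrow> real) \<Rightarrow> (int \<Rightarrow> 'n::finite \<times> bool) \<Rightarrow> real" where
  "contract k l T z = (\<Sum>u\<in>UNIV. bsgn u * T (z(k := u, l := flip u)))"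

lemma flip_flip [simp]: "flip (flip x) = x"
  by (simp add: flip_def)

lemma flip_neq [simp]: "flip x \<noteq> x" "x \<noteq> flip x"
  by (simp_all add: flip_def prod_eq_iff)

lemma flip_eq_iff: "flip x = y \<longleftrightarrow> x = flip y"
  by (auto simp: flip_def)

lemma flip_inject [simp]: "flip x = flip y \<longleftrightarrow> x = y"
  by (auto simp: flip_def prod_eq_iff)

lemma bij_flip: "bij flip"
  by (rule involuntory_imp_bij) simp

lemma bsgn_flip [simp]: "bsgn (flip x) = - bsgn x"
  by (simp add: flip_def bsgn_def)

lemma bsgn_sq [simp]: "bsgn x * bsgn x = 1" "bsgn x * (bsgn x * t) = t"
  by (simp_all add: bsgn_def)

lemma sform_swap: "sform x y = - sform y x"
  by (auto simp: sform_def)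

lemma agree_off_refl [simp]: "z \<in> agree_off J z"
  by (simp add: agree_off_def)

lemma agree_off_empty [simp]: "agree_off {} z = {z}"
  by (auto simp: agree_off_def)

lemma agree_off_eq: "y \<in> agree_off J z \<Longrightarrow> agree_off J y = agree_off J z"
  by (auto simp: agree_off_def)

lemma agree_off_insert:
  "k \<notin> J \<Longrightarrow> bij_betw (\<lambda>(y, u). y(k := u)) (agree_off J z \<times> UNIV) (agree_off (insert k J) z)"
  by (rule bij_betwI[where g = "\<lambda>y. (y(k := z k), y k)"]) (auto simp: agree_off_def fun_eq_iff)

lemma finite_agree_off:
  "finite J \<Longrightarrow> finite (agree_off J (z :: int \<Rightarrow> 'b::finite))"
proof (induction J rule: finite_induct)
  case (insert k J)
  then show ?case
    using bij_betw_finite[OF agree_off_insert[of k J z]] by simp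
qed simp

lemma sum_agree_off_insert:
  fixes g :: "(int \<Rightarrow> 'b::finite) \<Rightarrow> 'c::comm_monoid_add"
  assumes "k \<notin> J"
  shows "(\<Sum>y\<in>agree_off (insert k J) z. g y) = (\<Sum>y\<in>agree_off J z. \<Sum>u\<in>UNIV. g (y(k := u)))"
  using sum.reindex_bij_betw[OF agree_off_insert[OF assms], of g z]
  by (simp add: sum.cartesian_product case_prod_unfold)

lemma sum_agree_off_remove:
  fixes g :: "(int \<Rightarrow> 'b::finite) \<Rightarrow> 'c::comm_monoid_add"
  assumes "k \<in> J"
  shows "(\<Sum>y\<in>agree_off J z. g y) = (\<Sum>y\<in>agree_off (J - {k}) z. \<Sum>u\<in>UNIV. g (y(k := u)))"
  using sum_agree_off_insert[of k "J - {k}" g z] assms by (simp add: insert_absorb)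

lemma sum_agree_off_Un:
  fixes g :: "(int \<Rightarrow> 'b::finite) \<Rightarrow> 'c::comm_monoid_add"
  assumes "finite J" "finite K" "J \<inter> K = {}"
  shows "(\<Sum>y\<in>agree_off (J \<union> K) z. g y) = (\<Sum>y\<in>agree_off K z. \<Sum>x\<in>agree_off J y. g x)"
proof -
  have "bij_betw snd (SIGMA y:agree_off K z. agree_off J y) (agree_off (J \<union> K) z)"
    by (rule bij_betwI[where g = "\<lambda>x. (\<lambda>k. if k \<in> J then z k else x k, x)"])
      (use assms(3) in \<open>auto simp: agree_off_def fun_eq_iff disjoint_iff\<close>)
  from sum.reindex_bij_betw[OF this, of g] show ?thesis
    using assms by (simp add: sum.Sigma finite_agree_off case_prod_unfold)
qed

lemma sum_swap_pairs:
  "(\<Sum>x\<in>A. \<Sum>v\<in>B. \<Sum>k\<in>C. \<Sum>l\<in>D. f x v k l) = (\<Sum>k\<in>C. \<Sum>l\<in>D. \<Sum>x\<in>A. \<Sum>v\<in>B. f x v k l)"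
  using sum.swap[of "\<lambda>xv kl. f (fst xv) (snd xv) (fst kl) (snd kl)" "C \<times> D" "A \<times> B"]
  by (simp add: sum.cartesian_product')

text \<open>The core of the first fundamental theorem. Invariance rewrites \<open>(E\<^sub>x\<^sub>v T)\<^sup>2\<close> as a product of two different
  sums over slots; after summation over \<open>x\<close> and \<open>v\<close> the term of the slots \<open>k\<close> and \<open>l\<close> is \<open>F k l\<close>. For
  \<open>k \<noteq> l\<close> the sum over the index at \<open>k\<close> has a contraction as a factor. For \<open>k = l\<close> it is minus a square.
  A sum of squares is thus minus a sum of squares, and all of them vanish.\<close>

lemma sp_invariant_no_contractions_zero:
  fixes T :: "(int \<Rightarrow> 'n::finite \<times> bool) \<Rightarrow> real"
  assumes fin: "finite J" and ne: "J \<noteq> {}" and inv: "sp_invariant J T"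
    and contr: "\<And>k l z. k \<in> J \<Longrightarrow> l \<in> J \<Longrightarrow> k \<noteq> l \<Longrightarrow> contract k l T z = 0"
  shows "T z = 0"
proof -
  define S where "S = agree_off J z"
  have finS: "finite S"
    using fin by (simp add: S_def finite_agree_off)
  define F where "F k l y = bsgn (y k) * bsgn (flip (y l)) * T (y(k := flip (y l))) * T (y(l := flip (y k)))"
    for k l and y :: "int \<Rightarrow> 'n \<times> bool"
  have delta: "(\<Sum>x\<in>UNIV. \<Sum>v\<in>UNIV. (if a = x then f v else 0) * (bsgn x * bsgn v * (if b = flip v then g x else 0)))
      = bsgn a * bsgn (flip b) * f (flip b) * g a" for a b :: "'n \<times> bool" and f g
  proof -
    have *: "(if a = x then f v else 0) * (bsgn x * bsgn v * (if b = flip v then g x else 0))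
        = (if x = a then (if v = flip b then bsgn a * bsgn (flip b) * f (flip b) * g a else 0) else 0)"
      for x v
      by (auto simp: flip_eq_iff)
    then have "(\<Sum>v\<in>UNIV. (if a = x then f v else 0) * (bsgn x * bsgn v * (if b = flip v then g x else 0)))
        = (if x = a then bsgn a * bsgn (flip b) * f (flip b) * g a else 0)" for x
      by (simp only: *) (cases "x = a"; simp)
    then show ?thesis
      by simp
  qed
  have sq: "(\<Sum>x\<in>UNIV. \<Sum>v\<in>UNIV. (elem_act J x v T y)\<^sup>2) = (\<Sum>k\<in>J. \<Sum>l\<in>J. F k l y)" for y
  proof -
    have "(elem_act J x v T y)\<^sup>2 = (\<Sum>k\<in>J. \<Sum>l\<in>J. (if y k = x then T (y(k := v)) else 0) *
        (bsgn x * bsgn v * (if y l = flip v then T (y(l := flip x)) else 0)))" for x v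
    proof -
      have "(elem_act J x v T y)\<^sup>2 = elem_act J x v T y * (bsgn x * bsgn v * elem_act J (flip v) (flip x) T y)"
        using inv unfolding sp_invariant_def by (metis power2_eq_square)
      also have "\<dots> = (\<Sum>k\<in>J. if y k = x then T (y(k := v)) else 0)
          * (\<Sum>l\<in>J. bsgn x * bsgn v * (if y l = flip v then T (y(l := flip x)) else 0))"
        by (simp only: elem_act_def sum_distrib_left)
      finally show ?thesis
        by (simp only: sum_product)
    qed
    then have "(\<Sum>x\<in>UNIV. \<Sum>v\<in>UNIV. (elem_act J x v T y)\<^sup>2)
        = (\<Sum>x\<in>UNIV. \<Sum>v\<in>UNIV. \<Sum>k\<in>J. \<Sum>l\<in>J. (if y k = x then T (y(k := v)) else 0) *
        (bsgn x * bsgn v * (if y l = flip v then T (y(l := flip x)) else 0)))"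
      by simp
    also have "\<dots> = (\<Sum>k\<in>J. \<Sum>l\<in>J. \<Sum>x\<in>UNIV. \<Sum>v\<in>UNIV. (if y k = x then T (y(k := v)) else 0) *
        (bsgn x * bsgn v * (if y l = flip v then T (y(l := flip x)) else 0)))"
      by (rule sum_swap_pairs)
    finally show ?thesis
      by (simp add: delta F_def)
  qed
  have off_diag: "(\<Sum>y\<in>S. F k l y) = 0" if "k \<in> J" "l \<in> J" "k \<noteq> l" for k l
  proof -
    have "(\<Sum>y\<in>S. F k l y) = (\<Sum>y\<in>agree_off (J - {k}) z. \<Sum>u\<in>UNIV. F k l (y(k := u)))"
      unfolding S_def by (rule sum_agree_off_remove[OF that(1)])
    also have "\<dots> = (\<Sum>y\<in>agree_off (J - {k}) z. bsgn (flip (y l)) * T (y(k := flip (y l))) * contract k l T y)"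
      using that by (intro sum.cong) (auto simp: F_def contract_def sum_distrib_left intro!: sum.cong)
    finally show ?thesis
      using contr[OF that] by simp
  qed
  have "(\<Sum>y\<in>S. \<Sum>x\<in>UNIV. \<Sum>v\<in>UNIV. (elem_act J x v T y)\<^sup>2) = (\<Sum>y\<in>S. \<Sum>k\<in>J. \<Sum>l\<in>J. F k l y)"
    by (simp add: sq)
  also have "\<dots> = (\<Sum>k\<in>J. \<Sum>y\<in>S. \<Sum>l\<in>J. F k l y)"
    by (rule sum.swap)
  also have "\<dots> = (\<Sum>k\<in>J. \<Sum>l\<in>J. \<Sum>y\<in>S. F k l y)"
    by (intro sum.cong refl sum.swap)
  also have "\<dots> = (\<Sum>k\<in>J. \<Sum>l\<in>J. if l = k then \<Sum>y\<in>S. F k k y else 0)"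
    using off_diag by (intro sum.cong) auto
  also have "\<dots> = (\<Sum>k\<in>J. \<Sum>y\<in>S. F k k y)"
    using fin by simp
  also have "\<dots> = - (\<Sum>k\<in>J. \<Sum>y\<in>S. (T (y(k := flip (y k))))\<^sup>2)"
    by (simp add: F_def power2_eq_square sum_negf)
  finally have "(\<Sum>y\<in>S. \<Sum>x\<in>UNIV. \<Sum>v\<in>UNIV. (elem_act J x v T y)\<^sup>2)
      + (\<Sum>k\<in>J. \<Sum>y\<in>S. (T (y(k := flip (y k))))\<^sup>2) = 0"
    by simp
  moreover have "(\<Sum>y\<in>S. \<Sum>x\<in>UNIV. \<Sum>v\<in>UNIV. (elem_act J x v T y)\<^sup>2) \<ge> 0"
    "(\<Sum>k\<in>J. \<Sum>y\<in>S. (T (y(k := flip (y k))))\<^sup>2) \<ge> 0"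
    by (intro sum_nonneg zero_le_power2)+
  ultimately have "(\<Sum>k\<in>J. \<Sum>y\<in>S. (T (y(k := flip (y k))))\<^sup>2) = 0"
    by linarith
  then have zero: "(\<Sum>y\<in>S. (T (y(k := flip (y k))))\<^sup>2) = 0" if "k \<in> J" for k
    using that fin by (subst (asm) sum_nonneg_eq_0_iff) (auto intro: sum_nonneg)
  obtain k where k: "k \<in> J"
    using ne by blast
  then have "z(k := flip (z k)) \<in> S"
    by (simp add: S_def agree_off_def)
  then have "T ((z(k := flip (z k)))(k := flip ((z(k := flip (z k))) k))) = 0"
    using zero[OF k] finS by (subst (asm) sum_nonneg_eq_0_iff) auto
  then show "T z = 0"
    by simp
qed

text \<open>Contraction commutes with the action on the remaining slots; the terms of the two contracted slots
  cancel because the form is itself invariant.\<close>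

lemma sp_invariant_contract:
  fixes T :: "(int \<Rightarrow> 'n::finite \<times> bool) \<Rightarrow> real"
  assumes fin: "finite J" and kl: "k \<in> J" "l \<in> J" "k \<noteq> l" and inv: "sp_invariant J T"
  shows "sp_invariant (J - {k, l}) (contract k l T)"
proof -
  define D where "D x y z = bsgn x * (T (z(k := y, l := flip x)) - T (z(k := flip x, l := y)))"
    for x y and z :: "int \<Rightarrow> 'n \<times> bool"
  have split: "(\<Sum>u\<in>UNIV. bsgn u * elem_act J x y T (z(k := u, l := flip u)))
      = elem_act (J - {k, l}) x y (contract k l T) z + D x y z" for x y z
  proof -
    have J: "J = insert k (insert l (J - {k, l}))"
      using kl by auto
    have "elem_act J x y T (z(k := u, l := flip u)) =
        (if u = x then T (z(k := y, l := flip x)) else 0) +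
        (if u = flip x then T (z(k := flip x, l := y)) else 0) +
        (\<Sum>i\<in>J - {k, l}. if z i = x then T (z(i := y, k := u, l := flip u)) else 0)" for u
    proof -
      have "(\<Sum>i\<in>J - {k, l}. if (z(k := u, l := flip u)) i = x then T (z(k := u, l := flip u, i := y)) else 0)
          = (\<Sum>i\<in>J - {k, l}. if z i = x then T (z(i := y, k := u, l := flip u)) else 0)"
      proof (intro sum.cong refl)
        fix i assume "i \<in> J - {k, l}"
        then have "z(k := u, l := flip u, i := y) = z(i := y, k := u, l := flip u)"
          by (auto simp: fun_eq_iff)
        then show "(if (z(k := u, l := flip u)) i = x then T (z(k := u, l := flip u, i := y)) else 0)
            = (if z i = x then T (z(i := y, k := u, l := flip u)) else 0)"
          using \<open>i \<in> J - {k, l}\<close> by simp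
      qed
      moreover have "z(k := u, l := flip u, k := y) = z(k := y, l := flip u)"
        using kl by (auto simp: fun_eq_iff)
      ultimately show ?thesis
        unfolding elem_act_def
        by (subst J, subst sum.insert, use fin in simp, use kl in simp,
            subst sum.insert, use fin in simp, use kl in simp) (use kl in \<open>auto simp: flip_eq_iff\<close>)
    qed
    then have "(\<Sum>u\<in>UNIV. bsgn u * elem_act J x y T (z(k := u, l := flip u))) =
        (\<Sum>u\<in>UNIV. if u = x then bsgn x * T (z(k := y, l := flip x)) else 0)
        + (\<Sum>u\<in>UNIV. if u = flip x then - bsgn x * T (z(k := flip x, l := y)) else 0)
        + (\<Sum>u\<in>UNIV. \<Sum>i\<in>J - {k, l}. bsgn u * (if z i = x then T (z(i := y, k := u, l := flip u)) else 0))"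
      unfolding sum.distrib[symmetric] by (intro sum.cong) (auto simp: algebra_simps sum_distrib_left)
    also have "(\<Sum>u\<in>UNIV. \<Sum>i\<in>J - {k, l}. bsgn u * (if z i = x then T (z(i := y, k := u, l := flip u)) else 0))
        = (\<Sum>i\<in>J - {k, l}. if z i = x then contract k l T (z(i := y)) else 0)"
    proof (subst sum.swap, intro sum.cong refl)
      fix i
      show "(\<Sum>u\<in>UNIV. bsgn u * (if z i = x then T (z(i := y, k := u, l := flip u)) else 0))
          = (if z i = x then contract k l T (z(i := y)) else 0)"
        by (cases "z i = x") (simp_all add: contract_def)
    qed
    also have "(\<Sum>u\<in>UNIV. if u = x then bsgn x * T (z(k := y, l := flip x)) else 0)
        = bsgn x * T (z(k := y, l := flip x))"
      by simp
    also have "(\<Sum>u\<in>UNIV. if u = flip x then - bsgn x * T (z(k := flip x, l := y)) else 0)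
        = - bsgn x * T (z(k := flip x, l := y))"
      by simp
    finally show ?thesis
      unfolding D_def elem_act_def[of "J - {k, l}"] right_diff_distrib by linarith
  qed
  have D: "D x y z = bsgn x * bsgn y * D (flip y) (flip x) z" for x y z
    by (simp add: D_def algebra_simps)
  show ?thesis
    unfolding sp_invariant_def
  proof (intro allI)
    fix x y z
    have "(\<Sum>u\<in>UNIV. bsgn u * elem_act J x y T (z(k := u, l := flip u)))
        = bsgn x * bsgn y * (\<Sum>u\<in>UNIV. bsgn u * elem_act J (flip y) (flip x) T (z(k := u, l := flip u)))"
      unfolding sum_distrib_left
    proof (intro sum.cong refl)
      fix u
      have "elem_act J x y T (z(k := u, l := flip u))
          = bsgn x * bsgn y * elem_act J (flip y) (flip x) T (z(k := u, l := flip u))"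
        using inv unfolding sp_invariant_def by blast
      then show "bsgn u * elem_act J x y T (z(k := u, l := flip u))
          = bsgn x * bsgn y * (bsgn u * elem_act J (flip y) (flip x) T (z(k := u, l := flip u)))"
        by simp
    qed
    then show "elem_act (J - {k, l}) x y (contract k l T) z
        = bsgn x * bsgn y * elem_act (J - {k, l}) (flip y) (flip x) (contract k l T) z"
      unfolding split using D[of x y z] by (simp add: algebra_simps)
  qed
qed

text \<open>A half picks one element from each pair of \<open>p\<close>. It orients the pairs, which matters because the form
  is antisymmetric.\<close>

definition half :: "(int \<Rightarrow> int) \<Rightarrow> int set \<Rightarrow> int set \<Rightarrow> bool" where
  "half p J H \<longleftrightarrow> H \<subseteq> J \<and> p ` H = J - H"

definition pairing_tensor :: "(int \<Rightarrow> int) \<Rightarrow> int set \<Rightarrow> (int \<Rightarrow> 'n \<times> bool) \<Rightarrow> real" where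
  "pairing_tensor p H z = (\<Prod>m\<in>H. sform (z m) (z (p m)))"

lemma pairingsD:
  assumes "p \<in> pairings J"
  shows "p permutes J" "p (p k) = k" "k \<in> J \<Longrightarrow> p k \<noteq> k" "p k \<in> J \<longleftrightarrow> k \<in> J" "inj_on p A"
    "p k = p l \<longleftrightarrow> k = l"
proof -
  show p: "p permutes J" and pp: "p (p k) = k" for k
    using assms by (auto simp: pairings_def fun_eq_iff)
  show "k \<in> J \<Longrightarrow> p k \<noteq> k"
    using assms by (auto simp: pairings_def)
  show "p k \<in> J \<longleftrightarrow> k \<in> J"
    using p by (rule permutes_in_image)
  show "inj_on p A" "p k = p l \<longleftrightarrow> k = l"
    by (metis inj_onI pp)+
qed

lemma finite_pairings: "finite J \<Longrightarrow> finite (pairings J)"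
  unfolding pairings_def by (rule finite_subset[OF _ finite_permutations]) auto

lemma half_iff:
  assumes "p \<in> pairings J" "half p J H" "k \<in> J"
  shows "p k \<in> H \<longleftrightarrow> k \<notin> H"
proof -
  have "p ` H = J - H"
    using assms by (simp add: half_def)
  then have "k \<notin> H \<longleftrightarrow> k \<in> p ` H"
    using assms by auto
  also have "\<dots> \<longleftrightarrow> p k \<in> H"
    using pairingsD(2)[OF assms(1)] by (metis imageE imageI)
  finally show ?thesis
    by simp
qed

lemma half_altdef:
  assumes "p \<in> pairings J"
  shows "half p J H \<longleftrightarrow> H \<subseteq> J \<and> (\<forall>k\<in>J. p k \<in> H \<longleftrightarrow> k \<notin> H)"
proof
  assume H: "H \<subseteq> J \<and> (\<forall>k\<in>J. p k \<in> H \<longleftrightarrow> k \<notin> H)"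
  have "J - H \<subseteq> p ` H"
  proof
    fix k assume "k \<in> J - H"
    then have "p k \<in> H" "k = p (p k)"
      using H pairingsD(2)[OF assms] by auto
    then show "k \<in> p ` H"
      by blast
  qed
  moreover have "p ` H \<subseteq> J - H"
    using H pairingsD(2,4)[OF assms] by auto
  ultimately show "half p J H"
    using H by (auto simp: half_def)
qed (use half_iff[OF assms] in \<open>auto simp: half_def\<close>)

lemma sum_half:
  fixes g :: "int \<Rightarrow> 'c::comm_monoid_add"
  assumes "finite J" "p \<in> pairings J" "half p J H"
  shows "(\<Sum>k\<in>J. g k) = (\<Sum>m\<in>H. g m + g (p m))"
proof -
  have J: "J = H \<union> p ` H" "H \<inter> p ` H = {}"
    using assms(3) by (auto simp: half_def)
  have "finite H"
    using assms(1) J(1) by (metis finite_Un)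
  then have "(\<Sum>k\<in>J. g k) = (\<Sum>m\<in>H. g m) + (\<Sum>m\<in>p ` H. g m)"
    using J by (subst J(1)) (simp add: sum.union_disjoint)
  also have "(\<Sum>m\<in>p ` H. g m) = (\<Sum>m\<in>H. g (p m))"
    using pairingsD(5)[OF assms(2), of H] by (simp add: sum.reindex)
  finally show ?thesis
    by (simp add: sum.distrib)
qed

text \<open>The action on the two slots of a pair meets a single factor, and there it expresses the invariance
  of the form.\<close>

lemma sp_invariant_pairing_tensor:
  assumes fin: "finite J" and p: "p \<in> pairings J" and H: "half p J H"
  shows "sp_invariant J (pairing_tensor p H :: (int \<Rightarrow> 'n \<times> bool) \<Rightarrow> real)"
proof -
  have finH: "finite H"
    using fin H by (auto simp: half_def intro: finite_subset)
  define R where "R z m = (\<Prod>i\<in>H - {m}. sform (z i) (z (p i)))" for z :: "int \<Rightarrow> 'n \<times> bool" and m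
  define L where "L x y a b = (if a = x then sform y b else 0) + (if b = x then sform a y else 0)"
    for x y a b :: "'n \<times> bool"
  have act: "elem_act J x y (pairing_tensor p H) z = (\<Sum>m\<in>H. R z m * L x y (z m) (z (p m)))" for x y z
    unfolding elem_act_def sum_half[OF fin p H]
  proof (intro sum.cong refl)
    fix m assume m: "m \<in> H"
    then have mJ: "m \<in> J" "p m \<notin> H" "p m \<noteq> m"
      using H pairingsD(3)[OF p] half_iff[OF p H] by (auto simp: half_def)
    have other: "p i \<noteq> m" "p i \<noteq> p m" "i \<noteq> p m" if "i \<in> H - {m}" for i
      using that m mJ half_iff[OF p H] pairingsD(6)[OF p] H by (auto simp: half_def)
    have "pairing_tensor p H (z(m := y)) = R z m * sform y (z (p m))"
      unfolding pairing_tensor_def R_def using finH m mJ other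
      by (subst prod.remove[of H m]) (auto intro!: prod.cong)
    moreover have "pairing_tensor p H (z(p m := y)) = R z m * sform (z m) y"
      unfolding pairing_tensor_def R_def using finH m mJ other
      by (subst prod.remove[of H m]) (auto intro!: prod.cong)
    ultimately show "(if z m = x then pairing_tensor p H (z(m := y)) else 0)
        + (if z (p m) = x then pairing_tensor p H (z(p m := y)) else 0) = R z m * L x y (z m) (z (p m))"
      by (simp add: L_def algebra_simps)
  qed
  have L: "L x y a b = bsgn x * bsgn y * L (flip y) (flip x) a b" for x y a b
    by (auto simp: L_def sform_def flip_eq_iff)
  show ?thesis
    unfolding sp_invariant_def act sum_distrib_left
    by (intro allI sum.cong refl) (subst L, simp)
qed

text \<open>Contracting the slots \<open>k\<close> and \<open>l\<close> is adjoint to multiplying by the form in these slots. So a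
  contraction of a tensor orthogonal to all pairing tensors is orthogonal to those on the remaining
  slots and vanishes by induction. The half may be any, since it only affects the sign of the pairing
  tensor.\<close>

theorem sp_invariant_orthogonal_zero:
  fixes T :: "(int \<Rightarrow> 'n::finite \<times> bool) \<Rightarrow> real"
  assumes "finite J" "sp_invariant J T"
    and "\<And>p. p \<in> pairings J \<Longrightarrow>
      \<exists>H. half p J H \<and> (\<forall>z. (\<Sum>y\<in>agree_off J z. pairing_tensor p H y * T y) = 0)"
  shows "T z = 0"
  using assms
proof (induction "card J" arbitrary: J T z rule: less_induct)
  case less
  show ?case
  proof (cases "J = {}")
    case True
    then have "id \<in> pairings J"
      by (auto simp: pairings_def permutes_id)
    from less.prems(3)[OF this] True show ?thesis
      by (auto simp: half_def pairing_tensor_def)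
  next
    case False
    have "contract k l T z = 0" if kl: "k \<in> J" "l \<in> J" "k \<noteq> l" for k l z
    proof (rule less.hyps)
      let ?J = "J - {k, l}"
      have "?J \<subset> J"
        using kl by auto
      then show "card ?J < card J" "finite ?J"
        using less.prems(1) by (auto simp: psubset_card_mono)
      show "sp_invariant ?J (contract k l T)"
        by (rule sp_invariant_contract) (use less.prems kl in auto)
      fix q assume q: "q \<in> pairings ?J"
      define p where "p = Transposition.transpose k l \<circ> q"
      have q_kl: "q k = k" "q l = l"
        using pairingsD(1)[OF q] by (auto simp: permutes_def)
      have q_other: "q i \<noteq> k" "q i \<noteq> l" if "i \<noteq> k" "i \<noteq> l" for i
        using that q_kl pairingsD(2)[OF q] by metis+
      have pk: "p k = l" "p l = k" and p_other: "p i = q i" if "i \<noteq> k" "i \<noteq> l" for i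
        using q_kl q_other that by (auto simp: p_def transpose_def)
      have "p permutes J"
        unfolding p_def
        by (rule permutes_compose[OF permutes_subset[OF pairingsD(1)[OF q]]])
          (use kl in \<open>auto intro: permutes_swap_id\<close>)
      moreover have "p (p i) = i" for i
        using pk p_other[of i] p_other[of "q i"] q_other[of i] pairingsD(2)[OF q, of i] q_kl
        by (cases "i = k \<or> i = l") (auto simp: p_def)
      moreover have "p i \<noteq> i" if "i \<in> J" for i
        using that pk p_other[of i] pairingsD(3)[OF q, of i] kl q_kl
        by (cases "i = k \<or> i = l") (auto simp: p_def)
      ultimately have p: "p \<in> pairings J"
        by (auto simp: pairings_def fun_eq_iff)
      from less.prems(3)[OF this] obtain H where H: "half p J H"
        and orth: "\<And>z. (\<Sum>y\<in>agree_off J z. pairing_tensor p H y * T y) = 0"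
        by blast
      have pk: "p k = l" "p l = k"
        using q_kl by (auto simp: p_def)
      have half': "half q ?J (H - {k, l})"
        unfolding half_altdef[OF q]
      proof (intro conjI ballI)
        fix i assume i: "i \<in> ?J"
        then show "q i \<in> H - {k, l} \<longleftrightarrow> i \<notin> H - {k, l}"
          using half_iff[OF p H, of i] p_other[of i] q_other[of i] by auto
      qed (use H in \<open>auto simp: half_def\<close>)
      \<comment> \<open>The pair \<open>{k, l}\<close> may be oriented either way by \<open>H\<close>.\<close>
      define c :: real where "c = (if k \<in> H then 1 else - 1)"
      have pairing_tensor: "pairing_tensor p H (y(l := v, k := u)) = c * sform u v * pairing_tensor q (H - {k, l}) y" for y u v
      proof -
        have finH: "finite H"
          using H less.prems(1) by (auto simp: half_def intro: finite_subset)
        have rest: "(\<Prod>i\<in>H - {k, l}. sform ((y(l := v, k := u)) i) ((y(l := v, k := u)) (p i)))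
            = pairing_tensor q (H - {k, l}) y"
          unfolding pairing_tensor_def using p_other q_other by (intro prod.cong) auto
        show ?thesis
        proof (cases "k \<in> H")
          case True
          then have "l \<notin> H"
            using half_iff[OF p H kl(1)] pk by simp
          then have "H - {k} = H - {k, l}"
            by auto
          then show ?thesis
            unfolding pairing_tensor_def[of p] prod.remove[OF finH True]
            using rest True kl pk by (simp add: c_def)
        next
          case False
          then have "l \<in> H"
            using half_iff[OF p H kl(1)] pk by simp
          moreover have "H - {l} = H - {k, l}"
            using False by auto
          ultimately show ?thesis
            using prod.remove[OF finH \<open>l \<in> H\<close>, of "\<lambda>i. sform ((y(l := v, k := u)) i) ((y(l := v, k := u)) (p i))"]
              rest False kl pk sform_swap[of v u]
            by (simp add: c_def pairing_tensor_def[of p])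
        qed
      qed
      show "\<exists>H. half q ?J H \<and> (\<forall>z. (\<Sum>y\<in>agree_off ?J z. pairing_tensor q H y * contract k l T y) = 0)"
      proof (intro exI conjI allI)
        fix z
        have J: "J = insert k (insert l ?J)"
          using kl by auto
        have "0 = (\<Sum>y\<in>agree_off (insert k (insert l ?J)) z. pairing_tensor p H y * T y)"
          using orth[of z] J by simp
        also have "\<dots> = (\<Sum>y\<in>agree_off ?J z. \<Sum>v\<in>UNIV. \<Sum>u\<in>UNIV.
            pairing_tensor p H (y(l := v, k := u)) * T (y(l := v, k := u)))"
          using kl by (simp add: sum_agree_off_insert)
        also have "\<dots> = (\<Sum>y\<in>agree_off ?J z. c * (pairing_tensor q (H - {k, l}) y * contract k l T y))"
        proof (intro sum.cong refl)
          fix y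
          have "(\<Sum>v\<in>UNIV. \<Sum>u\<in>UNIV. pairing_tensor p H (y(l := v, k := u)) * T (y(l := v, k := u)))
              = (\<Sum>u\<in>UNIV. \<Sum>v\<in>UNIV. pairing_tensor p H (y(l := v, k := u)) * T (y(l := v, k := u)))"
            by (rule sum.swap)
          also have "\<dots> = (\<Sum>u\<in>UNIV. \<Sum>v\<in>UNIV. if v = flip u then
              c * pairing_tensor q (H - {k, l}) y * (bsgn u * T (y(k := u, l := flip u))) else 0)"
          proof (intro sum.cong refl)
            fix u v
            have "y(l := flip u, k := u) = y(k := u, l := flip u)"
              using kl by (intro fun_upd_twist) simp
            then show "pairing_tensor p H (y(l := v, k := u)) * T (y(l := v, k := u)) = (if v = flip u then
              c * pairing_tensor q (H - {k, l}) y * (bsgn u * T (y(k := u, l := flip u))) else 0)"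
              unfolding pairing_tensor by (simp add: sform_def del: fun_upd_apply)
          qed
          finally show "(\<Sum>v\<in>UNIV. \<Sum>u\<in>UNIV. pairing_tensor p H (y(l := v, k := u)) * T (y(l := v, k := u)))
              = c * (pairing_tensor q (H - {k, l}) y * contract k l T y)"
            by (simp add: contract_def sum_distrib_left algebra_simps)
        qed
        also have "\<dots> = c * (\<Sum>y\<in>agree_off ?J z. pairing_tensor q (H - {k, l}) y * contract k l T y)"
          by (simp add: sum_distrib_left)
        finally show "(\<Sum>y\<in>agree_off ?J z. pairing_tensor q (H - {k, l}) y * contract k l T y) = 0"
          by (auto simp: c_def split: if_splits)
      qed (rule half')
    qed
    then show ?thesis
      using sp_invariant_no_contractions_zero[OF less.prems(1) False less.prems(2)] by blast
  qed
qed

section \<open>Signs of permutations and pairs of pairings\<close>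

lemma orbit_eq_orbit:
  assumes "permutation f" "y \<in> orbit f x"
  shows "orbit f y = orbit f x"
proof -
  have "x \<in> orbit f y"
    by (rule orbit_swap[OF permutation_self_in_orbit[OF assms(1)] assms(2)])
  then show ?thesis
    using orbit_trans[OF _ assms(2)] orbit_trans[of _ f x y] by blast
qed

lemma permutes_permutation: "f permutes S \<Longrightarrow> finite S \<Longrightarrow> permutation f"
  by (auto simp: permutation_permutes)

lemma num_orbits_cong:
  assumes "\<And>x. x \<in> S \<Longrightarrow> f x \<in> S" "\<And>x. x \<in> S \<Longrightarrow> f x = g x"
  shows "num_orbits S f = num_orbits S g"
proof -
  have "orbit f x = orbit g x" if "x \<in> S" for x
    using orbit_cong0[of x S f g] assms that by auto
  then show ?thesis
    unfolding num_orbits_def by (simp cong: image_cong)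
qed

text \<open>Composing with a transposition takes the new point out of its cycle: the number of orbits is kept,
  while the sign and the number of points change.\<close>

lemma sign_eq_num_orbits:
  assumes "finite S" "f permutes S"
  shows "sign f = (- 1) ^ (card S + num_orbits S f)"
  using assms
proof (induction S arbitrary: f rule: finite_induct)
  case empty
  then show ?case
    by (simp add: num_orbits_def)
next
  case (insert a S)
  have perm: "permutation f"
    using insert by (intro permutes_permutation[of f "insert a S"]) auto
  show ?case
  proof (cases "f a = a")
    case True
    then have f: "f permutes S"
      using insert.prems insert.hyps(2) by (metis insertE permutes_superset Diff_iff)
    have "orbit f a = {a}"
      using True by (simp add: orbit_eq_singleton_iff)
    moreover have "a \<notin> orbit f x" if "x \<in> S" for x
      using permutes_orbit_subset[OF f that] insert.hyps(2) by blast
    ultimately have "orbit f a \<notin> orbit f ` S"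
      by auto
    then have "num_orbits (insert a S) f = Suc (num_orbits S f)"
      using insert.hyps(1) by (simp add: num_orbits_def)
    then show ?thesis
      using insert.IH[OF f] insert.hyps by simp
  next
    case False
    define b where "b = f a"
    have b: "b \<in> S" "b \<noteq> a"
      using False insert.prems unfolding b_def by (metis insertE insertI1 permutes_in_image)+
    define g where "g = Transposition.transpose a b \<circ> f"
    have g: "g permutes S"
      unfolding g_def b_def by (rule permutes_insert_lemma[OF insert.prems])
    have f: "f = Transposition.transpose a b \<circ> g"
      by (simp add: g_def fun_eq_iff)
    \<comment> \<open>\<open>g\<close> skips \<open>a\<close> and agrees with \<open>f\<close> otherwise.\<close>
    have gx: "g x = (if f x = a then b else f x)" if "x \<noteq> a" for x
    proof -
      have "f x \<noteq> b"
        using that insert.prems by (metis b_def permutes_inj injD)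
      then show ?thesis
        by (simp add: g_def transpose_def)
    qed
    have orb1: "y \<in> orbit f x" if "y \<in> orbit g x" "x \<in> S" for x y
      using that(1)
    proof induction
      case base
      have "x \<noteq> a"
        using that insert.hyps by auto
      then show ?case
        using gx[of x] orbit.base[of f x] orbit.step[of "f x" f x] by (auto simp: b_def split: if_splits)
    next
      case (step y)
      have "y \<noteq> a"
        using step.hyps permutes_orbit_subset[OF g that(2)] insert.hyps by auto
      then show ?case
        using gx[of y] step.IH orbit.step[of _ f x] by (auto simp: b_def)
    qed
    have orb2: "if y = a then b \<in> orbit g x else y \<in> orbit g x" if "y \<in> orbit f x" "x \<in> S" for x y
      using that(1)
    proof induction
      case base
      have "x \<noteq> a"
        using that insert.hyps by auto
      then show ?case
        using gx[of x] orbit.base[of g x] by auto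
    next
      case (step y)
      show ?case
      proof (cases "y = a")
        case True
        then show ?thesis
          using step.IH b by (simp add: b_def)
      next
        case False
        then show ?thesis
          using step.IH gx[of y] orbit.step[of y g x] by auto
      qed
    qed
    have orb: "orbit g x = orbit f x - {a}" if "x \<in> S" for x
    proof (intro equalityI subsetI)
      fix y assume "y \<in> orbit f x - {a}"
      then show "y \<in> orbit g x"
        using orb2[OF _ that, of y] by simp
    qed (use orb1[OF _ that] permutes_orbit_subset[OF g that] insert.hyps in auto)
    have "orbit f a = orbit f b"
      using permutation_orbit_step[OF perm, of a] by (simp add: b_def)
    then have "orbit f ` insert a S = orbit f ` S"
      using b by auto
    moreover have "orbit g ` S = (\<lambda>X. X - {a}) ` orbit f ` S"
      using orb by (auto simp: image_image)
    moreover have "inj_on (\<lambda>X. X - {a}) (orbit f ` S)"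
    proof (rule inj_onI, clarsimp)
      fix x y assume xy: "x \<in> S" "y \<in> S" "orbit f x - {a} = orbit f y - {a}"
      have "x \<in> orbit f x - {a}"
        using xy insert.hyps permutation_self_in_orbit[OF perm, of x] by auto
      then show "orbit f x = orbit f y"
        using xy orbit_eq_orbit[OF perm, of x y] by auto
    qed
    ultimately have "num_orbits (insert a S) f = num_orbits S g"
      by (simp add: num_orbits_def card_image)
    moreover have "sign f = - sign g"
      using b permutes_permutation[OF g insert.hyps(1)]
      by (subst f) (simp add: sign_compose permutation_swap_id sign_swap_id)
    ultimately show ?thesis
      using insert.IH[OF g] insert.hyps by simp
  qed
qed

lemma join_blocks_commute: "join_blocks J p q = join_blocks J q p"
  by (simp add: join_blocks_def Un_commute)

lemma half_complement: "p \<in> pairings J \<Longrightarrow> half p J H \<Longrightarrow> half p J (J - H)"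
  using half_iff[of p J H] pairingsD(4)[of p J] by (auto simp: half_altdef)

lemma card_half:
  assumes "finite J" "p \<in> pairings J" "half p J H"
  shows "card J = 2 * card H"
  using sum_half[OF assms, of "\<lambda>_. 1 :: nat"] by simp

context
  fixes J :: "int set" and p q :: "int \<Rightarrow> int"
  assumes fin: "finite J" and p: "p \<in> pairings J" and q: "q \<in> pairings J"
begin

lemma pairing_product_permutes: "q \<circ> p permutes J"
  using pairingsD(1)[OF p] pairingsD(1)[OF q] by (rule permutes_compose)

lemma pairing_product_permutation: "permutation (q \<circ> p)"
  using pairing_product_permutes fin by (rule permutes_permutation)

lemma inv_pairing_product: "inv (q \<circ> p) = p \<circ> q"
  by (rule inv_unique_comp) (auto simp: fun_eq_iff pairingsD(2)[OF p] pairingsD(2)[OF q])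

lemma orbit_pairing_image: "orbit (q \<circ> p) (p x) = p ` orbit (q \<circ> p) x"
proof -
  have "p ` orbit (p \<circ> q) x = orbit (q \<circ> p) (p x)"
  proof (rule orbit_inverse)
    show "x \<in> orbit (p \<circ> q) x"
      using permutation_inverse[OF pairing_product_permutation]
      by (intro permutation_self_in_orbit) (simp add: inv_pairing_product)
  qed (simp add: pairingsD(2)[OF p])
  moreover have "orbit (p \<circ> q) x = orbit (q \<circ> p) x"
    using orbit_inv_eq[OF pairing_product_permutation, of x] by (simp add: inv_pairing_product)
  ultimately show ?thesis
    by simp
qed

text \<open>A product of two fixed-point-free involutions cannot carry \<open>x\<close> to \<open>p x\<close>: cancelling one
  factor at each end, \<open>(q \<circ> p) ^^ n\<close> would make \<open>p\<close> or \<open>q\<close> fix a point.\<close>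

lemma pairing_notin_orbit:
  assumes "x \<in> J"
  shows "p x \<notin> orbit (q \<circ> p) x"
proof -
  have "((q \<circ> p) ^^ n) x \<noteq> p x" if "x \<in> J" for n x
    using that
  proof (induction n arbitrary: x rule: induct_nat_012)
    case 0
    then show ?case
      using pairingsD(3)[OF p, of x] by simp
  next
    case 1
    then show ?case
      using pairingsD(3)[OF q, of "p x"] pairingsD(4)[OF p] by simp
  next
    case (ge2 n)
    let ?y = "q (p x)"
    have "?y \<in> J"
      using ge2.prems pairingsD(4)[OF p] pairingsD(4)[OF q] by simp
    then have *: "((q \<circ> p) ^^ n) ?y \<noteq> p ?y"
      by (rule ge2.IH)
    show ?case
    proof
      assume "((q \<circ> p) ^^ Suc (Suc n)) x = p x"
      moreover have "((q \<circ> p) ^^ Suc n) x = ((q \<circ> p) ^^ n) ?y"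
        by (simp add: funpow_swap1)
      moreover have "((q \<circ> p) ^^ Suc (Suc n)) x = q (p (((q \<circ> p) ^^ Suc n) x))"
        by simp
      ultimately have "q (p (((q \<circ> p) ^^ n) ?y)) = p x"
        by simp
      then show False
        using * by (metis pairingsD(2)[OF p] pairingsD(2)[OF q])
    qed
  qed
  from this[OF assms] show ?thesis
    unfolding orbit_altdef by (auto dest: sym)
qed

text \<open>The points \<open>x\<close> and \<open>p x\<close> lie in different orbits of \<open>q \<circ> p\<close>, which \<open>p\<close> and \<open>q\<close> exchange; comparing
  the minima of the two orbits selects one of them.\<close>

lemma common_half_exists: "\<exists>H. half p J H \<and> half q J H"
proof -
  let ?r = "q \<circ> p"
  define H where "H = {x \<in> J. Min (orbit ?r x) < Min (orbit ?r (p x))}"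
  have fin_orb: "finite (orbit ?r x)" for x
    by (rule finite_orbit, rule permutation_self_in_orbit, rule pairing_product_permutation)
  have neq: "Min (orbit ?r x) \<noteq> Min (orbit ?r (p x))" if "x \<in> J" for x
  proof
    assume "Min (orbit ?r x) = Min (orbit ?r (p x))"
    then obtain m where "m \<in> orbit ?r x" "m \<in> orbit ?r (p x)"
      using Min_in[OF fin_orb orbit_nonempty] by metis
    then have "orbit ?r x = orbit ?r (p x)"
      using orbit_eq_orbit[OF pairing_product_permutation] by metis
    then show False
      using pairing_notin_orbit[OF that] permutation_self_in_orbit[OF pairing_product_permutation] by metis
  qed
  have orb_q: "orbit ?r (q x) = orbit ?r (p x)" for x
    using permutation_orbit_step[OF pairing_product_permutation, of "p x"]
    by (simp add: pairingsD(2)[OF p])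
  have orb_pq: "orbit ?r (p (q x)) = orbit ?r x" for x
    using permutation_orbit_step[OF pairing_product_permutation, of "p (q x)"]
    by (simp add: pairingsD(2)[OF p] pairingsD(2)[OF q])
  have less: "Min (orbit ?r (p x)) < Min (orbit ?r x) \<longleftrightarrow> \<not> Min (orbit ?r x) < Min (orbit ?r (p x))"
    if "x \<in> J" for x
    using neq[OF that] by linarith
  have "half p J H" "half q J H"
    unfolding half_altdef[OF p] half_altdef[OF q]
    using pairingsD(4)[OF p] pairingsD(4)[OF q]
    by (auto simp: H_def less orb_q orb_pq pairingsD(2)[OF p])
  then show ?thesis
    by blast
qed

context
  fixes H :: "int set"
  assumes pH: "half p J H" and qH: "half q J H"
begin

lemma pairing_product_half: "x \<in> H \<Longrightarrow> q (p x) \<in> H"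
  using pH half_iff[OF p pH, of x] half_iff[OF q qH, of "p x"] pairingsD(4)[OF p, of x]
  by (auto simp: half_def)

lemma orbit_half_subset: "x \<in> H \<Longrightarrow> orbit (q \<circ> p) x \<subseteq> H"
proof
  fix y assume "y \<in> orbit (q \<circ> p) x" "x \<in> H"
  then show "y \<in> H"
    by induction (auto intro: pairing_product_half)
qed

text \<open>A block of the join consists of an orbit contained in \<open>H\<close> and of the image of that orbit under \<open>p\<close>.\<close>

lemma join_blocks_eq_num_orbits: "join_blocks J p q = num_orbits H (q \<circ> p)"
proof -
  let ?r = "q \<circ> p"
  define R where "R = {(k, p k) |k. k \<in> J} \<union> {(k, q k) |k. k \<in> J}"
  define cls where "cls X = X \<union> p ` X" for X
  have HJ: "H \<subseteq> J"
    using pH by (simp add: half_def)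
  have cls: "R\<^sup>* `` {x} = cls (orbit ?r x)" if x: "x \<in> H" for x
  proof (intro equalityI subsetI)
    fix y assume "y \<in> R\<^sup>* `` {x}"
    then have "(x, y) \<in> R\<^sup>*"
      by simp
    then show "y \<in> cls (orbit ?r x)"
    proof (induction rule: rtrancl_induct)
      case base
      then show ?case
        using permutation_self_in_orbit[OF pairing_product_permutation, of x] unfolding cls_def by blast
    next
      case (step y z)
      have "q y \<in> p ` orbit ?r x" if "y \<in> orbit ?r x"
      proof -
        have "p (q y) \<in> orbit (inv ?r) y"
          using orbit.base[of "p \<circ> q" y] by (simp add: inv_pairing_product)
        then have "p (q y) \<in> orbit ?r x"
          using orbit_inv_eq[OF pairing_product_permutation] that orbit_trans by metis
        then have "p (p (q y)) \<in> p ` orbit ?r x"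
          by blast
        then show ?thesis
          by (simp add: pairingsD(2)[OF p])
      qed
      moreover have "q (p w) \<in> orbit ?r x" if "w \<in> orbit ?r x" for w
        using orbit.step[OF that] by simp
      moreover have "z = p y \<or> z = q y"
        using step.hyps(2) unfolding R_def by blast
      moreover have "y \<in> orbit ?r x \<or> (\<exists>w \<in> orbit ?r x. y = p w)"
        using step.IH unfolding cls_def by blast
      ultimately show ?case
        unfolding cls_def using pairingsD(2)[OF p] by (metis UnI1 UnI2 imageI)
    qed
  next
    fix y assume "y \<in> cls (orbit ?r x)"
    moreover have step: "(y, ?r y) \<in> R\<^sup>*" if "y \<in> J" for y
    proof -
      have "(y, p y) \<in> R" "(p y, q (p y)) \<in> R"
        using that pairingsD(4)[OF p] by (auto simp: R_def)
      then show ?thesis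
        by auto
    qed
    moreover have *: "(x, y) \<in> R\<^sup>*" if "y \<in> orbit ?r x" for y
      using that
    proof induction
      case base
      then show ?case
        using step x HJ by blast
    next
      case (step y)
      then have "y \<in> J"
        using orbit_half_subset[OF x] HJ by blast
      then show ?case
        using step.IH \<open>\<And>y. y \<in> J \<Longrightarrow> (y, ?r y) \<in> R\<^sup>*\<close> by (meson rtrancl_trans)
    qed
    moreover have "(x, p y) \<in> R\<^sup>*" if "y \<in> orbit ?r x" for y
    proof -
      have "(y, p y) \<in> R"
        using that orbit_half_subset[OF x] HJ by (auto simp: R_def)
      then show ?thesis
        using *[OF that] by auto
    qed
    ultimately show "y \<in> R\<^sup>* `` {x}"
      by (auto simp: cls_def)
  qed
  have "R\<^sup>* `` {x} = R\<^sup>* `` {p x}" if "x \<in> J" for x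
  proof -
    have "(x, p x) \<in> R" "(p x, p (p x)) \<in> R"
      using that pairingsD(4)[OF p] by (auto simp: R_def)
    then have "(x, p x) \<in> R" "(p x, x) \<in> R"
      by (simp_all add: pairingsD(2)[OF p])
    then show ?thesis
      by (auto intro: converse_rtrancl_into_rtrancl)
  qed
  then have "R\<^sup>* `` {x} \<in> (\<lambda>x. R\<^sup>* `` {x}) ` H" if "x \<in> J" for x
    using that half_iff[OF p pH that] by (cases "x \<in> H") auto
  then have "(\<lambda>x. R\<^sup>* `` {x}) ` J = (\<lambda>x. R\<^sup>* `` {x}) ` H"
    using HJ by auto
  then have "J // R\<^sup>* = (\<lambda>x. R\<^sup>* `` {x}) ` H"
    unfolding quotient_def by blast
  also have "\<dots> = cls ` orbit ?r ` H"
    using cls by (simp add: image_image)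
  finally have "join_blocks J p q = card (cls ` orbit ?r ` H)"
    by (simp add: join_blocks_def R_def)
  also have "\<dots> = card (orbit ?r ` H)"
  proof (rule card_image, rule inj_onI)
    have "cls X \<inter> H = X" if "X \<in> orbit ?r ` H" for X
    proof -
      have "X \<subseteq> H"
        using that orbit_half_subset by auto
      then show ?thesis
        using pH by (auto simp: cls_def half_def)
    qed
    then show "X = Y" if "X \<in> orbit ?r ` H" "Y \<in> orbit ?r ` H" "cls X = cls Y" for X Y
      using that by metis
  qed
  finally show ?thesis
    by (simp add: num_orbits_def)
qed

end

lemma num_orbits_pairing_product: "num_orbits J (q \<circ> p) = 2 * join_blocks J p q"
proof -
  let ?r = "q \<circ> p"
  obtain H where H: "half p J H" "half q J H"
    using common_half_exists by blast
  have J: "J = H \<union> p ` H"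
    using H(1) by (auto simp: half_def)
  have finH: "finite H"
    using fin J by (metis finite_Un)
  have "orbit ?r ` p ` H = (`) p ` orbit ?r ` H"
    by (auto simp: image_image orbit_pairing_image)
  then have card2: "card (orbit ?r ` p ` H) = card (orbit ?r ` H)"
    using pairingsD(5)[OF p, of UNIV] by (auto intro!: card_image inj_onI simp: inj_image_eq_iff)
  have "orbit ?r ` H \<inter> orbit ?r ` p ` H = {}"
  proof -
    have "orbit ?r x \<noteq> orbit ?r (p y)" if "x \<in> H" "y \<in> H" for x y
    proof -
      have "p y \<notin> H"
        using that H half_iff[OF p H(1), of y] by (auto simp: half_def)
      then show ?thesis
        using orbit_half_subset[OF H that(1)]
          permutation_self_in_orbit[OF pairing_product_permutation, of "p y"] by auto
    qed
    then show ?thesis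
      by auto
  qed
  then have "num_orbits J ?r = card (orbit ?r ` H) + card (orbit ?r ` p ` H)"
    unfolding num_orbits_def using finH
    by (subst J) (simp add: image_Un card_Un_disjoint)
  then show ?thesis
    using join_blocks_eq_num_orbits[OF H] card2 by (simp add: num_orbits_def)
qed

end

lemma sign_switch_blocks:
  assumes "finite J" "p \<in> pairings J" "A \<subseteq> J" "A \<inter> p ` A = {}"
  shows "(\<lambda>x. if x \<in> A \<union> p ` A then p x else x) permutes J \<and>
    sign (\<lambda>x. if x \<in> A \<union> p ` A then p x else x) = (- 1) ^ card A"
proof -
  have "finite A"
    using assms by (metis finite_subset)
  then show ?thesis
    using assms(3,4)
  proof (induction A rule: finite_induct)
    case empty
    then show ?case
      by (simp add: permutes_id[unfolded id_def])
  next
    case (insert a A)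
    let ?s = "\<lambda>A x. if x \<in> A \<union> p ` A then p x else x"
    have a: "a \<in> J" "p a \<in> J" "p a \<noteq> a"
      using insert.prems pairingsD(3,4)[OF assms(2)] by auto
    have notin: "a \<notin> A \<union> p ` A" "p a \<notin> A \<union> p ` A"
      using insert.prems insert.hyps pairingsD(2,6)[OF assms(2)] by auto
    have eq: "?s (insert a A) = Transposition.transpose a (p a) \<circ> ?s A"
    proof
      fix x
      have "p x \<noteq> a" "p x \<noteq> p a" if "x \<in> A \<union> p ` A"
        using notin that pairingsD(2,6)[OF assms(2)] by (auto simp: image_iff)
      then show "?s (insert a A) x = (Transposition.transpose a (p a) \<circ> ?s A) x"
        using notin pairingsD(2)[OF assms(2)]
        by (cases "x \<in> A \<union> p ` A") (auto simp: transpose_def)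
    qed
    have IH: "?s A permutes J" "sign (?s A) = (- 1) ^ card A"
      using insert by auto
    have "?s (insert a A) permutes J"
      unfolding eq using a by (intro permutes_compose IH permutes_swap_id) auto
    moreover have "sign (?s (insert a A)) = (- 1) ^ card (insert a A)"
      unfolding eq using a insert.hyps permutes_permutation[OF IH(1) assms(1)] IH(2)
      by (simp add: sign_compose permutation_swap_id sign_swap_id)
    ultimately show ?case
      by blast
  qed
qed

text \<open>\<open>s\<close> moves the oriented pairing \<open>(p, H)\<close> to \<open>(q, H')\<close>. The sign of such an \<open>s\<close> compares the two
  orientations, as in the definition of the Pfaffian.\<close>

definition carries :: "int set \<Rightarrow> (int \<Rightarrow> int) \<Rightarrow> (int \<Rightarrow> int) \<Rightarrow> int set \<Rightarrow> (int \<Rightarrow> int) \<Rightarrow> int set \<Rightarrow> bool" where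
  "carries J s p H q H' \<longleftrightarrow> s permutes J \<and> s ` H = H' \<and> (\<forall>x\<in>J. s (p x) = q (s x))"

lemma carries_comp:
  assumes "carries J s p H p' H'" "carries J t p' H' p'' H''"
  shows "carries J (t \<circ> s) p H p'' H''"
  using assms by (auto simp: carries_def permutes_compose image_comp[symmetric] permutes_in_image)

text \<open>Reversing the pairs on which the halves differ is a product of that many transpositions.\<close>

lemma carries_switch_half:
  assumes fin: "finite J" and p: "p \<in> pairings J" and H: "half p J H" "half p J H'"
  shows "\<exists>s. carries J s p H p H' \<and> sign s = (- 1) ^ card (H - H')"
proof -
  let ?A = "H - H'"
  define s where "s = (\<lambda>x. if x \<in> ?A \<union> p ` ?A then p x else x)"
  have sub: "H \<subseteq> J" "H' \<subseteq> J"
    using H by (auto simp: half_def)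
  have pA: "p ` ?A = H' - H"
  proof (intro equalityI subsetI)
    fix x assume "x \<in> H' - H"
    then have "p x \<in> ?A" "x = p (p x)"
      using half_iff[OF p H(1), of x] half_iff[OF p H(2), of x] sub pairingsD(2)[OF p] by auto
    then show "x \<in> p ` ?A"
      by blast
  qed (use half_iff[OF p H(1)] half_iff[OF p H(2)] sub in auto)
  have s: "s permutes J" "sign s = (- 1) ^ card ?A"
    using sign_switch_blocks[OF fin p, of ?A] sub pA unfolding s_def by blast+
  have swap: "x \<in> ?A \<longleftrightarrow> p x \<in> H' - H" "x \<in> H' - H \<longleftrightarrow> p x \<in> ?A" if "x \<in> J" for x
    using half_iff[OF p H(1) that] half_iff[OF p H(2) that] by auto
  have "s ` H = H'"
  proof (intro equalityI subsetI)
    fix x assume "x \<in> H'"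
    then have "x \<in> J"
      using sub by auto
    show "x \<in> s ` H"
    proof (cases "x \<in> H")
      case True
      then have "s x = x"
        using \<open>x \<in> H'\<close> pA by (auto simp: s_def)
      then show ?thesis
        using True image_eqI[of x s x H] by simp
    next
      case False
      then have "p x \<in> ?A"
        using swap[OF \<open>x \<in> J\<close>] \<open>x \<in> H'\<close> by auto
      then have "s (p x) = x" "p x \<in> H"
        using pairingsD(2)[OF p] by (auto simp: s_def)
      then show ?thesis
        using image_eqI[of x s "p x" H] by simp
    qed
  next
    fix y assume "y \<in> s ` H"
    then obtain x where x: "x \<in> H" "y = s x"
      by blast
    then show "y \<in> H'"
      using swap(1)[of x] sub pA by (auto simp: s_def split: if_splits)
  qed
  moreover have "s (p x) = p (s x)" if "x \<in> J" for x
    unfolding s_def pA using swap[OF that] by auto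
  ultimately have "carries J s p H p H'"
    using s by (simp add: carries_def)
  then show ?thesis
    using s by blast
qed

text \<open>Fixing \<open>H\<close> and applying \<open>q \<circ> p\<close> to the other half replaces each partner under \<open>p\<close> by the partner
  under \<open>q\<close>.\<close>

lemma carries_switch_pairing:
  assumes fin: "finite J" and p: "p \<in> pairings J" and q: "q \<in> pairings J"
    and H: "half p J H" "half q J H"
  shows "\<exists>s. carries J s p H q H \<and> sign s = (- 1) ^ (card J div 2 + join_blocks J p q)"
proof -
  let ?K = "J - H"
  let ?s = "\<lambda>x. if x \<in> ?K then (q \<circ> p) x else x"
  have K: "half p J ?K" "half q J ?K"
    using half_complement H p q by auto
  have inK: "(q \<circ> p) x \<in> ?K" if "x \<in> ?K" for x
    using pairing_product_half[OF fin p q K that] by simp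
  have finK: "finite ?K"
    using fin by simp
  have "inj_on ?s ?K"
    using pairingsD(6)[OF p] pairingsD(6)[OF q] by (auto simp: inj_on_def)
  moreover from this have "?s ` ?K = ?K"
    using inK by (intro endo_inj_surj finK) auto
  ultimately have s: "?s permutes ?K"
    by (intro bij_imp_permutes) (auto simp: bij_betw_def)
  have "sign ?s = (- 1) ^ (card ?K + num_orbits ?K ?s)"
    by (rule sign_eq_num_orbits[OF finK s])
  also have "num_orbits ?K ?s = num_orbits ?K (q \<circ> p)"
    using inK by (intro num_orbits_cong[symmetric, THEN sym]) auto
  also have "\<dots> = join_blocks J p q"
    by (rule join_blocks_eq_num_orbits[OF fin p q K, symmetric])
  also have "card ?K = card J div 2"
    using card_half[OF fin p K(1)] by simp
  finally have "sign ?s = (- 1) ^ (card J div 2 + join_blocks J p q)" .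
  moreover have "carries J ?s p H q H"
    unfolding carries_def
  proof (intro conjI ballI)
    show "?s permutes J"
      using s by (rule permutes_subset) auto
    show "?s ` H = H"
      by (auto simp: image_iff)
    fix x assume x: "x \<in> J"
    then show "?s (p x) = q (?s x)"
      using half_iff[OF p H(1) x] pairingsD(2,4)[OF p] pairingsD(2)[OF q] by auto
  qed
  ultimately show ?thesis
    by blast
qed

text \<open>A permutation that commutes with \<open>p\<close> and preserves a half acts in the same way on both
  halves, so each of its cycles occurs twice.\<close>

lemma sign_carries_self:
  assumes fin: "finite J" and p: "p \<in> pairings J" and H: "half p J H" and s: "carries J s p H p H"
  shows "sign s = 1"
proof -
  have HJ: "H \<subseteq> J" and sJ: "s permutes J" and sH: "s ` H = H" and comm: "\<And>x. x \<in> J \<Longrightarrow> s (p x) = p (s x)"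
    using H s by (auto simp: half_def carries_def)
  \<comment> \<open>The restriction to \<open>H\<close>; its conjugate by \<open>p\<close> is the restriction to the other half.\<close>
  define r where "r x = (if x \<in> H then s x else x)" for x
  have "bij_betw r H H"
    using sH permutes_inj_on[OF sJ, of H] by (auto simp: bij_betw_def r_def inj_on_def)
  then have rH: "r permutes H"
    by (rule bij_imp_permutes) (simp add: r_def)
  have perm_r: "permutation r"
    using rH HJ fin by (meson finite_subset permutes_permutation)
  have perm_p: "permutation p"
    using pairingsD(1)[OF p] fin by (rule permutes_permutation)
  have "s = r \<circ> (p \<circ> r \<circ> p)"
  proof
    fix x
    consider "x \<notin> J" | "x \<in> H" | "x \<in> J - H"
      by blast
    then show "s x = (r \<circ> (p \<circ> r \<circ> p)) x"
    proof cases
      case 1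
      then have "s x = x" "p x \<notin> H" "x \<notin> H"
        using sJ HJ pairingsD(4)[OF p] by (auto simp: permutes_def)
      then show ?thesis
        by (simp add: r_def pairingsD(2)[OF p])
    next
      case 2
      then have "p x \<notin> H"
        using half_iff[OF p H] HJ by auto
      then show ?thesis
        using 2 by (simp add: r_def pairingsD(2)[OF p])
    next
      case 3
      then have px: "p x \<in> H"
        using half_iff[OF p H] by auto
      have "s x \<notin> H"
        using 3 sH permutes_inj[OF sJ] by (metis DiffD2 image_iff injD)
      then show ?thesis
        using 3 px comm[of x] by (simp add: r_def pairingsD(2)[OF p])
    qed
  qed
  then have "sign s = sign r * (sign p * sign r * sign p)"
    using perm_r perm_p by (simp add: sign_compose permutation_compose)
  then show ?thesis
    by (simp add: mult_ac)
qed

text \<open>Starting from \<open>(p, E)\<close>, switch alternately the half and the pairing, going through \<open>d\<close> and \<open>q\<close> back to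
  \<open>(p, E)\<close>. The composite of the six permutations is even, and its sign is the product of theirs.\<close>

theorem three_pairings_parity:
  assumes fin: "finite J" and p: "p \<in> pairings J" and q: "q \<in> pairings J" and d: "d \<in> pairings J"
    and E: "half p J E" "half q J E" and F: "half p J F" "half d J F"
    and G: "half q J G" "half d J G"
  shows "even (join_blocks J p q + join_blocks J p d + join_blocks J q d + card J div 2
    + card (E - F) + card (F - G) + card (G - E))"
proof -
  let ?m = "card J div 2"
  obtain s1 where s1: "carries J s1 p E p F" "sign s1 = (- 1) ^ card (E - F)"
    using carries_switch_half[OF fin p E(1) F(1)] by blast
  obtain s2 where s2: "carries J s2 p F d F" "sign s2 = (- 1) ^ (?m + join_blocks J p d)"
    using carries_switch_pairing[OF fin p d F] by blast
  obtain s3 where s3: "carries J s3 d F d G" "sign s3 = (- 1) ^ card (F - G)"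
    using carries_switch_half[OF fin d F(2) G(2)] by blast
  obtain s4 where s4: "carries J s4 d G q G" "sign s4 = (- 1) ^ (?m + join_blocks J d q)"
    using carries_switch_pairing[OF fin d q G(2) G(1)] by blast
  obtain s5 where s5: "carries J s5 q G q E" "sign s5 = (- 1) ^ card (G - E)"
    using carries_switch_half[OF fin q G(1) E(2)] by blast
  obtain s6 where s6: "carries J s6 q E p E" "sign s6 = (- 1) ^ (?m + join_blocks J q p)"
    using carries_switch_pairing[OF fin q p E(2) E(1)] by blast
  have "carries J (s6 \<circ> (s5 \<circ> (s4 \<circ> (s3 \<circ> (s2 \<circ> s1))))) p E p E"
    by (meson carries_comp s1 s2 s3 s4 s5 s6)
  then have "sign (s6 \<circ> (s5 \<circ> (s4 \<circ> (s3 \<circ> (s2 \<circ> s1))))) = 1"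
    by (rule sign_carries_self[OF fin p E(1)])
  moreover have "permutation s1" "permutation s2" "permutation s3" "permutation s4"
    "permutation s5" "permutation s6"
    using s1 s2 s3 s4 s5 s6 fin by (auto simp: carries_def intro: permutes_permutation)
  ultimately have "sign s6 * (sign s5 * (sign s4 * (sign s3 * (sign s2 * sign s1)))) = 1"
    by (simp add: sign_compose permutation_compose)
  then have "(- 1 :: int) ^ (?m + join_blocks J q p + (card (G - E) + (?m + join_blocks J d q
      + (card (F - G) + (?m + join_blocks J p d + card (E - F)))))) = 1"
    unfolding s1 s2 s3 s4 s5 s6 power_add by simp
  then have "even (?m + join_blocks J q p + (card (G - E) + (?m + join_blocks J d q
      + (card (F - G) + (?m + join_blocks J p d + card (E - F))))))"
    by (metis neg_one_odd_power one_neq_neg_one)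
  then show ?thesis
    using join_blocks_commute[of J q p] join_blocks_commute[of J q d] by simp argo
qed

section \<open>Permutations of signed sets as pairings\<close>

lemma PM_D:
  assumes "\<alpha> \<in> PM I"
  shows "\<alpha> permutes pm I" "- \<alpha> (- x) = inv \<alpha> x" "k \<in> pm I \<Longrightarrow> - k \<notin> orbit \<alpha> k"
  using assms by (auto simp: PM_def fun_eq_iff)

lemma uminus_mem_pm [simp]: "- k \<in> pm I \<longleftrightarrow> k \<in> pm I"
  by (auto simp: pm_def image_iff) (metis minus_minus)+

lemma finite_pm: "finite I \<Longrightarrow> finite (pm I)"
  by (simp add: pm_def)

lemma FD_subset: "FD I \<alpha> \<subseteq> pm I"
  by (auto simp: FD_def)

lemma FD_orbit_cong: "k \<in> pm I \<Longrightarrow> l \<in> pm I \<Longrightarrow> orbit \<alpha> k = orbit \<alpha> l \<Longrightarrow> k \<in> FD I \<alpha> \<longleftrightarrow> l \<in> FD I \<alpha>"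
  by (simp add: FD_def)

lemma mem_pm_iff:
  assumes "\<And>i. i \<in> I \<Longrightarrow> 0 < i"
  shows "k \<in> pm I \<longleftrightarrow> \<bar>k\<bar> \<in> I"
proof -
  have "k \<in> pm I \<longleftrightarrow> k \<in> I \<or> - k \<in> I"
    by (force simp: pm_def)
  then show ?thesis
    using assms[of k] assms[of "- k"] by (auto simp: abs_if)
qed

abbreviation (input) delta :: "int set \<Rightarrow> int \<Rightarrow> int" where
  "delta I \<equiv> restrict_id uminus (pm I)"

text \<open>Composition with \<open>k \<mapsto> -k\<close>, which translates between the permutations in \<open>PM I\<close> and the pairings of
  the signed set in both directions. Pairings are the identity off that set, hence the restriction.\<close>

definition pairing_of :: "int set \<Rightarrow> (int \<Rightarrow> int) \<Rightarrow> int \<Rightarrow> int" where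
  "pairing_of I f = restrict_id (uminus \<circ> f) (pm I)"

context
  fixes I :: "int set"
  assumes fin: "finite I" and pos: "\<And>i. i \<in> I \<Longrightarrow> 0 < i"
begin

lemma pm_nonzero: "k \<in> pm I \<Longrightarrow> k \<noteq> 0"
  using pos by (force simp: pm_def)

lemma delta_permutes: "delta I permutes pm I"
  by (rule permutes_restrict_id) (auto intro!: bij_betwI[where g = uminus])

lemma delta_pairing: "delta I \<in> pairings (pm I)"
  using delta_permutes pm_nonzero by (auto simp: pairings_def restrict_id_def fun_eq_iff)

lemma pos_half_delta: "half (delta I) (pm I) I"
  unfolding half_altdef[OF delta_pairing]
proof (intro conjI ballI)
  fix k assume "k \<in> pm I"
  then show "delta I k \<in> I \<longleftrightarrow> k \<notin> I"
    using pos[of k] pos[of "- k"] by (auto simp: pm_def)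
qed (simp add: pm_def)

lemma PM_pairing_of:
  assumes "\<alpha> \<in> PM I"
  shows "pairing_of I \<alpha> \<in> pairings (pm I)" "\<alpha> = delta I \<circ> pairing_of I \<alpha>" "pairing_of I (pairing_of I \<alpha>) = \<alpha>"
proof -
  note a = PM_D[OF assms]
  have mem: "\<alpha> k \<in> pm I \<longleftrightarrow> k \<in> pm I" for k
    by (rule permutes_in_image[OF a(1)])
  have out: "\<alpha> k = k" if "k \<notin> pm I" for k
    using a(1) that by (simp add: permutes_def)
  have comp: "pairing_of I \<alpha> = delta I \<circ> \<alpha>"
    using mem out by (auto simp: pairing_of_def restrict_id_def fun_eq_iff)
  have "pairing_of I \<alpha> (pairing_of I \<alpha> k) = k" for k
    using mem[of k] mem[of "- \<alpha> k"] out[of k] a(2)[of "\<alpha> k"] permutes_inverses(2)[OF a(1), of k]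
    by (auto simp: pairing_of_def restrict_id_def)
  moreover have "pairing_of I \<alpha> k \<noteq> k" if "k \<in> pm I" for k
  proof
    assume "pairing_of I \<alpha> k = k"
    then have "\<alpha> k = - k"
      using that by (simp add: pairing_of_def)
    then show False
      using a(3)[OF that] orbit.base[of \<alpha> k] by simp
  qed
  ultimately show "pairing_of I \<alpha> \<in> pairings (pm I)"
    unfolding pairings_def comp
    using permutes_compose[OF a(1) delta_permutes] by (auto simp: fun_eq_iff)
  show "\<alpha> = delta I \<circ> pairing_of I \<alpha>" "pairing_of I (pairing_of I \<alpha>) = \<alpha>"
    using mem out by (auto simp: pairing_of_def restrict_id_def fun_eq_iff)
qed

lemma pairing_of_PM:
  assumes p: "p \<in> pairings (pm I)"
  shows "pairing_of I p \<in> PM I" "pairing_of I p = delta I \<circ> p" "pairing_of I (pairing_of I p) = p"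
proof -
  note d = delta_pairing
  note finJ = finite_pm[OF fin]
  have mem: "p k \<in> pm I \<longleftrightarrow> k \<in> pm I" for k
    by (rule pairingsD(4)[OF p])
  have out: "p k = k" if "k \<notin> pm I" for k
    using pairingsD(1)[OF p] that by (simp add: permutes_def)
  show comp: "pairing_of I p = delta I \<circ> p" and "pairing_of I (pairing_of I p) = p"
    using mem out by (auto simp: pairing_of_def restrict_id_def fun_eq_iff)
  have inv: "inv (pairing_of I p) = p \<circ> delta I"
    unfolding comp by (rule inv_pairing_product[OF finJ p d])
  have "- k \<notin> orbit (delta I \<circ> p) k" if k: "k \<in> pm I" for k
  proof
    assume "- k \<in> orbit (delta I \<circ> p) k"
    moreover have "(delta I \<circ> p) (p k) = - k"
      using k pairingsD(2)[OF p, of k] by simp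
    ultimately have "orbit (delta I \<circ> p) k = orbit (delta I \<circ> p) (p k)"
      using orbit_eq_orbit[OF pairing_product_permutation[OF finJ p d], of "- k" k]
        permutation_orbit_step[OF pairing_product_permutation[OF finJ p d], of "p k"] by simp
    then show False
      using pairing_notin_orbit[OF finJ p d k]
        permutation_self_in_orbit[OF pairing_product_permutation[OF finJ p d], of "p k"] by simp
  qed
  moreover have "- pairing_of I p (- k) = inv (pairing_of I p) k" for k
    unfolding inv using out[of k] out[of "- k"] by (auto simp: pairing_of_def restrict_id_def)
  moreover have "pairing_of I p permutes pm I"
    unfolding comp using pairingsD(1)[OF p] delta_permutes by (rule permutes_compose)
  ultimately show "pairing_of I p \<in> PM I"
    by (auto simp: PM_def fun_eq_iff comp)
qed

lemma bij_pairing_of: "bij_betw (pairing_of I) (PM I) (pairings (pm I))"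
  using PM_pairing_of pairing_of_PM by (intro bij_betwI[where g = "pairing_of I"]) auto

lemma inv_PM:
  assumes "\<alpha> \<in> PM I"
  shows "inv \<alpha> \<in> PM I" "inv (inv \<alpha>) = \<alpha>"
proof -
  note a = PM_D[OF assms]
  have perm: "permutation \<alpha>"
    using a(1) finite_pm[OF fin] by (rule permutes_permutation)
  show inv: "inv (inv \<alpha>) = \<alpha>"
    by (rule inv_inv_eq[OF permutes_bij[OF a(1)]])
  have "- inv \<alpha> (- x) = \<alpha> x" for x
    using a(2)[of "- x"] by simp
  then show "inv \<alpha> \<in> PM I"
    using a permutes_inv[OF a(1)] by (auto simp: PM_def fun_eq_iff inv orbit_inv_eq[OF perm])
qed

lemma bij_inv_PM: "bij_betw inv (PM I) (PM I)"
  using inv_PM by (intro bij_betwI[where g = inv]) auto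

text \<open>The cycles come in pairs with signs and order reversed.\<close>

lemma orbit_uminus:
  assumes a: "\<alpha> \<in> PM I" and k: "k \<in> pm I"
  shows "orbit \<alpha> (- k) = uminus ` orbit \<alpha> k"
proof -
  note finJ = finite_pm[OF fin]
  note p = PM_pairing_of(1)[OF a]
  have perm: "permutation \<alpha>"
    using PM_D(1)[OF a] finJ by (rule permutes_permutation)
  have sub: "orbit \<alpha> k \<subseteq> pm I"
    by (rule permutes_orbit_subset[OF PM_D(1)[OF a] k])
  have "orbit \<alpha> (pairing_of I \<alpha> k) = pairing_of I \<alpha> ` orbit \<alpha> k"
    using orbit_pairing_image[OF finJ p delta_pairing, of k] PM_pairing_of(2)[OF a] by simp
  also have "\<dots> = (\<lambda>x. - \<alpha> x) ` orbit \<alpha> k"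
    using sub by (intro image_cong) (auto simp: pairing_of_def)
  also have "\<dots> = uminus ` \<alpha> ` orbit \<alpha> k"
    by (simp add: image_image)
  also have "\<alpha> ` orbit \<alpha> k = orbit \<alpha> k"
    using orbit_inverse[of k \<alpha> \<alpha> \<alpha>] permutation_self_in_orbit[OF perm, of k] permutation_orbit_step[OF perm, of k] by simp
  finally have "orbit \<alpha> (- \<alpha> k) = uminus ` orbit \<alpha> k"
    using k by (simp add: pairing_of_def)
  moreover have "\<alpha> (- \<alpha> k) = - k"
    using PM_D(2)[OF a, of "\<alpha> k"] permutes_inverses(2)[OF PM_D(1)[OF a], of k] by simp
  ultimately show ?thesis
    using permutation_orbit_step[OF perm, of "- \<alpha> k"] by simp
qed

lemma uminus_FD_iff:
  assumes a: "\<alpha> \<in> PM I" and k: "k \<in> pm I"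
  shows "- k \<in> FD I \<alpha> \<longleftrightarrow> k \<notin> FD I \<alpha>"
proof -
  let ?O = "orbit \<alpha> k"
  have perm: "permutation \<alpha>"
    using PM_D(1)[OF a] finite_pm[OF fin] by (rule permutes_permutation)
  have sub: "?O \<subseteq> pm I"
    by (rule permutes_orbit_subset[OF PM_D(1)[OF a] k])
  have finO: "finite ?O"
    using sub finite_pm[OF fin] by (rule finite_subset)
  obtain m where m: "m \<in> ?O" "\<And>j. j \<in> ?O \<Longrightarrow> \<bar>m\<bar> \<le> \<bar>j\<bar>"
    using arg_min_if_finite(1)[OF finO orbit_nonempty, of abs] arg_min_least[OF finO orbit_nonempty, of _ abs]
    by blast
  have uniq: "j = m" if "j \<in> ?O" "\<bar>j\<bar> \<le> \<bar>m\<bar>" for j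
  proof (rule ccontr)
    assume "j \<noteq> m"
    then have "j = - m"
      using m(2)[OF that(1)] that(2) by linarith
    moreover have "orbit \<alpha> m = ?O"
      by (rule orbit_eq_orbit[OF perm m(1)])
    moreover have "m \<in> pm I"
      using m(1) sub by auto
    ultimately show False
      using PM_D(3)[OF a, of m] that(1) by simp
  qed
  have "k \<in> FD I \<alpha> \<longleftrightarrow> 0 < m"
    using m uniq k by (auto simp: FD_def)
  moreover have "- k \<in> FD I \<alpha> \<longleftrightarrow> 0 < - m"
    using m uniq k orbit_uminus[OF a k] by (auto simp: FD_def)
  moreover have "m \<noteq> 0"
    using m(1) sub pm_nonzero by auto
  ultimately show ?thesis
    by linarith
qed

text \<open>The chosen cycles orient both the pairing of \<open>\<alpha>\<close> and the pairing \<open>k \<mapsto> -k\<close>, because \<open>k \<mapsto> -k\<close>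
  exchanges the two cycles of each pair.\<close>

lemma half_FD:
  assumes a: "\<alpha> \<in> PM I"
  shows "half (delta I) (pm I) (FD I \<alpha>)" "half (pairing_of I \<alpha>) (pm I) (FD I \<alpha>)"
proof -
  have perm: "permutation \<alpha>"
    using PM_D(1)[OF a] finite_pm[OF fin] by (rule permutes_permutation)
  show "half (delta I) (pm I) (FD I \<alpha>)"
    using uminus_FD_iff[OF a] FD_subset by (simp add: half_altdef[OF delta_pairing])
  have "- \<alpha> k \<in> FD I \<alpha> \<longleftrightarrow> k \<notin> FD I \<alpha>" if "k \<in> pm I" for k
    using that permutes_in_image[OF PM_D(1)[OF a]] uminus_FD_iff[OF a, of "\<alpha> k"]
      FD_orbit_cong[of "\<alpha> k" I k \<alpha>] permutation_orbit_step[OF perm] by simp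
  then show "half (pairing_of I \<alpha>) (pm I) (FD I \<alpha>)"
    using FD_subset by (simp add: half_altdef[OF PM_pairing_of(1)[OF a]]) (simp add: pairing_of_def)
qed

lemma num_orbits_PM:
  assumes a: "\<alpha> \<in> PM I"
  shows "num_orbits (pm I) \<alpha> = 2 * join_blocks (pm I) (pairing_of I \<alpha>) (delta I)"
    "num_orbits (FD I \<alpha>) \<alpha> = join_blocks (pm I) (pairing_of I \<alpha>) (delta I)"
proof -
  note p = PM_pairing_of(1)[OF a] and f = finite_pm[OF fin]
  show "num_orbits (pm I) \<alpha> = 2 * join_blocks (pm I) (pairing_of I \<alpha>) (delta I)"
    using num_orbits_pairing_product[OF f p delta_pairing] PM_pairing_of(2)[OF a] by simp
  show "num_orbits (FD I \<alpha>) \<alpha> = join_blocks (pm I) (pairing_of I \<alpha>) (delta I)"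
    using join_blocks_eq_num_orbits[OF f p delta_pairing half_FD(2)[OF a] half_FD(1)[OF a]]
      PM_pairing_of(2)[OF a] by simp
qed

end

section \<open>The Gram matrix of the pairing tensors\<close>

lemma sform_nonzero_iff: "sform x y \<noteq> 0 \<longleftrightarrow> y = flip x"
  by (simp add: sform_def bsgn_def)

lemma pairing_tensor_nonzero_iff:
  assumes "finite J" "p \<in> pairings J" "half p J H"
  shows "pairing_tensor p H z \<noteq> 0 \<longleftrightarrow> (\<forall>k\<in>J. z (p k) = flip (z k))"
proof -
  have HJ: "H \<subseteq> J"
    using assms by (simp add: half_def)
  then have "finite H"
    using assms(1) finite_subset by blast
  then have "pairing_tensor p H z \<noteq> 0 \<longleftrightarrow> (\<forall>m\<in>H. z (p m) = flip (z m))"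
    by (simp add: pairing_tensor_def sform_nonzero_iff)
  also have "\<dots> \<longleftrightarrow> (\<forall>k\<in>J. z (p k) = flip (z k))"
  proof
    assume *: "\<forall>m\<in>H. z (p m) = flip (z m)"
    show "\<forall>k\<in>J. z (p k) = flip (z k)"
    proof
      fix k assume k: "k \<in> J"
      show "z (p k) = flip (z k)"
      proof (cases "k \<in> H")
        case False
        then have "p k \<in> H"
          using half_iff[OF assms(2,3) k] by simp
        then have "z (p (p k)) = flip (z (p k))"
          using * by blast
        then show ?thesis
          by (simp add: pairingsD(2)[OF assms(2)])
      qed (use * in simp)
    qed
  qed (use HJ in auto)
  finally show ?thesis .
qed

lemma pairing_tensor_value:
  assumes "\<And>k. k \<in> H \<Longrightarrow> z (p k) = flip (z k)"
  shows "pairing_tensor p H z = (\<Prod>m\<in>H. bsgn (z m))"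
  unfolding pairing_tensor_def using assms by (intro prod.cong) (simp_all add: sform_def)

text \<open>An index function that is compatible with both pairings amounts to one value for each orbit of
  \<open>q \<circ> p\<close> in a common half, extended to the other half by flips.\<close>

lemma card_pairing_tensor_support:
  fixes z :: "int \<Rightarrow> 'n::finite \<times> bool"
  assumes fin: "finite J" and p: "p \<in> pairings J" and q: "q \<in> pairings J"
  shows "card {y \<in> agree_off J z. \<forall>k\<in>J. y (p k) = flip (y k) \<and> y (q k) = flip (y k)}
    = (2 * CARD('n)) ^ join_blocks J p q"
proof -
  let ?C = "{y \<in> agree_off J z. \<forall>k\<in>J. y (p k) = flip (y k) \<and> y (q k) = flip (y k)}"
  obtain H where H: "half p J H" "half q J H"
    using common_half_exists[OF fin p q] by blast
  have HJ: "H \<subseteq> J"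
    using H by (simp add: half_def)
  have finH: "finite H"
    using fin HJ by (rule finite_subset[rotated])
  define O' where "O' = orbit (q \<circ> p)"
  note perm = pairing_product_permutation[OF fin p q]
  have O_step: "O' (q (p x)) = O' x" for x
    using permutation_orbit_step[OF perm, of x] by (simp add: O'_def)
  have O_pq: "O' (p (q x)) = O' x" for x
    using O_step[of "p (q x)"] by (simp add: pairingsD(2)[OF p] pairingsD(2)[OF q])
  have O_q: "O' (q x) = O' (p x)" for x
    using O_step[of "p x"] by (simp add: pairingsD(2)[OF p])
  have pH: "p k \<in> H \<longleftrightarrow> k \<notin> H" "q k \<in> H \<longleftrightarrow> k \<notin> H" "p k \<in> J" "q k \<in> J" if "k \<in> J" for k
    using half_iff[OF p H(1) that] half_iff[OF q H(2) that] pairingsD(4)[OF p] pairingsD(4)[OF q] that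
    by auto
  define ext where "ext g k = (if k \<in> H then g (O' k) else if k \<in> J then flip (g (O' (p k))) else z k)"
    for g :: "int set \<Rightarrow> 'n \<times> bool" and k
  define res where "res y = (\<lambda>X\<in>O' ` H. y (SOME k. k \<in> X))" for y :: "int \<Rightarrow> 'n \<times> bool"
  have const: "y x = y k" if "y \<in> ?C" "k \<in> H" "x \<in> O' k" for y k x
    using that(3) unfolding O'_def
  proof induction
    case base
    have "k \<in> J" "p k \<in> J"
      using that HJ pH by auto
    then show ?case
      using that(1) by auto
  next
    case (step x)
    then have "x \<in> J"
      using orbit_half_subset[OF fin p q H that(2)] HJ by auto
    then show ?case
      using that(1) step.IH pH(3)[of x] by auto
  qed
  have self: "k \<in> O' k" for k
    unfolding O'_def by (rule permutation_self_in_orbit[OF perm])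
  have "bij_betw ext (PiE (O' ` H) (\<lambda>_. UNIV)) ?C"
  proof (rule bij_betwI[where g = res])
    show "ext \<in> (O' ` H \<rightarrow>\<^sub>E UNIV) \<rightarrow> ?C"
    proof
      fix g :: "int set \<Rightarrow> 'n \<times> bool"
      have "ext g (p k) = flip (ext g k)" "ext g (q k) = flip (ext g k)" if "k \<in> J" for k
        using pH[OF that] that by (simp_all add: ext_def pairingsD(2)[OF p] O_pq O_q)
      moreover have "ext g \<in> agree_off J z"
        using HJ by (auto simp: agree_off_def ext_def)
      ultimately show "ext g \<in> ?C"
        by simp
    qed
    show "res \<in> ?C \<rightarrow> (O' ` H \<rightarrow>\<^sub>E UNIV)"
      by (auto simp: res_def)
    show "res (ext g) = g" if g: "g \<in> O' ` H \<rightarrow>\<^sub>E UNIV" for g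
    proof
      fix X
      show "res (ext g) X = g X"
      proof (cases "X \<in> O' ` H")
        case True
        then obtain k where k: "k \<in> H" "X = O' k"
          by auto
        have "(SOME k. k \<in> X) \<in> X"
          using self[of k] k by (auto intro: someI)
        then have "(SOME k. k \<in> X) \<in> H" "O' (SOME k. k \<in> X) = X"
          using k orbit_half_subset[OF fin p q H k(1)] orbit_eq_orbit[OF perm] by (auto simp: O'_def)
        then show ?thesis
          using True by (simp add: res_def ext_def)
      next
        case False
        then show ?thesis
          using PiE_arb[OF g False] False by (simp add: res_def)
      qed
    qed
    show "ext (res y) = y" if y: "y \<in> ?C" for y
    proof
      fix k
      have H_case: "res y (O' k) = y k" if "k \<in> H" for k
      proof -
        have "(SOME x. x \<in> O' k) \<in> O' k"
          using self[of k] by (rule someI)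
        then show ?thesis
          using const[OF y that] that by (simp add: res_def)
      qed
      consider "k \<in> H" | "k \<in> J - H" | "k \<notin> J"
        by blast
      then show "ext (res y) k = y k"
      proof cases
        case 2
        then have "p k \<in> H"
          using pH by auto
        then show ?thesis
          using 2 y H_case[of "p k"] by (simp add: ext_def)
      next
        case 3
        then show ?thesis
          using y HJ by (auto simp: ext_def agree_off_def)
      qed (simp add: ext_def H_case)
    qed
  qed
  then have "card ?C = card (PiE (O' ` H) (\<lambda>_. UNIV :: ('n \<times> bool) set))"
    by (simp add: bij_betw_same_card)
  also have "\<dots> = CARD('n \<times> bool) ^ card (O' ` H)"
    using finH by (simp add: card_PiE)
  also have "card (O' ` H) = join_blocks J p q"
    unfolding join_blocks_eq_num_orbits[OF fin p q H] by (simp add: num_orbits_def O'_def)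
  finally show ?thesis
    by (simp add: mult.commute)
qed

text \<open>The sign for which the Gram matrix of the pairing tensors is \<open>Gr\<close>; the exponent of its first factor
  is the number of pairs of cycles of the permutation, and the second factor accounts for the columns.\<close>

definition norm_sign :: "int set \<Rightarrow> (int \<Rightarrow> int) \<Rightarrow> real" where
  "norm_sign I p = (- 1) ^ join_blocks (pm I) p (delta I) * (\<Prod>m\<in>FD I (pairing_of I p). of_int (sgn m))"

definition normalized_tensor :: "int set \<Rightarrow> (int \<Rightarrow> int) \<Rightarrow> (int \<Rightarrow> 'n \<times> bool) \<Rightarrow> real" where
  "normalized_tensor I p z = norm_sign I p * pairing_tensor p (FD I (pairing_of I p)) z"

lemma prod_sign_eq:
  fixes f :: "'b \<Rightarrow> real"
  assumes "finite H" "\<And>m. m \<in> H \<Longrightarrow> f m = (if m \<in> E then 1 else - 1)"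
  shows "(\<Prod>m\<in>H. f m) = (- 1) ^ card (H - E)"
proof -
  have "(\<Prod>m\<in>H. f m) = (\<Prod>m\<in>H. if m \<in> E then 1 else - 1)"
    using assms(2) by (intro prod.cong) auto
  also have "\<dots> = (\<Prod>m\<in>H - E. - 1)"
    using assms(1) by (intro prod.mono_neutral_cong_right) auto
  finally show ?thesis
    by simp
qed

lemma card_Diff_half_commute:
  assumes "finite J" "p \<in> pairings J" "half p J H" "q \<in> pairings J" "half q J K"
  shows "card (H - K) = card (K - H)"
proof -
  have "finite H" "finite K"
    using assms by (auto simp: half_def intro: finite_subset)
  moreover have "card H = card K"
    using card_half[OF assms(1-3)] card_half[OF assms(1,4,5)] by simp
  ultimately show ?thesis
    by (metis card_Diff_subset_Int finite_Int Int_commute)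
qed

context
  fixes I :: "int set"
  assumes fin: "finite I" and pos: "\<And>i. i \<in> I \<Longrightarrow> 0 < i"
begin

lemma half_FD_pairing:
  assumes p: "p \<in> pairings (pm I)"
  shows "half (delta I) (pm I) (FD I (pairing_of I p))" "half p (pm I) (FD I (pairing_of I p))"
  using half_FD[OF fin pos pairing_of_PM(1)[OF fin pos p]] pairing_of_PM(3)[OF fin pos p] by auto

lemma norm_sign_eq:
  assumes p: "p \<in> pairings (pm I)"
  shows "norm_sign I p = (- 1) ^ (join_blocks (pm I) p (delta I) + card (FD I (pairing_of I p) - I))"
proof -
  have sub: "FD I (pairing_of I p) \<subseteq> pm I"
    using half_FD_pairing[OF p] by (simp add: half_def)
  then have "finite (FD I (pairing_of I p))"
    using finite_pm[OF fin] by (rule finite_subset)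
  moreover have "real_of_int (sgn m) = (if m \<in> I then 1 else - 1)" if "m \<in> FD I (pairing_of I p)" for m
    using that sub pos by (fastforce simp: pm_def)
  ultimately have "(\<Prod>m\<in>FD I (pairing_of I p). real_of_int (sgn m)) = (- 1) ^ card (FD I (pairing_of I p) - I)"
    by (intro prod_sign_eq)
  then show ?thesis
    by (simp add: norm_sign_def power_add)
qed

text \<open>At an index \<open>y\<close> where both tensors are nonzero, the slots with positive sign form a common half \<open>E\<close> of
  \<open>p\<close> and \<open>q\<close>, and each tensor is a sign that counts its half against \<open>E\<close> and against the positive slots.
  The parity theorem for \<open>p\<close>, \<open>q\<close> and \<open>k \<mapsto> -k\<close> evaluates the product of these signs.\<close>

lemma Gram_normalized_tensor:
  fixes z :: "int \<Rightarrow> 'n::finite \<times> bool"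
  assumes p: "p \<in> pairings (pm I)" and q: "q \<in> pairings (pm I)"
  shows "(\<Sum>y\<in>agree_off (pm I) z. normalized_tensor I p y * normalized_tensor I q y) = Gr CARD('n) (pm I) p q"
proof -
  let ?J = "pm I"
  let ?F = "FD I (pairing_of I p)" and ?G = "FD I (pairing_of I q)"
  let ?C = "{y \<in> agree_off ?J z. \<forall>k\<in>?J. y (p k) = flip (y k) \<and> y (q k) = flip (y k)}"
  note d = delta_pairing[OF fin pos] and finJ = finite_pm[OF fin]
  note F = half_FD_pairing[OF p] and G = half_FD_pairing[OF q]
  note I = pos_half_delta[OF fin pos]
  have fin_FG: "finite ?F" "finite ?G"
    using F G finJ by (auto simp: half_def intro: finite_subset)
  \<comment> \<open>Replacing \<open>p\<close> and \<open>q\<close> by the third pairing, once with three different halves and once with equal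
    ones, leaves a statement on the halves alone.\<close>
  have parity_d: "even (card (?F - ?G) + card (?G - I) + card (?F - I))"
  proof -
    have "even (join_blocks ?J (delta I) (delta I) + join_blocks ?J (delta I) (delta I)
        + join_blocks ?J (delta I) (delta I) + card ?J div 2)"
      using three_pairings_parity[OF finJ d d d I I I I I I] by simp
    moreover have "card (I - ?F) = card (?F - I)"
      by (rule card_Diff_half_commute[OF finJ d I d F(1)])
    ultimately show ?thesis
      using three_pairings_parity[OF finJ d d d F(1) F(1) G(1) G(1) I I] by simp
  qed
  have val: "normalized_tensor I p y * normalized_tensor I q y = (- 1) ^ (card ?J div 2 + join_blocks ?J p q)" if y: "y \<in> ?C" for y
  proof -
    define E where "E = {k \<in> ?J. snd (y k)}"
    have E: "half p ?J E" "half q ?J E"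
      using y pairingsD(4)[OF p] pairingsD(4)[OF q]
      by (auto simp: half_altdef[OF p] half_altdef[OF q] E_def flip_def)
    have "pairing_tensor p ?F y = (\<Prod>m\<in>?F. bsgn (y m))" "pairing_tensor q ?G y = (\<Prod>m\<in>?G. bsgn (y m))"
      using y F G by (auto intro!: pairing_tensor_value simp: half_def)
    moreover have "(\<Prod>m\<in>?F. bsgn (y m)) = (- 1) ^ card (?F - E)" "(\<Prod>m\<in>?G. bsgn (y m)) = (- 1) ^ card (?G - E)"
      using F G fin_FG by (auto intro!: prod_sign_eq simp: E_def bsgn_def half_def)
    ultimately have "normalized_tensor I p y * normalized_tensor I q y = (- 1) ^ (join_blocks ?J p (delta I) + card (?F - I)
        + card (?F - E) + (join_blocks ?J q (delta I) + card (?G - I) + card (?G - E)))"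
      by (simp add: normalized_tensor_def norm_sign_eq[OF p] norm_sign_eq[OF q] power_add)
    moreover have "card (?F - E) = card (E - ?F)"
      by (rule card_Diff_half_commute[OF finJ p F(2) p E(1)])
    moreover have "even (join_blocks ?J p q + join_blocks ?J p (delta I) + join_blocks ?J q (delta I)
        + card ?J div 2 + card (E - ?F) + card (?F - ?G) + card (?G - E))"
      by (rule three_pairings_parity[OF finJ p q d E F(2) F(1) G(2) G(1)])
    ultimately show ?thesis
      using parity_d by (auto simp: minus_one_power_iff)
  qed
  have zero: "normalized_tensor I p y * normalized_tensor I q y = 0" if "y \<in> agree_off ?J z - ?C" for y
    using that pairing_tensor_nonzero_iff[OF finJ p F(2), of y] pairing_tensor_nonzero_iff[OF finJ q G(2), of y]
    by (auto simp: normalized_tensor_def)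
  have "(\<Sum>y\<in>agree_off ?J z. normalized_tensor I p y * normalized_tensor I q y) = (\<Sum>y\<in>?C. (- 1) ^ (card ?J div 2 + join_blocks ?J p q))"
    using zero val finite_agree_off[OF finJ] by (intro sum.mono_neutral_cong_right) auto
  also have "\<dots> = real (card ?C) * (- 1) ^ (card ?J div 2 + join_blocks ?J p q)"
    by simp
  also have "\<dots> = Gr CARD('n) ?J p q"
    unfolding card_pairing_tensor_support[OF finJ p q] Gr_def
    by (simp add: power_add power_minus[of "2 * real CARD('n)"])
  finally show ?thesis .
qed

end

text \<open>For the pairing of a permutation, the normalizing sign counts the chosen cycles.\<close>

lemma normalized_tensor_pairing_of:
  assumes fin: "finite I" and pos: "\<And>i. i \<in> I \<Longrightarrow> 0 < i" and a: "\<alpha> \<in> PM I"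
  shows "normalized_tensor I (pairing_of I \<alpha>) z = (- 1) ^ num_orbits (FD I \<alpha>) \<alpha> *
    (\<Prod>m\<in>FD I \<alpha>. of_int (sgn m) * sform (z m) (z (- \<alpha> m)))"
proof -
  have "FD I \<alpha> \<subseteq> pm I"
    by (rule FD_subset)
  then have "pairing_tensor (pairing_of I \<alpha>) (FD I \<alpha>) z = (\<Prod>m\<in>FD I \<alpha>. sform (z m) (z (- \<alpha> m)))"
    unfolding pairing_tensor_def by (intro prod.cong refl) (auto simp: pairing_of_def)
  then show ?thesis
    using PM_pairing_of(3)[OF fin pos a] num_orbits_PM(2)[OF fin pos a]
    by (simp add: normalized_tensor_def norm_sign_def prod.distrib)
qed

lemma FD_inv:
  assumes "finite I" "\<alpha> \<in> PM I"
  shows "FD I (inv \<alpha>) = FD I \<alpha>" "num_orbits S (inv \<alpha>) = num_orbits S \<alpha>"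
proof -
  have "permutation \<alpha>"
    using PM_D(1)[OF assms(2)] finite_pm[OF assms(1)] by (rule permutes_permutation)
  then show "FD I (inv \<alpha>) = FD I \<alpha>" "num_orbits S (inv \<alpha>) = num_orbits S \<alpha>"
    by (simp_all add: FD_def num_orbits_def orbit_inv_eq)
qed

text \<open>The chosen cycles contain exactly one of \<open>k\<close> and \<open>-k\<close>.\<close>

lemma bij_abs_FD:
  assumes fin: "finite I" and pos: "\<And>i. i \<in> I \<Longrightarrow> 0 < i" and a: "\<alpha> \<in> PM I"
  shows "bij_betw abs (FD I \<alpha>) I"
proof (rule bij_betwI[where g = "\<lambda>k. if k \<in> FD I \<alpha> then k else - k"])
  have sub: "FD I \<alpha> \<subseteq> pm I"
    by (rule FD_subset)
  show "abs \<in> FD I \<alpha> \<rightarrow> I"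
    using sub pos by (force simp: pm_def)
  have sgn: "- k \<in> FD I \<alpha> \<longleftrightarrow> k \<notin> FD I \<alpha>" if "k \<in> pm I" for k
    by (rule uminus_FD_iff[OF fin pos a that])
  show "(\<lambda>k. if k \<in> FD I \<alpha> then k else - k) \<in> I \<rightarrow> FD I \<alpha>"
    using sgn by (auto simp: pm_def)
  show "(if \<bar>k\<bar> \<in> FD I \<alpha> then \<bar>k\<bar> else - \<bar>k\<bar>) = k" if "k \<in> FD I \<alpha>" for k
    using that sgn[of k] sub by (auto simp: abs_if)
  show "\<bar>if k \<in> FD I \<alpha> then k else - k\<bar> = k" if "k \<in> I" for k
    using pos[OF that] by simp
qed

section \<open>The Weingarten expansion\<close>

lemma Gr_commute: "Gr N J p q = Gr N J q p"
  by (simp add: Gr_def join_blocks_commute)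

lemma Wg_pseudoinverse:
  assumes "finite J"
  shows "is_pseudoinverse (pairings J) (Gr N J) (Wg N J)"
  unfolding Wg_def by (rule is_pseudoinverse_The[OF finite_pairings[OF assms] Gr_commute])

lemma elem_act_combination:
  assumes "\<And>i k v. i \<in> S \<Longrightarrow> k \<in> J \<Longrightarrow> c i (z(k := v)) = c i z"
  shows "elem_act J x y (\<lambda>z. \<Sum>i\<in>S. c i z * f i z) z = (\<Sum>i\<in>S. c i z * elem_act J x y (f i) z)"
proof -
  have "elem_act J x y (\<lambda>z. \<Sum>i\<in>S. c i z * f i z) z
      = (\<Sum>k\<in>J. \<Sum>i\<in>S. c i z * (if z k = x then f i (z(k := y)) else 0))"
    unfolding elem_act_def using assms by (intro sum.cong refl) auto
  also have "\<dots> = (\<Sum>i\<in>S. \<Sum>k\<in>J. c i z * (if z k = x then f i (z(k := y)) else 0))"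
    by (rule sum.swap)
  finally show ?thesis
    by (simp add: elem_act_def sum_distrib_left)
qed

lemma sp_invariant_combination:
  assumes "\<And>i. i \<in> S \<Longrightarrow> sp_invariant J (f i)"
    and "\<And>i k v z. i \<in> S \<Longrightarrow> k \<in> J \<Longrightarrow> c i (z(k := v)) = c i z"
  shows "sp_invariant J (\<lambda>z. \<Sum>i\<in>S. c i z * f i z)"
proof -
  have *: "elem_act J x y (\<lambda>z. \<Sum>i\<in>S. c i z * f i z) z = (\<Sum>i\<in>S. c i z * elem_act J x y (f i) z)" for x y z
    by (rule elem_act_combination) (use assms in auto)
  show ?thesis
    unfolding sp_invariant_def *
  proof (intro allI)
    fix x y z
    show "(\<Sum>i\<in>S. c i z * elem_act J x y (f i) z)
        = bsgn x * bsgn y * (\<Sum>i\<in>S. c i z * elem_act J (flip y) (flip x) (f i) z)"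
      unfolding sum_distrib_left
    proof (intro sum.cong refl)
      fix i assume "i \<in> S"
      then have "elem_act J x y (f i) z = bsgn x * bsgn y * elem_act J (flip y) (flip x) (f i) z"
        using assms(1) unfolding sp_invariant_def by blast
      then show "c i z * elem_act J x y (f i) z
          = bsgn x * bsgn y * (c i z * elem_act J (flip y) (flip x) (f i) z)"
        by simp
    qed
  qed
qed

lemma sp_invariant_diff:
  assumes "sp_invariant J f" "sp_invariant J g"
  shows "sp_invariant J (\<lambda>z. f z - g z)"
proof -
  have *: "elem_act J x y (\<lambda>z. f z - g z) z = elem_act J x y f z - elem_act J x y g z" for x y z
    unfolding elem_act_def sum_subtractf[symmetric] by (intro sum.cong) auto
  show ?thesis
    unfolding sp_invariant_def *
  proof (intro allI)
    fix x y z
    have "elem_act J x y f z = bsgn x * bsgn y * elem_act J (flip y) (flip x) f z"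
      "elem_act J x y g z = bsgn x * bsgn y * elem_act J (flip y) (flip x) g z"
      using assms unfolding sp_invariant_def by blast+
    then show "elem_act J x y f z - elem_act J x y g z
        = bsgn x * bsgn y * (elem_act J (flip y) (flip x) f z - elem_act J (flip y) (flip x) g z)"
      by (simp add: right_diff_distrib)
  qed
qed

lemma agree_off_upd: "k \<in> J \<Longrightarrow> agree_off J (z(k := v)) = agree_off J z"
  by (auto simp: agree_off_def)

context
  fixes I :: "int set"
  assumes fin: "finite I" and pos: "\<And>i. i \<in> I \<Longrightarrow> 0 < i"
begin

lemma sp_invariant_normalized_tensor:
  assumes "p \<in> pairings (pm I)"
  shows "sp_invariant (pm I) (normalized_tensor I p :: (int \<Rightarrow> 'n \<times> bool) \<Rightarrow> real)"
proof -
  have "sp_invariant (pm I) (pairing_tensor p (FD I (pairing_of I p)) :: (int \<Rightarrow> 'n \<times> bool) \<Rightarrow> real)"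
    by (rule sp_invariant_pairing_tensor[OF finite_pm[OF fin] assms half_FD_pairing(2)[OF fin pos assms]])
  then have "sp_invariant (pm I) (\<lambda>z. \<Sum>i\<in>{()}. norm_sign I p * pairing_tensor p (FD I (pairing_of I p)) (z :: int \<Rightarrow> 'n \<times> bool))"
    by (intro sp_invariant_combination) auto
  then show ?thesis
    by (simp add: normalized_tensor_def[abs_def])
qed

lemma normalized_tensor_cong:
  assumes "p \<in> pairings (pm I)" "\<And>k. k \<in> pm I \<Longrightarrow> y k = z k"
  shows "normalized_tensor I p y = normalized_tensor I p z"
  using half_FD_pairing(2)[OF fin pos assms(1)] assms pairingsD(4)[OF assms(1)]
  by (auto simp: normalized_tensor_def pairing_tensor_def half_def intro!: prod.cong)

text \<open>The difference \<open>D\<close> of the two sides is invariant, so it suffices that it is orthogonal to the pairing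
  tensors. With \<open>b\<close> the vector of the inner products of \<open>T\<close> with the pairing tensors, this says
  \<open>(1 - G W) b = 0\<close>. The rows of \<open>1 - G W\<close> lie in the kernel of the Gram matrix \<open>G\<close>, so they are
  coefficients of linear relations between the pairing tensors, and \<open>b\<close> inherits these relations.\<close>

theorem Weingarten_expansion:
  fixes T :: "(int \<Rightarrow> 'n::finite \<times> bool) \<Rightarrow> real"
  assumes T: "sp_invariant (pm I) T"
  shows "T z = (\<Sum>p\<in>pairings (pm I). \<Sum>q\<in>pairings (pm I).
    Wg CARD('n) (pm I) p q * normalized_tensor I p z * (\<Sum>y\<in>agree_off (pm I) z. normalized_tensor I q y * T y))"
proof -
  let ?J = "pm I" and ?P = "pairings (pm I)"
  let ?G = "Gr CARD('n) ?J" and ?W = "Wg CARD('n) ?J"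
  note finJ = finite_pm[OF fin]
  note finP = finite_pairings[OF finJ]
  define b where "b q z = (\<Sum>y\<in>agree_off ?J z. normalized_tensor I q y * T y)" for q z
  have b_upd: "b q (z(k := v)) = b q z" if "k \<in> ?J" for q z k v
    using that by (simp add: b_def agree_off_upd)
  have b_agree: "b q y = b q z" if "y \<in> agree_off ?J z" for q y z
    using agree_off_eq[OF that] by (simp add: b_def)
  define D where "D z = T z - (\<Sum>p\<in>?P. (\<Sum>q\<in>?P. ?W p q * b q z) * normalized_tensor I p z)" for z
  have "sp_invariant ?J D"
    unfolding D_def by (intro sp_invariant_diff T sp_invariant_combination sp_invariant_normalized_tensor) (simp_all add: b_upd)
  have orth: "(\<Sum>y\<in>agree_off ?J z. normalized_tensor I r y * D y) = 0" if r: "r \<in> ?P" for r z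
  proof -
    \<comment> \<open>Row \<open>r\<close> of \<open>1 - G W\<close>.\<close>
    define x where "x q = (if q = r then 1 else 0) - mat_prod ?P ?G ?W r q" for q
    have ker: "(\<Sum>q\<in>?P. x q * ?G q s) = 0" if s: "s \<in> ?P" for s
    proof -
      have "(\<Sum>q\<in>?P. x q * ?G q s) = (\<Sum>q\<in>?P. if q = r then ?G q s else 0) - mat_prod ?P (mat_prod ?P ?G ?W) ?G r s"
        unfolding mat_prod_def[of _ "mat_prod _ _ _"] sum_subtractf[symmetric]
        by (intro sum.cong) (auto simp: x_def algebra_simps)
      also have "\<dots> = 0"
        using Wg_pseudoinverse[OF finJ, of "CARD('n)"] r s finP by (simp add: is_pseudoinverse_def)
      finally show ?thesis .
    qed
    have "(\<Sum>y\<in>agree_off ?J z. (\<Sum>q\<in>?P. x q * normalized_tensor I q y)\<^sup>2)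
        = (\<Sum>y\<in>agree_off ?J z. \<Sum>s\<in>?P. \<Sum>q\<in>?P. x s * (x q * (normalized_tensor I q y * normalized_tensor I s y)))"
      unfolding power2_eq_square sum_product by (subst sum.swap) (simp add: mult_ac)
    also have "\<dots> = (\<Sum>s\<in>?P. \<Sum>y\<in>agree_off ?J z. \<Sum>q\<in>?P. x s * (x q * (normalized_tensor I q y * normalized_tensor I s y)))"
      by (rule sum.swap)
    also have "\<dots> = (\<Sum>s\<in>?P. \<Sum>q\<in>?P. \<Sum>y\<in>agree_off ?J z. x s * (x q * (normalized_tensor I q y * normalized_tensor I s y)))"
      by (intro sum.cong refl sum.swap)
    also have "\<dots> = (\<Sum>s\<in>?P. x s * (\<Sum>q\<in>?P. x q * ?G q s))"
      by (intro sum.cong refl) (simp add: sum_distrib_left[symmetric] Gram_normalized_tensor[OF fin pos])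
    also have "\<dots> = 0"
      by (simp add: ker)
    finally have "(\<Sum>y\<in>agree_off ?J z. (\<Sum>q\<in>?P. x q * normalized_tensor I q y)\<^sup>2) = 0" .
    then have null: "(\<Sum>q\<in>?P. x q * normalized_tensor I q y) = 0" if "y \<in> agree_off ?J z" for y
      using that finite_agree_off[OF finJ, of z] by (subst (asm) sum_nonneg_eq_0_iff) auto
    have "(\<Sum>q\<in>?P. x q * b q z) = (\<Sum>y\<in>agree_off ?J z. (\<Sum>q\<in>?P. x q * normalized_tensor I q y) * T y)"
      unfolding b_def sum_distrib_left sum_distrib_right by (subst sum.swap) (simp add: mult_ac)
    also have "\<dots> = 0"
      using null by simp
    finally have xb: "(\<Sum>q\<in>?P. x q * b q z) = 0" .
    have "(\<Sum>y\<in>agree_off ?J z. normalized_tensor I r y * D y) = b r z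
        - (\<Sum>y\<in>agree_off ?J z. \<Sum>p\<in>?P. \<Sum>q\<in>?P. ?W p q * b q z * (normalized_tensor I r y * normalized_tensor I p y))"
      unfolding b_def[of r] sum_subtractf[symmetric]
    proof (intro sum.cong refl)
      fix y assume y: "y \<in> agree_off ?J z"
      show "normalized_tensor I r y * D y = normalized_tensor I r y * T y
          - (\<Sum>p\<in>?P. \<Sum>q\<in>?P. ?W p q * b q z * (normalized_tensor I r y * normalized_tensor I p y))"
        unfolding D_def b_agree[OF y] right_diff_distrib sum_distrib_left sum_distrib_right
        by (simp add: mult_ac)
    qed
    also have "(\<Sum>y\<in>agree_off ?J z. \<Sum>p\<in>?P. \<Sum>q\<in>?P. ?W p q * b q z * (normalized_tensor I r y * normalized_tensor I p y))
        = (\<Sum>p\<in>?P. \<Sum>q\<in>?P. \<Sum>y\<in>agree_off ?J z. ?W p q * b q z * (normalized_tensor I r y * normalized_tensor I p y))"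
      by (subst sum.swap, intro sum.cong refl sum.swap)
    also have "\<dots> = (\<Sum>p\<in>?P. \<Sum>q\<in>?P. ?W p q * b q z * ?G r p)"
      by (intro sum.cong refl) (simp add: sum_distrib_left[symmetric] Gram_normalized_tensor[OF fin pos] r)
    also have "\<dots> = (\<Sum>q\<in>?P. mat_prod ?P ?G ?W r q * b q z)"
      unfolding mat_prod_def sum_distrib_right by (subst sum.swap) (simp add: mult_ac)
    also have "b r z - \<dots> = (\<Sum>q\<in>?P. x q * b q z)"
    proof -
      have "(\<Sum>q\<in>?P. x q * b q z) = (\<Sum>q\<in>?P. if q = r then b q z else 0) - (\<Sum>q\<in>?P. mat_prod ?P ?G ?W r q * b q z)"
        unfolding sum_subtractf[symmetric] by (intro sum.cong) (auto simp: x_def algebra_simps)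
      then show ?thesis
        using r finP by simp
    qed
    finally show ?thesis
      using xb by simp
  qed
  have "D z = 0"
  proof (rule sp_invariant_orthogonal_zero[OF finJ \<open>sp_invariant ?J D\<close>])
    fix r assume r: "r \<in> ?P"
    have "norm_sign I r \<noteq> 0"
      by (simp add: norm_sign_eq[OF fin pos r])
    then have "(\<Sum>y\<in>agree_off ?J z. pairing_tensor r (FD I (pairing_of I r)) y * D y) = 0" for z
      using orth[OF r, of z] by (simp add: normalized_tensor_def mult.assoc sum_distrib_left[symmetric])
    then show "\<exists>H. half r ?J H \<and> (\<forall>z. (\<Sum>y\<in>agree_off ?J z. pairing_tensor r H y * D y) = 0)"
      using half_FD_pairing(2)[OF fin pos r] by blast
  qed
  then have "T z = (\<Sum>p\<in>?P. (\<Sum>q\<in>?P. ?W p q * b q z) * normalized_tensor I p z)"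
    by (simp add: D_def)
  then show ?thesis
    unfolding sum_distrib_right b_def by (simp only: mult_ac)
qed

end

lemma sum_PiE_insert:
  fixes f :: "('a \<Rightarrow> 'b) \<Rightarrow> 'c::comm_monoid_add"
  assumes "c \<notin> K"
  shows "(\<Sum>P\<in>PiE (insert c K) B. f P) = (\<Sum>p\<in>B c. \<Sum>P\<in>PiE K B. f (P(c := p)))"
proof -
  have "bij_betw (\<lambda>(p, P). P(c := p)) (B c \<times> PiE K B) (PiE (insert c K) B)"
    unfolding bij_betw_def PiE_insert_eq using inj_combinator[OF assms, of B] by auto
  from sum.reindex_bij_betw[OF this, of f] show ?thesis
    by (simp add: sum.cartesian_product case_prod_unfold)
qed

text \<open>Each colour acts on its own slots, so the expansion for one colour can be applied to the
  coefficients left over from the other colours.\<close>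

theorem Weingarten_expansion_colours:
  fixes T :: "(int \<Rightarrow> 'n::finite \<times> bool) \<Rightarrow> real" and I :: "nat \<Rightarrow> int set"
  assumes "finite K" and fin: "\<And>c. c \<in> K \<Longrightarrow> finite (I c)"
    and pos: "\<And>c i. c \<in> K \<Longrightarrow> i \<in> I c \<Longrightarrow> 0 < i"
    and disj: "\<And>c d. c \<in> K \<Longrightarrow> d \<in> K \<Longrightarrow> c \<noteq> d \<Longrightarrow> pm (I c) \<inter> pm (I d) = {}"
    and T: "\<And>c. c \<in> K \<Longrightarrow> sp_invariant (pm (I c)) T"
  shows "T z = (\<Sum>P\<in>(\<Pi>\<^sub>E c\<in>K. pairings (pm (I c))). \<Sum>Q\<in>(\<Pi>\<^sub>E c\<in>K. pairings (pm (I c))).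
    (\<Prod>c\<in>K. Wg CARD('n) (pm (I c)) (P c) (Q c)) * (\<Prod>c\<in>K. normalized_tensor (I c) (P c) z) *
    (\<Sum>y\<in>agree_off (\<Union>c\<in>K. pm (I c)) z. (\<Prod>c\<in>K. normalized_tensor (I c) (Q c) y) * T y))"
  using assms
proof (induction K arbitrary: z rule: finite_induct)
  case empty
  then show ?case
    by simp
next
  case (insert c K)
  let ?B = "\<lambda>c. pairings (pm (I c))"
  let ?W = "\<lambda>c. Wg CARD('n) (pm (I c))"
  define U where "U = (\<Union>c\<in>K. pm (I c))"
  have finU: "finite U"
    using insert by (auto simp: U_def intro!: finite_pm)
  have finc: "finite (pm (I c))"
    using insert.prems by (auto intro: finite_pm)
  have cU: "U \<inter> pm (I c) = {}"
    using insert.hyps insert.prems(3) unfolding U_def by blast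
  note pos_c = insert.prems(2)[of c]
  define S where "S Q z = (\<Sum>y\<in>agree_off U z. (\<Prod>c\<in>K. normalized_tensor (I c) (Q c) y) * T y)" for Q z
  have S_inv: "sp_invariant (pm (I c)) (S Q)" if Q: "Q \<in> PiE K ?B" for Q
  proof -
    define h where "h y = (\<Prod>c\<in>K. normalized_tensor (I c) (Q c) y)" for y :: "int \<Rightarrow> 'n \<times> bool"
    have h: "h (y(k := v)) = h y" if "k \<in> pm (I c)" for y k v
      unfolding h_def
    proof (intro prod.cong refl normalized_tensor_cong)
      fix d l assume d: "d \<in> K"
      then show "finite (I d)" "Q d \<in> pairings (pm (I d))" "\<And>i. i \<in> I d \<Longrightarrow> 0 < i"
        using insert.prems Q by auto
      assume "l \<in> pm (I d)"
      then show "(y(k := v)) l = y l"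
        using cU d that by (auto simp: U_def)
    qed
    have act: "elem_act (pm (I c)) x v (S Q) z = (\<Sum>y\<in>agree_off U z. h y * elem_act (pm (I c)) x v T y)" for x v z
    proof -
      have "elem_act (pm (I c)) x v (S Q) z
          = (\<Sum>k\<in>pm (I c). \<Sum>y\<in>agree_off U z. if y k = x then h y * T (y(k := v)) else 0)"
        unfolding elem_act_def
      proof (intro sum.cong refl)
        fix k assume k: "k \<in> pm (I c)"
        then have kU: "k \<notin> U"
          using cU by blast
        have "bij_betw (\<lambda>y. y(k := v)) (agree_off U z) (agree_off U (z(k := v)))"
          by (rule bij_betwI[where g = "\<lambda>y. y(k := z k)"])
            (use kU in \<open>auto simp: agree_off_def fun_eq_iff\<close>)
        from sum.reindex_bij_betw[OF this, of "\<lambda>y. h y * T y"]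
        have "S Q (z(k := v)) = (\<Sum>y\<in>agree_off U z. h y * T (y(k := v)))"
          using h[OF k] by (simp add: S_def h_def[symmetric])
        moreover have "(\<Sum>y\<in>agree_off U z. if y k = x then h y * T (y(k := v)) else 0)
            = (\<Sum>y\<in>agree_off U z. if z k = x then h y * T (y(k := v)) else 0)"
          using kU by (intro sum.cong refl) (simp add: agree_off_def)
        ultimately show "(if z k = x then S Q (z(k := v)) else 0)
            = (\<Sum>y\<in>agree_off U z. if y k = x then h y * T (y(k := v)) else 0)"
          by simp
      qed
      also have "\<dots> = (\<Sum>y\<in>agree_off U z. \<Sum>k\<in>pm (I c). if y k = x then h y * T (y(k := v)) else 0)"
        by (rule sum.swap)
      also have "\<dots> = (\<Sum>y\<in>agree_off U z. h y * elem_act (pm (I c)) x v T y)"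
        unfolding elem_act_def sum_distrib_left by (intro sum.cong refl) auto
      finally show ?thesis .
    qed
    show ?thesis
      unfolding sp_invariant_def act
    proof (intro allI)
      fix x v z
      have *: "elem_act (pm (I c)) x v T y = bsgn x * bsgn v * elem_act (pm (I c)) (flip v) (flip x) T y" for y
        using insert.prems(4)[of c] unfolding sp_invariant_def by blast
      show "(\<Sum>y\<in>agree_off U z. h y * elem_act (pm (I c)) x v T y)
          = bsgn x * bsgn v * (\<Sum>y\<in>agree_off U z. h y * elem_act (pm (I c)) (flip v) (flip x) T y)"
        unfolding sum_distrib_left by (intro sum.cong refl) (subst *, simp)
    qed
  qed
  have S_expand: "S Q z = (\<Sum>p\<in>?B c. \<Sum>q\<in>?B c. ?W c p q * normalized_tensor (I c) p z *
      (\<Sum>y\<in>agree_off (U \<union> pm (I c)) z. normalized_tensor (I c) q y * (\<Prod>c\<in>K. normalized_tensor (I c) (Q c) y) * T y))"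
    if Q: "Q \<in> PiE K ?B" for Q z
  proof -
    have "S Q z = (\<Sum>p\<in>?B c. \<Sum>q\<in>?B c. ?W c p q * normalized_tensor (I c) p z *
        (\<Sum>y\<in>agree_off (pm (I c)) z. normalized_tensor (I c) q y * S Q y))"
      by (rule Weingarten_expansion[OF _ _ S_inv[OF Q]]) (use insert.prems in auto)
    moreover have "(\<Sum>y\<in>agree_off (pm (I c)) z. normalized_tensor (I c) q y * S Q y)
        = (\<Sum>y\<in>agree_off (U \<union> pm (I c)) z. normalized_tensor (I c) q y * (\<Prod>c\<in>K. normalized_tensor (I c) (Q c) y) * T y)"
      if q: "q \<in> ?B c" for q
      unfolding sum_agree_off_Un[OF finU finc cU] S_def sum_distrib_left
    proof (intro sum.cong refl)
      fix y x :: "int \<Rightarrow> 'n \<times> bool" assume x: "x \<in> agree_off U y"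
      have "normalized_tensor (I c) q x = normalized_tensor (I c) q y"
        by (rule normalized_tensor_cong[OF _ _ q]) (use insert.prems x cU in \<open>auto simp: agree_off_def\<close>)
      then show "normalized_tensor (I c) q y * ((\<Prod>c\<in>K. normalized_tensor (I c) (Q c) x) * T x)
          = normalized_tensor (I c) q x * (\<Prod>c\<in>K. normalized_tensor (I c) (Q c) x) * T x"
        by simp
    qed
    ultimately show ?thesis
      by simp
  qed
  have upd: "(\<Prod>d\<in>insert c K. f d ((P(c := p)) d)) = f c p * (\<Prod>d\<in>K. f d (P d))"
    for f :: "nat \<Rightarrow> (int \<Rightarrow> int) \<Rightarrow> real" and P p
    using insert.hyps by (simp, intro disjI2 prod.cong) auto
  have upd2: "(\<Prod>d\<in>insert c K. f d ((P(c := p)) d) ((Q(c := q)) d)) = f c p q * (\<Prod>d\<in>K. f d (P d) (Q d))"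
    for f :: "nat \<Rightarrow> (int \<Rightarrow> int) \<Rightarrow> (int \<Rightarrow> int) \<Rightarrow> real" and P p Q q
    using insert.hyps by (simp, intro disjI2 prod.cong) auto
  have "T z = (\<Sum>P\<in>PiE K ?B. \<Sum>Q\<in>PiE K ?B.
      (\<Prod>c\<in>K. ?W c (P c) (Q c)) * (\<Prod>c\<in>K. normalized_tensor (I c) (P c) z) * S Q z)"
    unfolding S_def U_def by (rule insert.IH) (use insert.prems in auto)
  also have "\<dots> = (\<Sum>P\<in>PiE K ?B. \<Sum>Q\<in>PiE K ?B. \<Sum>p\<in>?B c. \<Sum>q\<in>?B c.
      (?W c p q * (\<Prod>c\<in>K. ?W c (P c) (Q c))) * (normalized_tensor (I c) p z * (\<Prod>c\<in>K. normalized_tensor (I c) (P c) z)) *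
      (\<Sum>y\<in>agree_off (U \<union> pm (I c)) z. normalized_tensor (I c) q y * (\<Prod>c\<in>K. normalized_tensor (I c) (Q c) y) * T y))"
    by (intro sum.cong refl) (simp add: S_expand sum_distrib_left mult_ac)
  also have "\<dots> = (\<Sum>P\<in>PiE K ?B. \<Sum>p\<in>?B c. \<Sum>Q\<in>PiE K ?B. \<Sum>q\<in>?B c.
      (?W c p q * (\<Prod>c\<in>K. ?W c (P c) (Q c))) * (normalized_tensor (I c) p z * (\<Prod>c\<in>K. normalized_tensor (I c) (P c) z)) *
      (\<Sum>y\<in>agree_off (U \<union> pm (I c)) z. normalized_tensor (I c) q y * (\<Prod>c\<in>K. normalized_tensor (I c) (Q c) y) * T y))"
    by (intro sum.cong refl sum.swap)
  also have "\<dots> = (\<Sum>p\<in>?B c. \<Sum>P\<in>PiE K ?B. \<Sum>q\<in>?B c. \<Sum>Q\<in>PiE K ?B.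
      (?W c p q * (\<Prod>c\<in>K. ?W c (P c) (Q c))) * (normalized_tensor (I c) p z * (\<Prod>c\<in>K. normalized_tensor (I c) (P c) z)) *
      (\<Sum>y\<in>agree_off (U \<union> pm (I c)) z. normalized_tensor (I c) q y * (\<Prod>c\<in>K. normalized_tensor (I c) (Q c) y) * T y))"
    by (subst sum.swap) (intro sum.cong refl sum.swap)
  also have "\<dots> = (\<Sum>P\<in>PiE (insert c K) ?B. \<Sum>Q\<in>PiE (insert c K) ?B.
      (\<Prod>d\<in>insert c K. ?W d (P d) (Q d)) * (\<Prod>d\<in>insert c K. normalized_tensor (I d) (P d) z) *
      (\<Sum>y\<in>agree_off (U \<union> pm (I c)) z. (\<Prod>d\<in>insert c K. normalized_tensor (I d) (Q d) y) * T y))"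
    unfolding sum_PiE_insert[OF insert.hyps(2)] upd2[of "\<lambda>d. Wg CARD('n) (pm (I d))"]
      upd[of "\<lambda>d p. normalized_tensor (I d) p y" for y] ..
  finally show ?case
    by (simp add: U_def Un_commute)
qed

section \<open>Symplectic matrices as complex matrices\<close>

instance quat :: real_algebra_1
  by standard (simp_all add: times_quat_def scaleR_quat_def algebra_simps)

definition bsgn_int :: "'n \<times> bool \<Rightarrow> int" where
  "bsgn_int x = (if snd x then 1 else - 1)"

definition complex_entry :: "'n::finite qmat \<Rightarrow> 'n \<times> bool \<Rightarrow> 'n \<times> bool \<Rightarrow> complex" where
  "complex_entry A x y = qmat_entry A (fst x) (fst y) (bsgn_int x) (bsgn_int y)"

lemma bsgn_int_cases: "bsgn_int x = 1 \<or> bsgn_int x = - 1"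
  by (simp add: bsgn_int_def)

lemma bsgn_int_flip [simp]: "bsgn_int (flip x) = - bsgn_int x"
  by (simp add: bsgn_int_def flip_def)

lemma of_real_bsgn_sq [simp]: "complex_of_real (bsgn x) * (complex_of_real (bsgn x) * t) = t"
  by (simp add: bsgn_def)

lemma quat_entry_add: "quat_entry (p + q) h h' = quat_entry p h h' + quat_entry q h h'"
  by (simp add: quat_entry_def plus_quat_def complex_eq_iff)

lemma quat_entry_0: "quat_entry 0 h h' = 0"
  by (simp add: quat_entry_def zero_quat_def complex_eq_iff)

lemma quat_entry_scaleR: "quat_entry (r *\<^sub>R p) h h' = r *\<^sub>R quat_entry p h h'"
  by (simp add: quat_entry_def scaleR_quat_def complex_eq_iff)

lemma quat_entry_sum: "quat_entry (\<Sum>i\<in>A. p i) h h' = (\<Sum>i\<in>A. quat_entry (p i) h h')"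
  by (induction A rule: infinite_finite_induct) (simp_all add: quat_entry_0 quat_entry_add)

lemma quat_entry_mult:
  "quat_entry (p * q) h h' = quat_entry p h 1 * quat_entry q 1 h' + quat_entry p h (- 1) * quat_entry q (- 1) h'"
  by (simp add: quat_entry_def times_quat_def complex_eq_iff algebra_simps)

lemma quat_entry_qcnj:
  "quat_entry (qcnj q) (bsgn_int x) (bsgn_int y)
    = of_real (bsgn x * bsgn y) * quat_entry q (- bsgn_int y) (- bsgn_int x)"
  by (simp add: quat_entry_def qcnj_def bsgn_int_def bsgn_def complex_eq_iff)

lemma sum_signed_index: "(\<Sum>w\<in>UNIV. f w) = (\<Sum>i\<in>UNIV. f (i, True) + f (i, False))"
  for f :: "'n::finite \<times> bool \<Rightarrow> 'c::comm_monoid_add"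
  by (simp add: UNIV_Times_UNIV[symmetric] sum.cartesian_product' UNIV_bool add.commute del: UNIV_Times_UNIV)

lemma complex_entry_add: "complex_entry (A + B) x y = complex_entry A x y + complex_entry B x y"
  by (simp add: complex_entry_def qmat_entry_def quat_entry_add)

lemma complex_entry_scaleR: "complex_entry (r *\<^sub>R A) x y = r *\<^sub>R complex_entry A x y"
  by (simp add: complex_entry_def qmat_entry_def quat_entry_scaleR)

lemma complex_entry_mult: "complex_entry (A ** B) x y = (\<Sum>w\<in>UNIV. complex_entry A x w * complex_entry B w y)"
  by (simp add: complex_entry_def qmat_entry_def matrix_matrix_mult_def quat_entry_sum quat_entry_mult
      sum_signed_index bsgn_int_def)

lemma complex_entry_qadj: "complex_entry (qadj A) x y = of_real (bsgn x * bsgn y) * complex_entry A (flip y) (flip x)"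
  unfolding complex_entry_def qmat_entry_def qadj_def bsgn_int_flip by (simp add: quat_entry_qcnj) (simp add: flip_def)

lemma complex_entry_one: "complex_entry (mat 1) x y = (if x = y then 1 else 0)"
  by (cases x; cases y)
    (auto simp: complex_entry_def qmat_entry_def mat_def quat_entry_def one_quat_def zero_quat_def bsgn_int_def
      complex_eq_iff)

text \<open>Transposing the row index with the symplectic form makes rows and columns transform alike
  under conjugation.\<close>

definition twisted_entry :: "'n::finite qmat \<Rightarrow> 'n \<times> bool \<Rightarrow> 'n \<times> bool \<Rightarrow> complex" where
  "twisted_entry A x y = of_real (bsgn x) * complex_entry A x (flip y)"

text \<open>The matrix by which a single index transforms under conjugation by \<open>U\<close>.\<close>

definition coact :: "'n::finite qmat \<Rightarrow> 'n \<times> bool \<Rightarrow> 'n \<times> bool \<Rightarrow> complex" where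
  "coact U u x = complex_entry U (flip u) (flip x)"

lemma sum_flip: "(\<Sum>w\<in>UNIV. f (flip w)) = (\<Sum>w\<in>UNIV. f w)" for f :: "'n::finite \<times> bool \<Rightarrow> 'c::comm_monoid_add"
  by (rule sum.reindex_bij_betw) (rule bij_flip)

lemma twisted_entry_conj:
  "twisted_entry (qadj U ** A ** U) x v
    = (\<Sum>u\<in>UNIV. \<Sum>u'\<in>UNIV. coact U u x * coact U u' v * twisted_entry A u u')"
proof -
  have "twisted_entry (qadj U ** A ** U) x v
      = (\<Sum>w'\<in>UNIV. \<Sum>w\<in>UNIV. of_real (bsgn x * bsgn x * bsgn w) * complex_entry U (flip w) (flip x) * complex_entry A w w' * complex_entry U w' (flip v))"
    by (simp add: twisted_entry_def complex_entry_mult complex_entry_qadj sum_distrib_left sum_distrib_right mult_ac)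
  also have "\<dots> = (\<Sum>w\<in>UNIV. \<Sum>w'\<in>UNIV. of_real (bsgn w) * complex_entry U (flip w) (flip x) * complex_entry A w w' * complex_entry U w' (flip v))"
    by (subst sum.swap) simp
  also have "\<dots> = (\<Sum>w\<in>UNIV. \<Sum>w'\<in>UNIV. of_real (bsgn w) * complex_entry U (flip w) (flip x) * complex_entry A w (flip w') * complex_entry U (flip w') (flip v))"
    by (intro sum.cong refl sum_flip[symmetric])
  finally show ?thesis
    by (simp add: twisted_entry_def coact_def mult_ac)
qed

text \<open>Multilinear expansion, with one factor for each slot.\<close>

lemma prod_twisted_entry_conj:
  fixes z :: "int \<Rightarrow> 'n::finite \<times> bool"
  assumes "finite K" "\<And>k. k \<in> K \<Longrightarrow> 0 < k"
  shows "(\<Prod>k\<in>K. twisted_entry (qadj (V k) ** A k ** V k) (z k) (z (- k)))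
    = (\<Sum>y\<in>agree_off (pm K) z. (\<Prod>k\<in>pm K. coact (V \<bar>k\<bar>) (y k) (z k)) * (\<Prod>k\<in>K. twisted_entry (A k) (y k) (y (- k))))"
  using assms
proof (induction K rule: finite_induct)
  case empty
  then show ?case
    by (simp add: pm_def)
next
  case (insert k K)
  have k: "0 < k" "k \<notin> pm K" "- k \<notin> pm K" "\<And>l. l \<in> K \<Longrightarrow> l \<noteq> k \<and> l \<noteq> - k \<and> - l \<noteq> k \<and> - l \<noteq> - k"
  proof -
    have K: "0 < l" "l \<noteq> k" if "l \<in> K" for l
      using that insert.hyps insert.prems by auto
    show k: "0 < k"
      using insert.prems by simp
    show "l \<noteq> k \<and> l \<noteq> - k \<and> - l \<noteq> k \<and> - l \<noteq> - k" if "l \<in> K" for l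
      using K[OF that] k by auto
    show "k \<notin> pm K" "- k \<notin> pm K"
      using K k by (fastforce simp: pm_def)+
  qed
  have pm_ins: "pm (insert k K) = insert (- k) (insert k (pm K))"
    by (auto simp: pm_def)
  have finK: "finite (pm K)"
    using insert.hyps by (simp add: pm_def)
  let ?c = "\<lambda>u u' y. coact (V k) u (z k) * coact (V k) u' (z (- k)) * twisted_entry (A k) u u' *
    ((\<Prod>k\<in>pm K. coact (V \<bar>k\<bar>) (y k) (z k)) * (\<Prod>k\<in>K. twisted_entry (A k) (y k) (y (- k))))"
  have "(\<Sum>y\<in>agree_off (pm (insert k K)) z. (\<Prod>k\<in>pm (insert k K). coact (V \<bar>k\<bar>) (y k) (z k))
        * (\<Prod>k\<in>insert k K. twisted_entry (A k) (y k) (y (- k))))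
      = (\<Sum>y\<in>agree_off (pm K) z. \<Sum>u\<in>UNIV. \<Sum>u'\<in>UNIV. ?c u u' y)"
  proof -
    have "(\<Prod>j\<in>pm (insert k K). coact (V \<bar>j\<bar>) ((y(k := u, - k := u')) j) (z j))
          * (\<Prod>j\<in>insert k K. twisted_entry (A j) ((y(k := u, - k := u')) j) ((y(k := u, - k := u')) (- j))) = ?c u u' y"
      for y u u'
    proof -
      have "(\<Prod>j\<in>pm K. coact (V \<bar>j\<bar>) ((y(k := u, - k := u')) j) (z j)) = (\<Prod>j\<in>pm K. coact (V \<bar>j\<bar>) (y j) (z j))"
        using k by (intro prod.cong) auto
      moreover have "(\<Prod>j\<in>K. twisted_entry (A j) ((y(k := u, - k := u')) j) ((y(k := u, - k := u')) (- j)))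
          = (\<Prod>j\<in>K. twisted_entry (A j) (y j) (y (- j)))"
        using k(4) by (intro prod.cong) auto
      ultimately show ?thesis
        unfolding pm_ins using k finK insert.hyps by simp
    qed
    then show ?thesis
      unfolding pm_ins using k by (simp add: sum_agree_off_insert del: fun_upd_apply)
  qed
  also have "\<dots> = (\<Prod>k\<in>insert k K. twisted_entry (qadj (V k) ** A k ** V k) (z k) (z (- k)))"
    using insert by (simp add: twisted_entry_conj sum_distrib_right sum_distrib_left)
  finally show ?case ..
qed

section \<open>One-parameter subgroups\<close>

lemma matrix_mult_scaleR:
  fixes A B :: "'n::finite qmat"
  shows "(r *\<^sub>R A) ** B = r *\<^sub>R (A ** B)" "A ** (r *\<^sub>R B) = r *\<^sub>R (A ** B)"
  by (simp_all add: matrix_matrix_mult_def vec_eq_iff scaleR_sum_right)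

lemma matrix_mult_add_left: "(A + B) ** C = A ** C + B ** C" for A B C :: "'n::finite qmat"
  by (simp add: matrix_matrix_mult_def vec_eq_iff distrib_right sum.distrib)

lemma qcnj_simps: "qcnj (p + q) = qcnj p + qcnj q" "qcnj (r *\<^sub>R q) = r *\<^sub>R qcnj q" "qcnj (qcnj q) = q"
  "qcnj 0 = 0" "qcnj 1 = 1" "qcnj (p * q) = qcnj q * qcnj p"
  by (simp_all add: qcnj_def plus_quat_def scaleR_quat_def zero_quat_def one_quat_def times_quat_def)

lemma qadj_simps: "qadj (A + B) = qadj A + qadj B" "qadj (r *\<^sub>R A) = r *\<^sub>R qadj A" "qadj (mat 1) = mat 1"
  by (auto simp: qadj_def vec_eq_iff qcnj_simps mat_def)

lemma qadj_mult: "qadj (A ** B) = qadj B ** qadj A"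
proof -
  have "qcnj (\<Sum>i\<in>S. f i) = (\<Sum>i\<in>S. qcnj (f i))" for f :: "'a \<Rightarrow> quat" and S
    by (induction S rule: infinite_finite_induct) (simp_all add: qcnj_simps)
  then show ?thesis
    by (simp add: qadj_def matrix_matrix_mult_def vec_eq_iff qcnj_simps)
qed

text \<open>If \<open>S\<close> is antihermitian with \<open>S\<^sup>3 = -S\<close>, the exponential of \<open>t S\<close> is
  \<open>1 + sin t S + (1 - cos t) S\<^sup>2\<close>.\<close>

definition rotation :: "real \<Rightarrow> 'n::finite qmat \<Rightarrow> 'n qmat" where
  "rotation t S = mat 1 + sin t *\<^sub>R S + (1 - cos t) *\<^sub>R (S ** S)"

lemma rotation_in_Sp:
  assumes "qadj S = - 1 *\<^sub>R S" "S ** S ** S = - 1 *\<^sub>R S"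
  shows "rotation t S \<in> Sp"
proof -
  define Q where "Q = S ** S"
  define a where "a = sin t"
  define b where "b = 1 - cos t"
  have adjQ: "qadj Q = Q"
    by (simp add: Q_def qadj_mult assms(1)[simplified] matrix_mult_scaleR(1)[of "-1", simplified] matrix_mult_scaleR(2)[of _ "-1", simplified])
  have SQ: "S ** Q = - 1 *\<^sub>R S" "Q ** S = - 1 *\<^sub>R S" "S ** S = Q"
    using assms(2) by (simp_all add: Q_def matrix_mul_assoc)
  have QQ: "Q ** Q = - 1 *\<^sub>R Q"
    using SQ by (metis Q_def matrix_mul_assoc matrix_mult_scaleR(1))
  have "qadj (rotation t S) ** rotation t S = (mat 1 + (- a) *\<^sub>R S + b *\<^sub>R Q) ** (mat 1 + a *\<^sub>R S + b *\<^sub>R Q)"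
    unfolding rotation_def Q_def[symmetric] by (simp add: qadj_simps adjQ assms(1)[simplified] a_def b_def)
  also have "\<dots> = mat 1 + (b + b - a * a - b * b) *\<^sub>R Q"
    by (simp only: matrix_add_ldistrib matrix_mult_add_left matrix_mult_scaleR matrix_mul_lid matrix_mul_rid SQ QQ
        scaleR_add_left scaleR_diff_left)
      (simp add: algebra_simps)
  also have "b + b - a * a - b * b = 0"
    using sin_cos_squared_add[of t] by (simp add: a_def b_def power2_eq_square algebra_simps)
  finally show ?thesis
    by (simp add: Sp_def)
qed

lemma coact_rotation:
  "coact (rotation t S) u x = (if u = x then 1 else 0) + of_real (sin t) * coact S u x + of_real (1 - cos t) * coact (S ** S) u x"
  by (simp add: coact_def rotation_def complex_entry_add complex_entry_scaleR complex_entry_one scaleR_conv_of_real[where 'a = complex])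

definition unit_mat :: "'n \<Rightarrow> 'n \<Rightarrow> quat \<Rightarrow> 'n::finite qmat" where
  "unit_mat a b q = (\<chi> i j. if i = a \<and> j = b then q else 0)"

lemma unit_mat_mult: "unit_mat a b p ** unit_mat c d q = (if b = c then unit_mat a d (p * q) else 0)"
proof -
  have "(\<Sum>k\<in>UNIV. (if i = a \<and> k = b then p else 0) * (if k = c \<and> j = d then q else 0))
      = (\<Sum>k\<in>UNIV. if k = b then (if i = a \<and> j = d \<and> b = c then p * q else 0) else 0)" for i j
    by (intro sum.cong) auto
  then show ?thesis
    by (auto simp: unit_mat_def matrix_matrix_mult_def vec_eq_iff)
qed

lemma qadj_unit_mat: "qadj (unit_mat a b q) = unit_mat b a (qcnj q)"
  by (auto simp: qadj_def unit_mat_def vec_eq_iff qcnj_simps)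

lemma complex_entry_unit_mat: "complex_entry (unit_mat a b q) x y
    = (if fst x = a \<and> fst y = b then quat_entry q (bsgn_int x) (bsgn_int y) else 0)"
  by (simp add: complex_entry_def qmat_entry_def unit_mat_def quat_entry_0)

text \<open>The derivative at \<open>t = 0\<close> of the constant function \<open>t \<mapsto> T z\<close>. At \<open>t = 0\<close> all factors are Kronecker
  symbols, so in the product rule only one slot at a time differs from \<open>z\<close>.\<close>

lemma conj_invariant_imp_derivative_zero:
  fixes T :: "(int \<Rightarrow> 'n::finite \<times> bool) \<Rightarrow> complex"
  assumes fin: "finite J" and sub: "J' \<subseteq> J"
    and inv: "\<And>t z. T z = (\<Sum>y\<in>agree_off J z.
      (\<Prod>k\<in>J. if k \<in> J' then coact (rotation t S) (y k) (z k) else if y k = z k then 1 else 0) * T y)"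
  shows "(\<Sum>k\<in>J'. \<Sum>u\<in>UNIV. coact S u (z k) * T (z(k := u))) = 0"
proof -
  define f where "f y k t = (if k \<in> J' then coact (rotation t S) (y k) (z k) else if y k = z k then 1 else 0)"
    for y k t
  define g where "g y k = (if k \<in> J' then coact S (y k) (z k) else 0)" for y k
  have f0: "f y k 0 = (if y k = z k then 1 else 0)" for y k
    by (simp add: f_def coact_rotation)
  have "(f y k has_derivative (\<lambda>h. of_real h * g y k)) (at 0)" for y k
  proof (cases "k \<in> J'")
    case True
    then have f: "f y k = (\<lambda>t. (if y k = z k then 1 else 0) + of_real (sin t) * coact S (y k) (z k)
        + of_real (1 - cos t) * coact (S ** S) (y k) (z k))"
      by (auto simp: f_def coact_rotation)
    show ?thesis
      unfolding f using True by (auto intro!: derivative_eq_intros simp: g_def)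
  qed (simp add: f_def[abs_def] g_def)
  then have deriv: "((\<lambda>t. \<Sum>y\<in>agree_off J z. (\<Prod>k\<in>J. f y k t) * T y) has_derivative
      (\<lambda>h. \<Sum>y\<in>agree_off J z. (\<Sum>k\<in>J. of_real h * g y k * (\<Prod>j\<in>J - {k}. f y j 0)) * T y)) (at 0)"
    by (intro has_derivative_sum has_derivative_mult_left has_derivative_prod) auto
  have const: "(\<lambda>t. \<Sum>y\<in>agree_off J z. (\<Prod>k\<in>J. f y k t) * T y) = (\<lambda>t. T z)"
    using inv[of z] by (simp add: f_def)
  have deriv0: "((\<lambda>t::real. T z) has_derivative (\<lambda>h. 0)) (at 0)"
    by simp
  from fun_cong[OF has_derivative_unique[OF deriv[unfolded const] deriv0], of 1]
  have "0 = (\<Sum>y\<in>agree_off J z. \<Sum>k\<in>J. g y k * (\<Prod>j\<in>J - {k}. f y j 0) * T y)"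
    by (simp add: sum_distrib_right)
  also have "\<dots> = (\<Sum>k\<in>J. \<Sum>y\<in>agree_off J z. g y k * (\<Prod>j\<in>J - {k}. f y j 0) * T y)"
    by (rule sum.swap)
  also have "\<dots> = (\<Sum>k\<in>J. if k \<in> J' then \<Sum>u\<in>UNIV. coact S u (z k) * T (z(k := u)) else 0)"
  proof (intro sum.cong refl)
    fix k assume k: "k \<in> J"
    have "(\<Sum>y\<in>agree_off J z. g y k * (\<Prod>j\<in>J - {k}. f y j 0) * T y)
        = (\<Sum>y\<in>agree_off (J - {k}) z. \<Sum>u\<in>UNIV. g (y(k := u)) k * (\<Prod>j\<in>J - {k}. f (y(k := u)) j 0) * T (y(k := u)))"
      by (rule sum_agree_off_remove[OF k])
    also have "\<dots> = (\<Sum>y\<in>agree_off (J - {k}) z. if y = z then \<Sum>u\<in>UNIV. g (z(k := u)) k * T (z(k := u)) else 0)"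
    proof (intro sum.cong refl)
      fix y assume y: "y \<in> agree_off (J - {k}) z"
      have "(\<Prod>j\<in>J - {k}. f (y(k := u)) j 0) = (if y = z then 1 else 0)" for u
      proof (cases "y = z")
        case True
        then show ?thesis
          by (simp add: f0)
      next
        case False
        then obtain j where "y j \<noteq> z j"
          by blast
        then have "j \<in> J - {k}" "f (y(k := u)) j 0 = 0"
          using y by (auto simp: agree_off_def f0)
        then show ?thesis
          using False fin by (auto intro!: prod_zero)
      qed
      then show "(\<Sum>u\<in>UNIV. g (y(k := u)) k * (\<Prod>j\<in>J - {k}. f (y(k := u)) j 0) * T (y(k := u)))
          = (if y = z then \<Sum>u\<in>UNIV. g (z(k := u)) k * T (z(k := u)) else 0)"
        by simp
    qed
    also have "\<dots> = (\<Sum>u\<in>UNIV. g (z(k := u)) k * T (z(k := u)))"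
      using fin by (simp add: finite_agree_off)
    finally show "(\<Sum>y\<in>agree_off J z. g y k * (\<Prod>j\<in>J - {k}. f y j 0) * T y)
        = (if k \<in> J' then \<Sum>u\<in>UNIV. coact S u (z k) * T (z(k := u)) else 0)"
      by (simp add: g_def)
  qed
  also have "\<dots> = (\<Sum>k\<in>J'. \<Sum>u\<in>UNIV. coact S u (z k) * T (z(k := u)))"
    using fin sub by (intro sum.mono_neutral_cong_right) auto
  finally show ?thesis ..
qed

text \<open>The infinitesimal form of the conjugation by \<open>rotation t S\<close>.\<close>

definition lie_act :: "int set \<Rightarrow> ((int \<Rightarrow> 'n \<times> bool) \<Rightarrow> complex) \<Rightarrow> (int \<Rightarrow> 'n \<times> bool) \<Rightarrow> 'n::finite qmat \<Rightarrow> complex" where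
  "lie_act J T z S = (\<Sum>k\<in>J. \<Sum>u\<in>UNIV. coact S u (z k) * T (z(k := u)))"

definition complex_elem_act :: "int set \<Rightarrow> 'b \<Rightarrow> 'b \<Rightarrow> ((int \<Rightarrow> 'b) \<Rightarrow> complex) \<Rightarrow> (int \<Rightarrow> 'b) \<Rightarrow> complex" where
  "complex_elem_act J x y T z = (\<Sum>k\<in>J. if z k = x then T (z(k := y)) else 0)"

lemma lie_act_add: "lie_act J T z (A + B) = lie_act J T z A + lie_act J T z B"
  by (simp add: lie_act_def coact_def complex_entry_add distrib_right sum.distrib)

lemma lie_act_scaleR: "lie_act J T z (r *\<^sub>R A) = of_real r * lie_act J T z A"
  by (simp add: lie_act_def coact_def complex_entry_scaleR scaleR_conv_of_real[where 'a = complex] sum_distrib_left mult_ac)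

lemma lie_act_unit_mat:
  "lie_act J T z (unit_mat a b q) =
    quat_entry q (- 1) (- 1) * complex_elem_act J (b, True) (a, True) T z
    + quat_entry q (- 1) 1 * complex_elem_act J (b, False) (a, True) T z
    + quat_entry q 1 (- 1) * complex_elem_act J (b, True) (a, False) T z
    + quat_entry q 1 1 * complex_elem_act J (b, False) (a, False) T z"
proof -
  have "(\<Sum>u\<in>UNIV. coact (unit_mat a b q) u x * f u) =
      quat_entry q (- 1) (- 1) * (if x = (b, True) then f (a, True) else 0)
      + quat_entry q (- 1) 1 * (if x = (b, False) then f (a, True) else 0)
      + quat_entry q 1 (- 1) * (if x = (b, True) then f (a, False) else 0)
      + quat_entry q 1 1 * (if x = (b, False) then f (a, False) else 0)" for x f
  proof -
    have "(\<Sum>u\<in>UNIV. coact (unit_mat a b q) u x * f u) = (\<Sum>i\<in>UNIV. if i = a then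
        (if fst x = b then quat_entry q (- 1) (- bsgn_int x) * f (a, True) + quat_entry q 1 (- bsgn_int x) * f (a, False) else 0) else 0)"
      unfolding sum_signed_index by (intro sum.cong refl) (auto simp: coact_def complex_entry_unit_mat flip_def bsgn_int_def)
    then show ?thesis
      by (cases x) (auto simp: bsgn_int_def)
  qed
  then show ?thesis
    by (simp add: lie_act_def complex_elem_act_def sum.distrib sum_distrib_left)
qed

lemma Re_complex_elem_act: "Re (complex_elem_act J x y T z) = elem_act J x y (\<lambda>z. Re (T z)) z"
  "Im (complex_elem_act J x y T z) = elem_act J x y (\<lambda>z. Im (T z)) z"
  by (auto simp: complex_elem_act_def elem_act_def intro!: sum.cong)

text \<open>The matrices \<open>q E\<^sub>a\<^sub>b - q\<^sup>* E\<^sub>b\<^sub>a\<close> with \<open>q\<close> among \<open>1, i, j, k\<close> span the Lie algebra; their complex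
  combinations give all the relations that define invariance.\<close>

lemma lie_zero_imp_sp_invariant:
  fixes T :: "(int \<Rightarrow> 'n::finite \<times> bool) \<Rightarrow> complex"
  assumes lie: "\<And>S z. qadj S = - 1 *\<^sub>R S \<Longrightarrow> S ** S ** S = - 1 *\<^sub>R S \<Longrightarrow> lie_act J T z S = 0"
  shows "sp_invariant J (\<lambda>z. Re (T z))" "sp_invariant J (\<lambda>z. Im (T z))"
proof -
  have eq: "lie_act J T z (unit_mat a b q) = lie_act J T z (unit_mat b a (qcnj q))"
    if q: "q \<in> {Quat 1 0 0 0, Quat 0 1 0 0, Quat 0 0 1 0, Quat 0 0 0 1}" for a b q z
  proof (cases "a = b")
    case False
    let ?S = "unit_mat a b q + (- 1) *\<^sub>R unit_mat b a (qcnj q)"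
    have qq: "q * qcnj q = 1" "qcnj q * q = 1"
      using q by (auto simp: qcnj_def times_quat_def one_quat_def)
    have "?S ** ?S = (- 1) *\<^sub>R unit_mat a a 1 + (- 1) *\<^sub>R unit_mat b b 1"
      using False by (simp only: matrix_add_ldistrib matrix_mult_add_left matrix_mult_scaleR unit_mat_mult qq) simp
    then have "?S ** ?S ** ?S = - 1 *\<^sub>R ?S"
      using False by (simp only: matrix_add_ldistrib matrix_mult_add_left matrix_mult_scaleR unit_mat_mult) simp
    moreover have "qadj ?S = - 1 *\<^sub>R ?S"
      by (simp only: qadj_simps qadj_unit_mat qcnj_simps) simp
    ultimately have "lie_act J T z ?S = 0"
      by (intro lie)
    then show ?thesis
      unfolding lie_act_add lie_act_scaleR by simp
  next
    case True
    show ?thesis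
    proof (cases "q = 1")
      case True
      then show ?thesis
        using \<open>a = b\<close> by (simp add: qcnj_simps)
    next
      case False
      let ?S = "unit_mat a a q"
      have qq: "q * q = - 1 *\<^sub>R 1" "qcnj q = - 1 *\<^sub>R q"
        using q False by (auto simp: qcnj_def times_quat_def one_quat_def scaleR_quat_def uminus_quat_def)
      have um: "unit_mat a a (r *\<^sub>R p) = r *\<^sub>R unit_mat a a p" for r and p
        by (auto simp: unit_mat_def vec_eq_iff)
      have "?S ** ?S ** ?S = - 1 *\<^sub>R ?S"
        by (simp only: unit_mat_mult qq um matrix_mult_scaleR refl if_True mult_1_left)
      moreover have "qadj ?S = - 1 *\<^sub>R ?S"
        by (simp only: qadj_unit_mat qq um)
      ultimately have "lie_act J T z ?S = 0"
        by (intro lie)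
      then show ?thesis
        using \<open>a = b\<close> qq(2) um lie_act_scaleR by (metis mult_zero_right)
    qed
  qed
  have main: "complex_elem_act J x y T z = of_real (bsgn x * bsgn y) * complex_elem_act J (flip y) (flip x) T z" for x y z
  proof -
    obtain b g' a g where xy: "x = (b, g')" "y = (a, g)"
      by fastforce
    note eqs = eq[of "Quat 1 0 0 0" z a b] eq[of "Quat 0 1 0 0" z a b]
      eq[of "Quat 0 0 1 0" z a b] eq[of "Quat 0 0 0 1" z a b]
    show ?thesis
      using eqs unfolding lie_act_unit_mat xy
      by (cases g; cases g') (simp_all add: quat_entry_def qcnj_def flip_def bsgn_def complex_eq_iff)
  qed
  show "sp_invariant J (\<lambda>z. Re (T z))" "sp_invariant J (\<lambda>z. Im (T z))"
    unfolding sp_invariant_def Re_complex_elem_act[symmetric]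
    by (subst main, simp)+
qed

section \<open>Families of permutations indexed by the colours\<close>

text \<open>At each point at most one factor moves, so the order of the composition is immaterial.\<close>

lemma foldr_comp_disjoint:
  assumes "distinct cs" "\<And>c. c \<in> set cs \<Longrightarrow> P c permutes S c"
    and "\<And>c d. c \<in> set cs \<Longrightarrow> d \<in> set cs \<Longrightarrow> c \<noteq> d \<Longrightarrow> S c \<inter> S d = {}"
  shows "c \<in> set cs \<Longrightarrow> x \<in> S c \<Longrightarrow> foldr (\<lambda>c g. P c \<circ> g) cs id x = P c x"
    and "(\<And>c. c \<in> set cs \<Longrightarrow> x \<notin> S c) \<Longrightarrow> foldr (\<lambda>c g. P c \<circ> g) cs id x = x"
proof -
  have "(\<forall>c\<in>set cs. x \<in> S c \<longrightarrow> foldr (\<lambda>c g. P c \<circ> g) cs id x = P c x) \<and>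
      ((\<forall>c\<in>set cs. x \<notin> S c) \<longrightarrow> foldr (\<lambda>c g. P c \<circ> g) cs id x = x)"
    using assms
  proof (induction cs)
    case (Cons d cs)
    let ?f = "foldr (\<lambda>c g. P c \<circ> g) cs id"
    have out: "P d y = y" if "y \<notin> S d" for y
      using Cons.prems(2)[of d] that by (simp add: permutes_def)
    have "(\<forall>c\<in>set cs. x \<in> S c \<longrightarrow> ?f x = P c x) \<and> ((\<forall>c\<in>set cs. x \<notin> S c) \<longrightarrow> ?f x = x)"
      by (rule Cons.IH) (use Cons.prems in auto)
    note IH = conjunct1[OF this] conjunct2[OF this]
    have "P d (?f x) = P c x" if c: "c \<in> set (d # cs)" "x \<in> S c" for c
    proof (cases "c = d")
      case True
      have "x \<notin> S e" if "e \<in> set cs" for e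
        using Cons.prems(1) Cons.prems(3)[of c e] c that True by auto
      then show ?thesis
        using IH(2) True by simp
    next
      case False
      then have "?f x = P c x"
        using IH(1) c by auto
      moreover have "P c x \<in> S c"
        using permutes_in_image[OF Cons.prems(2)[OF c(1)]] c(2) by simp
      then have "P c x \<notin> S d"
        using Cons.prems(3)[OF c(1), of d] False by auto
      ultimately show ?thesis
        using out by simp
    qed
    moreover have "P d (?f x) = x" if "\<forall>c\<in>set (d # cs). x \<notin> S c"
      using that IH(2) out by simp
    moreover have "foldr (\<lambda>c g. P c \<circ> g) (d # cs) id x = P d (?f x)"
      by (simp only: foldr.simps comp_apply)
    ultimately show ?case
      by metis
  qed simp
  then show "c \<in> set cs \<Longrightarrow> x \<in> S c \<Longrightarrow> foldr (\<lambda>c g. P c \<circ> g) cs id x = P c x"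
    and "(\<And>c. c \<in> set cs \<Longrightarrow> x \<notin> S c) \<Longrightarrow> foldr (\<lambda>c g. P c \<circ> g) cs id x = x"
    by auto
qed

lemma num_orbits_UN:
  assumes "finite K" "\<And>c. c \<in> K \<Longrightarrow> finite (S c)"
    and "\<And>c d. c \<in> K \<Longrightarrow> d \<in> K \<Longrightarrow> c \<noteq> d \<Longrightarrow> S c \<inter> S d = {}"
    and closed: "\<And>c x. c \<in> K \<Longrightarrow> x \<in> S c \<Longrightarrow> f x \<in> S c"
  shows "num_orbits (\<Union>c\<in>K. S c) f = (\<Sum>c\<in>K. num_orbits (S c) f)"
proof -
  have sub: "orbit f x \<subseteq> S c" if "c \<in> K" "x \<in> S c" for c x
  proof
    fix y assume "y \<in> orbit f x"
    then show "y \<in> S c"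
      using that by induction (auto intro: closed)
  qed
  have "orbit f ` (\<Union>c\<in>K. S c) = (\<Union>c\<in>K. orbit f ` S c)"
    by auto
  moreover have "orbit f ` S c \<inter> orbit f ` S d = {}" if "c \<in> K" "d \<in> K" "c \<noteq> d" for c d
  proof -
    have "orbit f x \<noteq> orbit f y" if "x \<in> S c" "y \<in> S d" for x y
      using sub[OF \<open>c \<in> K\<close> that(1)] sub[OF \<open>d \<in> K\<close> that(2)] assms(3)[OF \<open>c \<in> K\<close> \<open>d \<in> K\<close> \<open>c \<noteq> d\<close>]
        orbit_nonempty[of f x] by auto
    then show ?thesis
      by auto
  qed
  ultimately show ?thesis
    using assms(1,2) by (simp add: num_orbits_def card_UN_disjoint)
qed

lemma sum_PiE_reindex:
  fixes f :: "('c \<Rightarrow> 'b) \<Rightarrow> 'd::comm_monoid_add"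
  assumes "\<And>c. c \<in> K \<Longrightarrow> bij_betw (h c) (A c) (B c)"
  shows "(\<Sum>P\<in>PiE K B. f P) = (\<Sum>P\<in>PiE K A. f (\<lambda>c\<in>K. h c (P c)))"
proof -
  have "bij_betw (\<lambda>P. \<lambda>c\<in>K. h c (P c)) (PiE K A) (PiE K B)"
  proof (rule bij_betwI[where g = "\<lambda>Q. \<lambda>c\<in>K. inv_into (A c) (h c) (Q c)"])
    show "(\<lambda>P. \<lambda>c\<in>K. h c (P c)) \<in> PiE K A \<rightarrow> PiE K B"
      using bij_betw_apply[OF assms] by (auto simp: PiE_iff Pi_iff)
    show "(\<lambda>Q. \<lambda>c\<in>K. inv_into (A c) (h c) (Q c)) \<in> PiE K B \<rightarrow> PiE K A"
      using assms by (auto simp: PiE_iff bij_betw_def inv_into_into)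
    show "(\<lambda>c\<in>K. inv_into (A c) (h c) ((\<lambda>c\<in>K. h c (P c)) c)) = P" if "P \<in> PiE K A" for P
      using assms that by (intro extensionalityI[where A = K]) (auto simp: PiE_iff bij_betw_inv_into_left[OF assms])
    show "(\<lambda>c\<in>K. h c ((\<lambda>c\<in>K. inv_into (A c) (h c) (Q c)) c)) = Q" if "Q \<in> PiE K B" for Q
      using assms that by (intro extensionalityI[where A = K]) (auto simp: PiE_iff bij_betw_inv_into_right[OF assms])
  qed
  from sum.reindex_bij_betw[OF this, of f] show ?thesis
    by simp
qed

lemma finite_colour_class: "finite (colour_class n w c)"
  by (rule finite_subset[of _ "{1..int n}"]) (auto simp: colour_class_def)

lemma colour_class_pos: "i \<in> colour_class n w c \<Longrightarrow> 0 < i"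
  by (simp add: colour_class_def)

lemma pm_colour_class: "pm (colour_class n w c) = {k \<in> pm {1..int n}. w \<bar>k\<bar> = c}"
proof -
  have "k \<in> pm (colour_class n w c) \<longleftrightarrow> k \<in> pm {1..int n} \<and> w \<bar>k\<bar> = c" for k
    using mem_pm_iff[of "colour_class n w c" k] mem_pm_iff[of "{1..int n}" k] by (auto simp: colour_class_def)
  then show ?thesis
    by blast
qed

lemma pm_colour_class_disjoint: "c \<noteq> d \<Longrightarrow> pm (colour_class n w c) \<inter> pm (colour_class n w d) = {}"
  by (auto simp: pm_colour_class)

definition inv_family :: "nat \<Rightarrow> (nat \<Rightarrow> int \<Rightarrow> int) \<Rightarrow> nat \<Rightarrow> int \<Rightarrow> int" where
  "inv_family C A = (\<lambda>c\<in>{1..C}. inv (A c))"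

context
  fixes n C :: nat and w :: "int \<Rightarrow> nat"
  assumes w: "w \<in> {1..int n} \<rightarrow> {1..C}"
begin

lemma familiesD: "A \<in> colour_families n C w \<Longrightarrow> c \<in> {1..C} \<Longrightarrow> A c \<in> PM (colour_class n w c)"
  by (auto simp: colour_families_def)

lemma colour_range: "k \<in> pm {1..int n} \<Longrightarrow> w \<bar>k\<bar> \<in> {1..C}"
  using w mem_pm_iff[of "{1..int n}" k] by auto

lemma UN_pm_colour_class: "(\<Union>c\<in>{1..C}. pm (colour_class n w c)) = pm {1..int n}"
  using colour_range by (auto simp: pm_colour_class)

lemma perm_prod_apply:
  assumes A: "A \<in> colour_families n C w"
  shows "c \<in> {1..C} \<Longrightarrow> x \<in> pm (colour_class n w c) \<Longrightarrow> perm_prod C A x = A c x"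
    and "x \<notin> pm {1..int n} \<Longrightarrow> perm_prod C A x = x"
proof -
  have perm: "A c permutes pm (colour_class n w c)" if "c \<in> set [1..<Suc C]" for c
    using PM_D(1)[OF familiesD[OF A]] that by auto
  note * = foldr_comp_disjoint[of "[1..<Suc C]" A "\<lambda>c. pm (colour_class n w c)", OF distinct_upt perm]
  show "c \<in> {1..C} \<Longrightarrow> x \<in> pm (colour_class n w c) \<Longrightarrow> perm_prod C A x = A c x"
    unfolding perm_prod_def by (rule *(1)) (use pm_colour_class_disjoint in auto)
  show "x \<notin> pm {1..int n} \<Longrightarrow> perm_prod C A x = x"
    unfolding perm_prod_def by (rule *(2)) (use pm_colour_class_disjoint in \<open>auto simp: pm_colour_class\<close>)
qed

lemma inv_family: "A \<in> colour_families n C w \<Longrightarrow> inv_family C A \<in> colour_families n C w"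
  using inv_PM(1)[OF finite_colour_class colour_class_pos familiesD] by (auto simp: inv_family_def colour_families_def)

lemma perm_prod_inv_family_cancel:
  assumes A: "A \<in> colour_families n C w"
  shows "perm_prod C (inv_family C A) (perm_prod C A x) = x" "perm_prod C A (perm_prod C (inv_family C A) x) = x"
proof -
  note B = inv_family[OF A]
  have "perm_prod C (inv_family C A) (perm_prod C A x) = x \<and> perm_prod C A (perm_prod C (inv_family C A) x) = x"
  proof (cases "x \<in> pm {1..int n}")
    case True
    define c where "c = w \<bar>x\<bar>"
    have c: "c \<in> {1..C}" "x \<in> pm (colour_class n w c)"
      using colour_range[OF True] True by (auto simp: c_def pm_colour_class)
    note Ac = PM_D(1)[OF familiesD[OF A c(1)]] and Bc = PM_D(1)[OF familiesD[OF B c(1)]]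
    have "A c x \<in> pm (colour_class n w c)" "inv_family C A c x \<in> pm (colour_class n w c)"
      using permutes_in_image[OF Ac] permutes_in_image[OF Bc] c(2) by auto
    moreover have "inv_family C A c = inv (A c)"
      using c(1) by (simp add: inv_family_def)
    ultimately show ?thesis
      using perm_prod_apply(1)[OF A c(1)] perm_prod_apply(1)[OF B c(1)] c(2)
        permutes_inverses[OF Ac] by simp
  qed (simp add: perm_prod_apply(2)[OF A] perm_prod_apply(2)[OF B])
  then show "perm_prod C (inv_family C A) (perm_prod C A x) = x" "perm_prod C A (perm_prod C (inv_family C A) x) = x"
    by auto
qed

lemma inv_perm_prod: "A \<in> colour_families n C w \<Longrightarrow> inv (perm_prod C A) = perm_prod C (inv_family C A)"
  by (rule inv_unique_comp) (auto simp: fun_eq_iff perm_prod_inv_family_cancel)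

lemma orbit_perm_prod:
  assumes A: "A \<in> colour_families n C w" and c: "c \<in> {1..C}" "x \<in> pm (colour_class n w c)"
  shows "orbit (perm_prod C A) x = orbit (A c) x"
proof (rule orbit_cong0[OF c(2)])
  show "perm_prod C A y = A c y" if "y \<in> pm (colour_class n w c)" for y
    by (rule perm_prod_apply(1)[OF A c(1) that])
  then show "perm_prod C A \<in> pm (colour_class n w c) \<rightarrow> pm (colour_class n w c)"
    using permutes_in_image[OF PM_D(1)[OF familiesD[OF A c(1)]]] by simp
qed

lemma perm_prod_PM:
  assumes A: "A \<in> colour_families n C w"
  shows "perm_prod C A \<in> PM {1..int n}"
proof -
  have bij: "bij (perm_prod C A)"
    by (rule o_bij[of "perm_prod C (inv_family C A)"]) (auto simp: fun_eq_iff perm_prod_inv_family_cancel[OF A])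
  then have "perm_prod C A permutes pm {1..int n}"
    using perm_prod_apply(2)[OF A] by (auto simp: permutes_def bij_iff)
  moreover have "- perm_prod C A (- x) = inv (perm_prod C A) x" for x
  proof (cases "x \<in> pm {1..int n}")
    case True
    define c where "c = w \<bar>x\<bar>"
    have c: "c \<in> {1..C}" "x \<in> pm (colour_class n w c)"
      using colour_range[OF True] True by (auto simp: c_def pm_colour_class)
    then show ?thesis
      using perm_prod_apply(1)[OF A c(1), of "- x"] perm_prod_apply(1)[OF inv_family[OF A] c]
        PM_D(2)[OF familiesD[OF A c(1)], of x]
      by (simp add: inv_perm_prod[OF A] inv_family_def)
  next
    case False
    then show ?thesis
      using perm_prod_apply(2)[OF A, of "- x"] perm_prod_apply(2)[OF inv_family[OF A], of x]
      by (simp add: inv_perm_prod[OF A])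
  qed
  moreover have "- k \<notin> orbit (perm_prod C A) k" if k: "k \<in> pm {1..int n}" for k
  proof -
    define c where "c = w \<bar>k\<bar>"
    have c: "c \<in> {1..C}" "k \<in> pm (colour_class n w c)"
      using colour_range[OF k] k by (auto simp: c_def pm_colour_class)
    then show ?thesis
      using PM_D(3)[OF familiesD[OF A c(1)] c(2)] orbit_perm_prod[OF A c] by simp
  qed
  ultimately show ?thesis
    by (auto simp: PM_def fun_eq_iff)
qed

lemma perm_prod_inj:
  assumes A: "A \<in> colour_families n C w" and B: "B \<in> colour_families n C w"
    and eq: "perm_prod C A = perm_prod C B"
  shows "A = B"
proof (rule PiE_ext[OF A[unfolded colour_families_def] B[unfolded colour_families_def]])
  fix c assume c: "c \<in> {1..C}"
  show "A c = B c"
  proof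
    fix x
    show "A c x = B c x"
    proof (cases "x \<in> pm (colour_class n w c)")
      case True
      then show ?thesis
        using perm_prod_apply(1)[OF A c True] perm_prod_apply(1)[OF B c True] eq by simp
    next
      case False
      then show ?thesis
        using PM_D(1)[OF familiesD[OF A c]] PM_D(1)[OF familiesD[OF B c]] by (simp add: permutes_def)
    qed
  qed
qed

lemma FD_perm_prod:
  assumes A: "A \<in> colour_families n C w"
  shows "FD {1..int n} (perm_prod C A) = (\<Union>c\<in>{1..C}. FD (colour_class n w c) (A c))"
proof -
  have eq: "k \<in> FD {1..int n} (perm_prod C A) \<longleftrightarrow> k \<in> FD (colour_class n w c) (A c)" if "c \<in> {1..C}" "k \<in> pm (colour_class n w c)" for c k
    using that orbit_perm_prod[OF A that] by (simp add: FD_def pm_colour_class)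
  show ?thesis
  proof (intro equalityI subsetI)
    fix k assume k: "k \<in> FD {1..int n} (perm_prod C A)"
    then have "k \<in> (\<Union>c\<in>{1..C}. pm (colour_class n w c))"
      unfolding UN_pm_colour_class by (rule subsetD[OF FD_subset])
    then obtain c where "c \<in> {1..C}" "k \<in> pm (colour_class n w c)"
      by (rule UN_E)
    then show "k \<in> (\<Union>c\<in>{1..C}. FD (colour_class n w c) (A c))"
      using eq k by (intro UN_I) auto
  next
    fix k assume "k \<in> (\<Union>c\<in>{1..C}. FD (colour_class n w c) (A c))"
    then obtain c where c: "c \<in> {1..C}" "k \<in> FD (colour_class n w c) (A c)"
      by (rule UN_E)
    then show "k \<in> FD {1..int n} (perm_prod C A)"
      using eq[OF c(1) subsetD[OF FD_subset c(2)]] by simp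
  qed
qed

lemma FD_colour_class_disjoint: "c \<noteq> d \<Longrightarrow> FD (colour_class n w c) (A c) \<inter> FD (colour_class n w d) (A d) = {}"
  using FD_subset[of "colour_class n w c" "A c"] FD_subset[of "colour_class n w d" "A d"] pm_colour_class_disjoint[of c d] by blast

lemma finite_FD_colour_class: "finite (FD (colour_class n w c) a)"
  by (rule finite_subset[OF FD_subset finite_pm[OF finite_colour_class]])

lemma num_orbits_FD_perm_prod:
  assumes A: "A \<in> colour_families n C w"
  shows "num_orbits (FD {1..int n} (perm_prod C A)) (perm_prod C A)
    = (\<Sum>c\<in>{1..C}. num_orbits (FD (colour_class n w c) (A c)) (A c))"
proof -
  have step: "A c x \<in> FD (colour_class n w c) (A c)" "perm_prod C A x = A c x" if "c \<in> {1..C}" "x \<in> FD (colour_class n w c) (A c)" for c x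
  proof -
    have x: "x \<in> pm (colour_class n w c)"
      using that(2) FD_subset by blast
    note Ac = PM_D(1)[OF familiesD[OF A that(1)]]
    have "orbit (A c) (A c x) = orbit (A c) x"
      by (rule permutation_orbit_step[OF permutes_permutation[OF Ac finite_pm[OF finite_colour_class]]])
    then show "A c x \<in> FD (colour_class n w c) (A c)"
      using FD_orbit_cong[of "A c x" "colour_class n w c" x "A c"] permutes_in_image[OF Ac] x that(2) by simp
    show "perm_prod C A x = A c x"
      by (rule perm_prod_apply(1)[OF A that(1) x])
  qed
  have "num_orbits (FD {1..int n} (perm_prod C A)) (perm_prod C A)
      = (\<Sum>c\<in>{1..C}. num_orbits (FD (colour_class n w c) (A c)) (perm_prod C A))"
    unfolding FD_perm_prod[OF A] using step
    by (intro num_orbits_UN) (auto simp: finite_FD_colour_class FD_colour_class_disjoint)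
  also have "\<dots> = (\<Sum>c\<in>{1..C}. num_orbits (FD (colour_class n w c) (A c)) (A c))"
    using step by (intro sum.cong refl num_orbits_cong) auto
  finally show ?thesis .
qed

text \<open>The chosen cycles of the product are those of the factors, and the normalizing signs multiply.\<close>

lemma prod_normalized_tensor_family:
  assumes A: "A \<in> colour_families n C w"
  shows "(\<Prod>c\<in>{1..C}. normalized_tensor (colour_class n w c) (pairing_of (colour_class n w c) (A c)) z)
    = normalized_tensor {1..int n} (pairing_of {1..int n} (perm_prod C A)) z"
proof -
  let ?g = "\<lambda>a m. of_int (sgn m) * sform (z m) (z (- a m))"
  have "normalized_tensor {1..int n} (pairing_of {1..int n} (perm_prod C A)) z
      = (- 1) ^ (\<Sum>c\<in>{1..C}. num_orbits (FD (colour_class n w c) (A c)) (A c)) *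
        (\<Prod>m\<in>(\<Union>c\<in>{1..C}. FD (colour_class n w c) (A c)). ?g (perm_prod C A) m)"
    using normalized_tensor_pairing_of[OF _ _ perm_prod_PM[OF A], of z]
    unfolding num_orbits_FD_perm_prod[OF A] unfolding FD_perm_prod[OF A] by simp
  also have "(\<Prod>m\<in>(\<Union>c\<in>{1..C}. FD (colour_class n w c) (A c)). ?g (perm_prod C A) m)
      = (\<Prod>c\<in>{1..C}. \<Prod>m\<in>FD (colour_class n w c) (A c). ?g (perm_prod C A) m)"
    by (rule prod.UNION_disjoint) (auto simp: finite_FD_colour_class FD_colour_class_disjoint)
  also have "\<dots> = (\<Prod>c\<in>{1..C}. \<Prod>m\<in>FD (colour_class n w c) (A c). ?g (A c) m)"
  proof (intro prod.cong refl)
    fix c m assume "c \<in> {1..C}" "m \<in> FD (colour_class n w c) (A c)"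
    then show "?g (perm_prod C A) m = ?g (A c) m"
      using perm_prod_apply(1)[OF A, of c m] FD_subset by fastforce
  qed
  also have "(- 1) ^ (\<Sum>c\<in>{1..C}. num_orbits (FD (colour_class n w c) (A c)) (A c)) * \<dots>
      = (\<Prod>c\<in>{1..C}. normalized_tensor (colour_class n w c) (pairing_of (colour_class n w c) (A c)) z)"
  proof -
    have "normalized_tensor (colour_class n w c) (pairing_of (colour_class n w c) (A c)) z
        = (- 1) ^ num_orbits (FD (colour_class n w c) (A c)) (A c) * (\<Prod>m\<in>FD (colour_class n w c) (A c). ?g (A c) m)" if "c \<in> {1..C}" for c
      by (rule normalized_tensor_pairing_of[OF finite_colour_class colour_class_pos familiesD[OF A that]])
    then show ?thesis
      by (simp add: power_sum prod.distrib)
  qed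
  finally show ?thesis ..
qed

text \<open>On the slots of colour \<open>c\<close>, \<open>inv \<alpha> \<circ> inv \<pi>\<close> is the product of the pairings of \<open>\<alpha>\<^sub>c\<close> and \<open>inv \<pi>\<^sub>c\<close>, so each
  block of their join accounts for two orbits.\<close>

lemma num_orbits_inv_inv:
  assumes A: "A \<in> colour_families n C w" and B: "B \<in> colour_families n C w"
  shows "num_orbits (pm {1..int n}) (inv (perm_prod C A) \<circ> inv (perm_prod C B))
    = 2 * (\<Sum>c\<in>{1..C}. join_blocks (pm (colour_class n w c)) (pairing_of (colour_class n w c) (A c)) (pairing_of (colour_class n w c) (inv (B c))))"
proof -
  let ?f = "inv (perm_prod C A) \<circ> inv (perm_prod C B)"
  define p where "p c = pairing_of (colour_class n w c) (inv (B c))" for c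
  define q where "q c = pairing_of (colour_class n w c) (A c)" for c
  have pq: "p c \<in> pairings (pm (colour_class n w c))" "q c \<in> pairings (pm (colour_class n w c))" if "c \<in> {1..C}" for c
    using PM_pairing_of(1)[OF finite_colour_class colour_class_pos] inv_PM(1)[OF finite_colour_class colour_class_pos] familiesD[OF A that] familiesD[OF B that]
    by (auto simp: p_def q_def)
  have f: "?f x = (q c \<circ> p c) x" "?f x \<in> pm (colour_class n w c)" if c: "c \<in> {1..C}" and x: "x \<in> pm (colour_class n w c)" for c x
  proof -
    have inB: "inv (B c) x \<in> pm (colour_class n w c)"
      using permutes_in_image[OF permutes_inv[OF PM_D(1)[OF familiesD[OF B c]]]] x by simp
    have "?f x = inv (A c) (inv (B c) x)"
      using perm_prod_apply(1)[OF inv_family[OF A] c inB] perm_prod_apply(1)[OF inv_family[OF B] c x] c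
      by (simp add: inv_perm_prod A B inv_family_def)
    also have "\<dots> = - A c (- inv (B c) x)"
      using PM_D(2)[OF familiesD[OF A c]] by simp
    also have "\<dots> = (q c \<circ> p c) x"
      using x inB by (simp add: p_def q_def pairing_of_def)
    finally show eq: "?f x = (q c \<circ> p c) x" .
    show "?f x \<in> pm (colour_class n w c)"
      unfolding eq using pairingsD(4)[OF pq(1)[OF c]] pairingsD(4)[OF pq(2)[OF c]] x by simp
  qed
  have "num_orbits (pm {1..int n}) ?f = (\<Sum>c\<in>{1..C}. num_orbits (pm (colour_class n w c)) ?f)"
    unfolding UN_pm_colour_class[symmetric] using f(2)
    by (intro num_orbits_UN) (auto simp: finite_pm finite_colour_class pm_colour_class_disjoint)
  also have "\<dots> = (\<Sum>c\<in>{1..C}. 2 * join_blocks (pm (colour_class n w c)) (q c) (p c))"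
  proof (intro sum.cong refl)
    fix c assume c: "c \<in> {1..C}"
    have "num_orbits (pm (colour_class n w c)) ?f = num_orbits (pm (colour_class n w c)) (q c \<circ> p c)"
      by (rule num_orbits_cong) (use f[OF c] in blast)+
    also have "\<dots> = 2 * join_blocks (pm (colour_class n w c)) (p c) (q c)"
      by (rule num_orbits_pairing_product[OF finite_pm[OF finite_colour_class] pq(1)[OF c] pq(2)[OF c]])
    finally show "num_orbits (pm (colour_class n w c)) ?f = 2 * join_blocks (pm (colour_class n w c)) (q c) (p c)"
      by (simp only: join_blocks_commute)
  qed
  finally show ?thesis
    by (simp add: sum_distrib_left p_def q_def)
qed

lemma sum_card_pm_colour_class: "(\<Sum>c\<in>{1..C}. card (pm (colour_class n w c))) = 2 * n"
proof -
  have "(\<Sum>c\<in>{1..C}. card (pm (colour_class n w c))) = card (\<Union>c\<in>{1..C}. pm (colour_class n w c))"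
    by (rule card_UN_disjoint[symmetric]) (auto simp: finite_pm finite_colour_class pm_colour_class_disjoint)
  also have "\<dots> = card ({1..int n} \<union> uminus ` {1..int n})"
    unfolding UN_pm_colour_class by (simp add: pm_def)
  also have "\<dots> = card {1..int n} + card (uminus ` {1..int n})"
    by (rule card_Un_disjoint) auto
  finally show ?thesis
    by (simp add: card_image)
qed

end

section \<open>Moments of an invariant family\<close>

lemma Sp_one: "mat 1 \<in> Sp"
  by (simp add: Sp_def qadj_simps)

lemma coact_one: "coact (mat 1) u x = (if u = x then 1 else 0)"
  by (simp add: coact_def complex_entry_one)

lemma measurable_conj: "(\<lambda>A. qadj U ** A ** U) \<in> borel_measurable (borel :: 'n::finite qmat measure)"
proof -
  have "linear (\<lambda>A. qadj U ** A ** U)"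
    by (rule linearI) (simp_all add: matrix_add_ldistrib matrix_mult_add_left matrix_mult_scaleR)
  then show ?thesis
    by (intro borel_measurable_continuous_onI linear_continuous_on) (simp add: linear_conv_bounded_linear)
qed

lemma measurable_twisted_entry: "(\<lambda>A. twisted_entry A x y) \<in> borel_measurable (borel :: 'n::finite qmat measure)"
proof -
  have "linear (\<lambda>A. twisted_entry A x y)"
    by (rule linearI)
      (simp_all add: twisted_entry_def complex_entry_add complex_entry_scaleR scaleR_conv_of_real[where 'a = complex] algebra_simps)
  then show ?thesis
    by (intro borel_measurable_continuous_onI linear_continuous_on) (simp add: linear_conv_bounded_linear)
qed

lemma twisted_entry_eq:
  "twisted_entry A x y = of_real (bsgn x) * qmat_entry A (fst x) (fst y) (bsgn_int x) (- bsgn_int y)"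
  by (simp add: twisted_entry_def complex_entry_def) (simp add: flip_def)

text \<open>The expectation as a tensor in which rows and columns transform alike.\<close>

definition moment :: "'a measure \<Rightarrow> nat \<Rightarrow> (int \<Rightarrow> 'a \<Rightarrow> 'n::finite qmat) \<Rightarrow> (int \<Rightarrow> 'n \<times> bool) \<Rightarrow> complex" where
  "moment M n X z = (\<integral>\<omega>. (\<Prod>k\<in>{1..int n}. twisted_entry (X k \<omega>) (z k) (z (- k))) \<partial>M)"

lemma integral_joint_law:
  assumes "\<And>k. k \<in> {1..int n} \<Longrightarrow> X k \<in> borel_measurable M"
  shows "integral\<^sup>L (joint_law M n X) (\<lambda>x. \<Prod>k\<in>{1..int n}. twisted_entry (x k) (z k) (z (- k))) = moment M n X z"
proof -
  have "(\<lambda>\<omega>. \<lambda>k\<in>{1..int n}. X k \<omega>) \<in> measurable M (\<Pi>\<^sub>M k\<in>{1..int n}. borel)"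
    using assms by (rule measurable_restrict)
  moreover have "(\<lambda>x. \<Prod>k\<in>{1..int n}. twisted_entry (x k) (z k) (z (- k))) \<in> borel_measurable (\<Pi>\<^sub>M k\<in>{1..int n}. borel)"
  proof (intro borel_measurable_prod)
    fix k assume "k \<in> {1..int n}"
    then show "(\<lambda>x. twisted_entry (x k) (z k) (z (- k))) \<in> borel_measurable (\<Pi>\<^sub>M k\<in>{1..int n}. borel)"
      by (intro measurable_compose[where g = "\<lambda>A. twisted_entry A (z k) (z (- k))" and f = "\<lambda>x. x k" and N = borel]
          measurable_component_singleton measurable_twisted_entry)
  qed
  ultimately show ?thesis
    unfolding joint_law_def moment_def by (subst integral_distr) (auto intro!: Bochner_Integration.integral_cong)
qed

context
  fixes M :: "'a measure" and n C :: nat and w :: "int \<Rightarrow> nat"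
    and X :: "int \<Rightarrow> 'a \<Rightarrow> quat ^ 'n::finite ^ 'n"
  assumes w: "w \<in> {1..int n} \<rightarrow> {1..C}"
    and meas: "\<And>k. k \<in> {1..int n} \<Longrightarrow> X k \<in> borel_measurable M"
    and inv: "sympl_general_position M n C w X"
    and intg: "\<And>(i :: int \<Rightarrow> 'n) h. h \<in> pm {1..int n} \<rightarrow> {1, -1} \<Longrightarrow>
      integrable M (\<lambda>\<omega>. \<Prod>k\<in>{1..int n}. qmat_entry (X k \<omega>) (i k) (i (- k)) (h k) (h (- k)))"
begin

lemma integrable_moment:
  "integrable M (\<lambda>\<omega>. \<Prod>k\<in>{1..int n}. twisted_entry (X k \<omega>) (z k) (z (- k)))"
proof -
  define h where "h k = sgn k * bsgn_int (z k)" for k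
  have "h \<in> pm {1..int n} \<rightarrow> {1, -1}"
    using bsgn_int_cases[of "z k" for k] by (auto simp: h_def pm_def sgn_if) metis+
  then have "integrable M (\<lambda>\<omega>. (\<Prod>k\<in>{1..int n}. of_real (bsgn (z k))) *
      (\<Prod>k\<in>{1..int n}. qmat_entry (X k \<omega>) (fst (z k)) (fst (z (- k))) (h k) (h (- k))))"
    by (intro integrable_mult_right intg)
  moreover have "(\<Prod>k\<in>{1..int n}. complex_of_real (bsgn (z k))) *
      (\<Prod>k\<in>{1..int n}. qmat_entry (X k \<omega>) (fst (z k)) (fst (z (- k))) (h k) (h (- k)))
      = (\<Prod>k\<in>{1..int n}. twisted_entry (X k \<omega>) (z k) (z (- k)))" for \<omega>
    unfolding prod.distrib[symmetric] by (intro prod.cong refl) (simp add: twisted_entry_eq h_def)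
  ultimately show ?thesis
    by simp
qed

lemma moment_invariant:
  assumes U: "\<And>c. c \<in> {1..C} \<Longrightarrow> U c \<in> Sp"
  shows "moment M n X z = (\<Sum>y\<in>agree_off (pm {1..int n}) z.
    (\<Prod>k\<in>pm {1..int n}. coact (U (w \<bar>k\<bar>)) (y k) (z k)) * moment M n X y)"
proof -
  let ?K = "{1..int n}"
  have "joint_law M n (\<lambda>k \<omega>. qadj (U (w k)) ** X k \<omega> ** U (w k)) = joint_law M n X"
    using inv U by (auto simp: sympl_general_position_def)
  moreover have "(\<lambda>\<omega>. qadj (U (w k)) ** X k \<omega> ** U (w k)) \<in> borel_measurable M" if "k \<in> ?K" for k
    using measurable_compose[OF meas[OF that] measurable_conj] .
  ultimately have "moment M n X z = moment M n (\<lambda>k \<omega>. qadj (U (w k)) ** X k \<omega> ** U (w k)) z"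
    using integral_joint_law[of n X M z] integral_joint_law[of n "\<lambda>k \<omega>. qadj (U (w k)) ** X k \<omega> ** U (w k)" M z]
      meas by simp
  also have "\<dots> = (\<integral>\<omega>. (\<Sum>y\<in>agree_off (pm ?K) z. (\<Prod>k\<in>pm ?K. coact (U (w \<bar>k\<bar>)) (y k) (z k))
      * (\<Prod>k\<in>?K. twisted_entry (X k \<omega>) (y k) (y (- k)))) \<partial>M)"
    unfolding moment_def by (subst prod_twisted_entry_conj) auto
  also have "\<dots> = (\<Sum>y\<in>agree_off (pm ?K) z. (\<Prod>k\<in>pm ?K. coact (U (w \<bar>k\<bar>)) (y k) (z k)) * moment M n X y)"
    unfolding moment_def by (simp add: Bochner_Integration.integral_sum integrable_mult_right integrable_moment)
  finally show ?thesis .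
qed

text \<open>Only the matrices of colour \<open>c\<close> are moved: the other colours are conjugated by the identity.\<close>

lemma sp_invariant_moment:
  "sp_invariant (pm (colour_class n w c)) (\<lambda>z. Re (moment M n X z))"
  "sp_invariant (pm (colour_class n w c)) (\<lambda>z. Im (moment M n X z))"
proof -
  let ?K = "{1..int n}" and ?J = "pm (colour_class n w c)"
  have "lie_act ?J (moment M n X) z S = 0" if S: "qadj S = - 1 *\<^sub>R S" "S ** S ** S = - 1 *\<^sub>R S" for S z
    unfolding lie_act_def
  proof (rule conj_invariant_imp_derivative_zero)
    show "finite (pm ?K)"
      by (simp add: finite_pm)
    show "?J \<subseteq> pm ?K"
      by (auto simp: pm_colour_class)
    fix t z
    have "(if d = c then rotation t S else mat 1) \<in> Sp" for d :: nat
      by (simp add: rotation_in_Sp[OF S] Sp_one)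
    from moment_invariant[OF this, of z]
    show "moment M n X z = (\<Sum>y\<in>agree_off (pm ?K) z.
        (\<Prod>k\<in>pm ?K. if k \<in> ?J then coact (rotation t S) (y k) (z k) else if y k = z k then 1 else 0) * moment M n X y)"
      by (simp add: pm_colour_class if_distrib[of "\<lambda>U. coact U _ _"] coact_one cong: if_cong prod.cong)
  qed
  then show "sp_invariant ?J (\<lambda>z. Re (moment M n X z))" "sp_invariant ?J (\<lambda>z. Im (moment M n X z))"
    by (blast intro: lie_zero_imp_sp_invariant)+
qed

lemma Re_of_real_mult: "Re (of_real a * b) = a * Re b"
  and Im_of_real_mult: "Im (of_real a * b) = a * Im b"
  by simp_all

lemma moment_expansion:
  "moment M n X z =
    (\<Sum>P\<in>(\<Pi>\<^sub>E c\<in>{1..C}. pairings (pm (colour_class n w c))). \<Sum>Q\<in>(\<Pi>\<^sub>E c\<in>{1..C}. pairings (pm (colour_class n w c))).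
      of_real ((\<Prod>c\<in>{1..C}. Wg CARD('n) (pm (colour_class n w c)) (P c) (Q c))
        * (\<Prod>c\<in>{1..C}. normalized_tensor (colour_class n w c) (P c) z)) *
      (\<Sum>y\<in>agree_off (pm {1..int n}) z.
        of_real (\<Prod>c\<in>{1..C}. normalized_tensor (colour_class n w c) (Q c) y) * moment M n X y))"
proof -
  have expand: "T z = (\<Sum>P\<in>(\<Pi>\<^sub>E c\<in>{1..C}. pairings (pm (colour_class n w c))). \<Sum>Q\<in>(\<Pi>\<^sub>E c\<in>{1..C}. pairings (pm (colour_class n w c))).
      ((\<Prod>c\<in>{1..C}. Wg CARD('n) (pm (colour_class n w c)) (P c) (Q c)) * (\<Prod>c\<in>{1..C}. normalized_tensor (colour_class n w c) (P c) z)) *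
      (\<Sum>y\<in>agree_off (pm {1..int n}) z. (\<Prod>c\<in>{1..C}. normalized_tensor (colour_class n w c) (Q c) y) * T y))"
    if "\<And>c. sp_invariant (pm (colour_class n w c)) T" for T
    unfolding UN_pm_colour_class[OF w, symmetric]
    by (rule Weingarten_expansion_colours)
      (use that finite_colour_class colour_class_pos pm_colour_class_disjoint in blast)+
  show ?thesis
    unfolding complex_eq_iff Re_sum Im_sum Re_of_real_mult Im_of_real_mult
    by (intro conjI expand sp_invariant_moment)
qed

end

section \<open>Trace functionals as contractions with pairing tensors\<close>

text \<open>Each element \<open>k\<close> of a chosen cycle contributes one matrix, with row index at the slot \<open>k\<close>
  and column index at the slot \<open>-k\<close>; the column index of \<open>k\<close> is the row index of \<open>\<pi> k\<close>, so the sum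
  runs over the index functions that are compatible with the pairing of \<open>inv \<pi>\<close>.\<close>

lemma Re_tr_eq:
  fixes A :: "int \<Rightarrow> 'n::finite qmat" and z :: "int \<Rightarrow> 'n \<times> bool"
  assumes a: "\<pi> \<in> PM {1..int n}"
  defines "r \<equiv> num_orbits (FD {1..int n} \<pi>) \<pi>"
  shows "(2 * of_nat CARD('n)) ^ r * Re_tr n \<pi> A = (- 1) ^ r * (\<Sum>y\<in>agree_off (pm {1..int n}) z.
    of_real (normalized_tensor {1..int n} (pairing_of {1..int n} (inv \<pi>)) y) * (\<Prod>k\<in>{1..int n}. twisted_entry (A k) (y k) (y (- k))))"
proof -
  let ?K = "{1..int n}"
  let ?J = "pm ?K" and ?F = "FD ?K \<pi>"
  have finK: "finite ?K" and pos: "\<And>i. i \<in> ?K \<Longrightarrow> 0 < i"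
    by auto
  note finJ = finite_pm[OF finK]
  have ia: "inv \<pi> \<in> PM ?K"
    by (rule inv_PM(1)[OF finK pos a])
  have FDi: "FD ?K (inv \<pi>) = ?F"
    by (rule FD_inv(1)[OF finK a])
  define p where "p = pairing_of ?K (inv \<pi>)"
  have p: "p \<in> pairings ?J"
    unfolding p_def by (rule PM_pairing_of(1)[OF finK pos ia])
  have hp: "half p ?J ?F"
    using half_FD(2)[OF finK pos ia] by (simp add: FDi p_def)
  have FJ: "?F \<subseteq> ?J"
    by (rule FD_subset)
  have finF: "finite ?F"
    using FJ finJ by (rule finite_subset)
  have piF: "\<pi> k \<in> ?F" "p (\<pi> k) = - k" if "k \<in> ?F" for k
  proof -
    have perm: "permutation \<pi>"
      using PM_D(1)[OF a] finJ by (rule permutes_permutation)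
    have "\<pi> k \<in> ?J"
      using that FJ permutes_in_image[OF PM_D(1)[OF a]] by blast
    then show "\<pi> k \<in> ?F" "p (\<pi> k) = - k"
      using that FJ FD_orbit_cong[of "\<pi> k" ?K k \<pi>] permutation_orbit_step[OF perm, of k]
        permutes_inverses(2)[OF PM_D(1)[OF a], of k]
      by (auto simp: p_def pairing_of_def)
  qed
  define tpr where "tpr y = (\<Prod>k\<in>?K. twisted_entry (A k) (y k) (y (- k)))" for y
  let ?C = "{y \<in> agree_off ?J z. \<forall>k\<in>?J. y (p k) = flip (y k)}"
  define summand where "summand = (\<lambda>(i, h). \<Prod>k\<in>?F. qmat_entry (signed_mat A k) (i k) (i (\<pi> k)) (h k) (h (\<pi> k)))"
  \<comment> \<open>Reading off \<open>i\<close> and \<open>h\<close> from the row slots of the chosen elements; \<open>\<Psi>\<close> extends by the pairing.\<close>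
  define \<Phi> where "\<Phi> y = (\<lambda>k\<in>?F. fst (y k), \<lambda>k\<in>?F. bsgn_int (y k))" for y :: "int \<Rightarrow> 'n \<times> bool"
  define \<Psi> where "\<Psi> ih k = (if k \<in> ?F then (fst ih k, snd ih k = 1) else
      if k \<in> ?J then flip (fst ih (p k), snd ih (p k) = 1) else z k)"
    for ih :: "(int \<Rightarrow> 'n) \<times> (int \<Rightarrow> int)" and k
  have "bij_betw \<Phi> ?C ((?F \<rightarrow>\<^sub>E UNIV) \<times> (?F \<rightarrow>\<^sub>E {1, -1}))"
  proof (rule bij_betwI[where g = \<Psi>])
    show "\<Phi> \<in> ?C \<rightarrow> (?F \<rightarrow>\<^sub>E UNIV) \<times> (?F \<rightarrow>\<^sub>E {1, -1})"
      by (auto simp: \<Phi>_def bsgn_int_def)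
    show "\<Psi> \<in> (?F \<rightarrow>\<^sub>E UNIV) \<times> (?F \<rightarrow>\<^sub>E {1, -1}) \<rightarrow> ?C"
    proof
      fix ih
      have "\<Psi> ih (p k) = flip (\<Psi> ih k)" if "k \<in> ?J" for k
        using half_iff[OF p hp that] that pairingsD(2,4)[OF p] by (simp add: \<Psi>_def)
      moreover have "\<Psi> ih \<in> agree_off ?J z"
        using FJ by (auto simp: \<Psi>_def agree_off_def)
      ultimately show "\<Psi> ih \<in> ?C"
        by simp
    qed
    show "\<Psi> (\<Phi> y) = y" if y: "y \<in> ?C" for y
    proof
      fix k
      have *: "(fst (y k), bsgn_int (y k) = 1) = y k" for k
        by (cases "y k") (simp add: bsgn_int_def)
      consider "k \<in> ?F" | "k \<in> ?J - ?F" | "k \<notin> ?J"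
        by blast
      then show "\<Psi> (\<Phi> y) k = y k"
      proof cases
        case 2
        then have "p k \<in> ?F"
          using half_iff[OF p hp] by simp
        then have "\<Psi> (\<Phi> y) k = flip (y (p k))"
          using 2 *[of "p k"] by (simp add: \<Psi>_def \<Phi>_def)
        then show ?thesis
          using 2 y by simp
      next
        case 3
        then show ?thesis
          using y FJ by (auto simp: \<Psi>_def agree_off_def)
      qed (simp add: \<Psi>_def \<Phi>_def *)
    qed
    show "\<Phi> (\<Psi> ih) = ih" if ih: "ih \<in> (?F \<rightarrow>\<^sub>E UNIV) \<times> (?F \<rightarrow>\<^sub>E {1, -1})" for ih
    proof -
      have "(\<lambda>k\<in>?F. fst (\<Psi> ih k)) = fst ih"
        using ih by (intro extensionalityI[where A = ?F]) (auto simp: \<Psi>_def PiE_def)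
      moreover have "bsgn_int (\<Psi> ih k) = snd ih k" if "k \<in> ?F" for k
        using that ih by (auto simp: \<Psi>_def bsgn_int_def dest!: PiE_mem[where x = k])
      then have "(\<lambda>k\<in>?F. bsgn_int (\<Psi> ih k)) = snd ih"
        using ih by (intro extensionalityI[where A = ?F]) (auto simp: PiE_def)
      ultimately show ?thesis
        by (simp add: \<Phi>_def)
    qed
  qed
  from sum.reindex_bij_betw[OF this, of summand]
  have "(\<Sum>i \<in> ?F \<rightarrow>\<^sub>E (UNIV :: 'n set). \<Sum>h \<in> ?F \<rightarrow>\<^sub>E {1, -1}. summand (i, h)) = (\<Sum>y\<in>?C. summand (\<Phi> y))"
    by (simp add: sum.cartesian_product')
  also have "\<dots> = (\<Sum>y\<in>?C. of_real ((\<Prod>m\<in>?F. of_int (sgn m)) * pairing_tensor p ?F y) * tpr y)"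
  proof (intro sum.cong refl)
    fix y assume y: "y \<in> ?C"
    have "summand (\<Phi> y) = (\<Prod>k\<in>?F. of_real (of_int (sgn k) * bsgn (y k)) * twisted_entry (A \<bar>k\<bar>) (y \<bar>k\<bar>) (y (- \<bar>k\<bar>)))"
      unfolding summand_def \<Phi>_def prod.case
    proof (intro prod.cong refl)
      fix k assume k: "k \<in> ?F"
      then have kJ: "k \<in> ?J" "\<pi> k \<in> ?J"
        using FJ piF by auto
      have "y (- k) = flip (y (\<pi> k))"
        using y kJ(2) piF(2)[OF k] by force
      then have "y (\<pi> k) = flip (y (- k))"
        by simp
      moreover have "qmat_entry (signed_mat A k) (fst (y k)) (fst (y (\<pi> k))) (bsgn_int (y k)) (bsgn_int (y (\<pi> k)))
          = complex_entry (signed_mat A k) (y k) (y (\<pi> k))"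
        by (simp add: complex_entry_def)
      moreover have "complex_entry (signed_mat A k) (y k) (flip (y (- k)))
          = of_real (of_int (sgn k) * bsgn (y k)) * twisted_entry (A \<bar>k\<bar>) (y \<bar>k\<bar>) (y (- \<bar>k\<bar>))"
      proof (cases "0 < k")
        case True
        then show ?thesis
          by (simp add: signed_mat_def twisted_entry_def)
      next
        case False
        moreover have "k \<noteq> 0"
          using pm_nonzero[OF finK pos kJ(1)] .
        ultimately show ?thesis
          by (simp add: signed_mat_def twisted_entry_def complex_entry_qadj mult_ac)
      qed
      ultimately show "qmat_entry (signed_mat A k) ((\<lambda>k\<in>?F. fst (y k)) k) ((\<lambda>k\<in>?F. fst (y k)) (\<pi> k))
          ((\<lambda>k\<in>?F. bsgn_int (y k)) k) ((\<lambda>k\<in>?F. bsgn_int (y k)) (\<pi> k))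
          = of_real (of_int (sgn k) * bsgn (y k)) * twisted_entry (A \<bar>k\<bar>) (y \<bar>k\<bar>) (y (- \<bar>k\<bar>))"
        using k piF(1)[OF k] by simp
    qed
    also have "\<dots> = of_real ((\<Prod>m\<in>?F. of_int (sgn m)) * (\<Prod>m\<in>?F. bsgn (y m)))
        * (\<Prod>k\<in>?F. twisted_entry (A \<bar>k\<bar>) (y \<bar>k\<bar>) (y (- \<bar>k\<bar>)))"
      by (simp add: prod.distrib)
    also have "(\<Prod>k\<in>?F. twisted_entry (A \<bar>k\<bar>) (y \<bar>k\<bar>) (y (- \<bar>k\<bar>))) = tpr y"
      unfolding tpr_def by (rule prod.reindex_bij_betw[OF bij_abs_FD[OF finK pos a]])
    also have "(\<Prod>m\<in>?F. bsgn (y m)) = pairing_tensor p ?F y"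
      using y FJ by (intro pairing_tensor_value[symmetric]) auto
    finally show "summand (\<Phi> y) = of_real ((\<Prod>m\<in>?F. of_int (sgn m)) * pairing_tensor p ?F y) * tpr y" .
  qed
  also have "\<dots> = (\<Sum>y\<in>agree_off ?J z. of_real ((\<Prod>m\<in>?F. of_int (sgn m)) * pairing_tensor p ?F y) * tpr y)"
    using pairing_tensor_nonzero_iff[OF finJ p hp] finite_agree_off[OF finJ] by (intro sum.mono_neutral_left) auto
  also have "\<dots> = (- 1) ^ r * (\<Sum>y\<in>agree_off ?J z. of_real (normalized_tensor ?K p y) * tpr y)"
  proof -
    have "normalized_tensor ?K p y = (- 1) ^ r * ((\<Prod>m\<in>?F. of_int (sgn m)) * pairing_tensor p ?F y)" for y :: "int \<Rightarrow> 'n \<times> bool"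
      using PM_pairing_of(3)[OF finK pos ia] num_orbits_PM(2)[OF finK pos ia] FD_inv(2)[OF finK a]
      by (simp add: normalized_tensor_def norm_sign_def p_def FDi r_def)
    then show ?thesis
      by (simp add: sum_distrib_left mult.assoc[symmetric] power_mult_distrib[symmetric])
  qed
  finally have sum: "(\<Sum>i \<in> ?F \<rightarrow>\<^sub>E (UNIV :: 'n set). \<Sum>h \<in> ?F \<rightarrow>\<^sub>E {1, -1}. summand (i, h))
      = (- 1) ^ r * (\<Sum>y\<in>agree_off ?J z. of_real (normalized_tensor ?K p y) * tpr y)" .
  have "Re_tr n \<pi> A = 2 powi (- int r) * of_nat CARD('n) powi (- int r)
      * (\<Sum>i \<in> ?F \<rightarrow>\<^sub>E (UNIV :: 'n set). \<Sum>h \<in> ?F \<rightarrow>\<^sub>E {1, -1}. summand (i, h))"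
    by (simp add: Re_tr_def Let_def summand_def r_def)
  then have "(2 * of_nat CARD('n)) ^ r * Re_tr n \<pi> A
      = (\<Sum>i \<in> ?F \<rightarrow>\<^sub>E (UNIV :: 'n set). \<Sum>h \<in> ?F \<rightarrow>\<^sub>E {1, -1}. summand (i, h))"
    by (simp add: power_int_minus power_mult_distrib field_simps)
  then show ?thesis
    unfolding sum by (simp add: p_def tpr_def)
qed

section \<open>The expansion of mixed moments\<close>

lemma finite_PM: "finite I \<Longrightarrow> finite (PM I)"
  by (rule finite_subset[OF _ finite_permutations[OF finite_pm]]) (auto simp: PM_def)

lemma prod_power_int:
  fixes x :: "'a::field"
  assumes "x \<noteq> 0"
  shows "(\<Prod>c\<in>K. x powi f c) = x powi (\<Sum>c\<in>K. f c)"
  by (induction K rule: infinite_finite_induct) (simp_all add: power_int_add assms)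

text \<open>Over all colours, the exponents of the normalizing powers add up to twice the number of matrices
  minus the number of blocks.\<close>

lemma prod_wg:
  assumes w: "w \<in> {1..int n} \<rightarrow> {1..C}" and N: "N > 0"
  shows "(\<Prod>c\<in>{1..C}. complex_of_real (wg N (pm (colour_class n w c)) (p c) (q c)))
    = (- 2 * of_nat N) powi (2 * int n - int (\<Sum>c\<in>{1..C}. join_blocks (pm (colour_class n w c)) (p c) (q c)))
      * of_real (\<Prod>c\<in>{1..C}. Wg N (pm (colour_class n w c)) (p c) (q c))"
proof -
  let ?J = "\<lambda>c. pm (colour_class n w c)"
  have "(\<Prod>c\<in>{1..C}. wg N (?J c) (p c) (q c))
      = (\<Prod>c\<in>{1..C}. (- 2 * real N) powi (int (card (?J c)) - int (join_blocks (?J c) (p c) (q c))))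
        * (\<Prod>c\<in>{1..C}. Wg N (?J c) (p c) (q c))"
    by (simp only: wg_def prod.distrib)
  also have "(\<Prod>c\<in>{1..C}. (- 2 * real N) powi (int (card (?J c)) - int (join_blocks (?J c) (p c) (q c))))
      = (- 2 * real N) powi (\<Sum>c\<in>{1..C}. int (card (?J c)) - int (join_blocks (?J c) (p c) (q c)))"
    by (rule prod_power_int) (use N in simp)
  also have "(\<Sum>c\<in>{1..C}. int (card (?J c)) - int (join_blocks (?J c) (p c) (q c)))
      = 2 * int n - int (\<Sum>c\<in>{1..C}. join_blocks (?J c) (p c) (q c))"
    unfolding sum_subtractf of_nat_sum[symmetric] sum_card_pm_colour_class[OF w] by simp
  finally have "(\<Prod>c\<in>{1..C}. wg N (?J c) (p c) (q c))
      = (- 2 * real N) powi (2 * int n - int (\<Sum>c\<in>{1..C}. join_blocks (?J c) (p c) (q c)))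
        * (\<Prod>c\<in>{1..C}. Wg N (?J c) (p c) (q c))" .
  from arg_cong[OF this, of complex_of_real] show ?thesis
    by (simp only: of_real_prod of_real_mult of_real_power_int of_real_minus of_real_numeral of_real_of_nat_eq)
qed

text \<open>The powers of \<open>x = 2N\<close>: \<open>a\<close> and \<open>r\<close> are half the numbers of cycles of \<open>\<alpha>\<close> and \<open>\<pi>\<close>, and \<open>j\<close> is the
  number of blocks of the join, which cancels between the Euler characteristic and the normalized
  Weingarten functions.\<close>

lemma coefficient_identity:
  fixes x :: complex
  assumes "x \<noteq> 0"
  shows "(- 1) ^ a * ((- 1) ^ r * x ^ r) = x powi (int a - int n) *
    ((- 1) ^ n * (- x) powi (int a + int r + int j - int n - 2 * int a) * (- x) powi (2 * int n - int j))"
proof -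
  have neg: "(- x) ^ k = (- 1) ^ k * x ^ k" for k
    by (rule power_minus)
  have exps: "int a + int r + int j - int n - 2 * int a = int (r + j) - int (n + a)" "2 * int n - int j = int (2 * n) - int j"
    by simp_all
  have sq: "(- 1 :: complex) ^ k * (- 1) ^ k = 1" for k
    by (simp add: power_add[symmetric] flip: mult_2)
  have diff: "y powi (int k - int l) = y ^ k / y ^ l" if "y \<noteq> 0" for y :: complex and k l
    using that by (subst power_int_diff) (simp_all only: power_int_of_nat simp_thms)
  have "x \<noteq> 0" "- x \<noteq> 0"
    using assms by simp_all
  note d = diff[OF this(1)] diff[OF this(2)]
  show ?thesis
    unfolding exps d neg power_add power_mult using assms sq[of a] sq[of n] sq[of j]
    by (simp add: field_simps power2_eq_square)
qed

text \<open>On the index function \<open>z\<close> that encodes \<open>\<iota>\<close> and \<open>\<eta>\<close>, a normalized pairing tensor is the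
  indicator of the two compatibility conditions times a sign. The signs of the rows, which come from
  transposing the row indices, cancel those of the chosen elements \<open>k > 0\<close>; where \<open>-k\<close> is chosen they
  leave \<open>\<eta> k * \<eta> (-k)\<close>.\<close>

lemma normalized_tensor_at_index:
  fixes \<iota> :: "int \<Rightarrow> 'n::finite" and \<eta> :: "int \<Rightarrow> int"
  assumes a: "\<alpha> \<in> PM {1..int n}" and \<eta>: "\<eta> \<in> pm {1..int n} \<rightarrow> {1, -1}"
  defines "z \<equiv> \<lambda>k. (\<iota> k, sgn k * \<eta> k = 1)"
  shows "(\<Prod>k\<in>{1..int n}. of_int (\<eta> k)) * normalized_tensor {1..int n} (pairing_of {1..int n} \<alpha>) z =
    (if (\<forall>k\<in>pm {1..int n}. \<iota> k = \<iota> (- \<alpha> k)) \<and> (\<forall>k\<in>pm {1..int n}. sgn k * \<eta> k = sgn (\<alpha> k) * \<eta> (- \<alpha> k))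
     then (- 1) ^ num_orbits (FD {1..int n} \<alpha>) \<alpha> *
       (\<Prod>k | k \<in> {1..int n} \<and> - k \<in> FD {1..int n} \<alpha>. of_int (\<eta> k * \<eta> (- k)))
     else 0)"
proof -
  let ?K = "{1..int n}"
  let ?J = "pm ?K" and ?F = "FD ?K \<alpha>"
  have finK: "finite ?K" and pos: "\<And>i. i \<in> ?K \<Longrightarrow> 0 < i"
    by auto
  note p = PM_pairing_of(1)[OF finK pos a]
  have p_eq: "pairing_of ?K \<alpha> k = - \<alpha> k" if "k \<in> ?J" for k
    using that by (simp add: pairing_of_def)
  have unit: "sgn k * \<eta> k = 1 \<or> sgn k * \<eta> k = - 1" "\<eta> k = 1 \<or> \<eta> k = - 1" if "k \<in> ?J" for k
    using that \<eta> pm_nonzero[OF finK pos that] by (auto simp: sgn_if Pi_iff)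
  have FJ: "?F \<subseteq> ?J"
    by (rule FD_subset)
  have compat: "z (- \<alpha> k) = flip (z k) \<longleftrightarrow> \<iota> k = \<iota> (- \<alpha> k) \<and> sgn k * \<eta> k = sgn (\<alpha> k) * \<eta> (- \<alpha> k)"
    if k: "k \<in> ?J" for k
  proof -
    have "- \<alpha> k \<in> ?J"
      using k permutes_in_image[OF PM_D(1)[OF a]] by simp
    then show ?thesis
      using unit(1)[OF k] unit(1)[of "- \<alpha> k"] by (auto simp: z_def flip_def sgn_minus)
  qed
  have nz: "pairing_tensor (pairing_of ?K \<alpha>) ?F z \<noteq> 0 \<longleftrightarrow>
      (\<forall>k\<in>?J. \<iota> k = \<iota> (- \<alpha> k)) \<and> (\<forall>k\<in>?J. sgn k * \<eta> k = sgn (\<alpha> k) * \<eta> (- \<alpha> k))"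
    using pairing_tensor_nonzero_iff[OF finite_pm[OF finK] p half_FD(2)[OF finK pos a], of z] compat by (auto simp: p_eq)
  show ?thesis
  proof (cases "(\<forall>k\<in>?J. \<iota> k = \<iota> (- \<alpha> k)) \<and> (\<forall>k\<in>?J. sgn k * \<eta> k = sgn (\<alpha> k) * \<eta> (- \<alpha> k))")
    case False
    then have "pairing_tensor (pairing_of ?K \<alpha>) ?F z = 0"
      using nz by blast
    then have "normalized_tensor ?K (pairing_of ?K \<alpha>) z = 0"
      using PM_pairing_of(3)[OF finK pos a] by (simp add: normalized_tensor_def)
    then show ?thesis
      using False by (simp only: mult_zero_right if_False)
  next
    case True
    have "normalized_tensor ?K (pairing_of ?K \<alpha>) z = (- 1) ^ num_orbits ?F \<alpha> * (\<Prod>m\<in>?F. of_int (sgn m) * sform (z m) (z (- \<alpha> m)))"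
      by (rule normalized_tensor_pairing_of[OF finK pos a])
    also have "(\<Prod>m\<in>?F. of_int (sgn m) * sform (z m) (z (- \<alpha> m))) = (\<Prod>m\<in>?F. real_of_int (\<eta> m))"
    proof (intro prod.cong refl)
      fix m assume "m \<in> ?F"
      then have m: "m \<in> ?J"
        using FJ by blast
      have "z (- \<alpha> m) = flip (z m)"
        using compat[OF m] True m by blast
      then have "real_of_int (sgn m) * sform (z m) (z (- \<alpha> m)) = of_int (sgn m) * bsgn (z m)"
        by (simp add: sform_def)
      also have "\<dots> = of_int (\<eta> m)"
        using unit[OF m] pm_nonzero[OF finK pos m] by (auto simp: z_def bsgn_def sgn_if split: if_splits)
      finally show "real_of_int (sgn m) * sform (z m) (z (- \<alpha> m)) = of_int (\<eta> m)" .
    qed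
    also have "\<dots> = (\<Prod>k\<in>?K. if - k \<in> ?F then of_int (\<eta> (- k)) else of_int (\<eta> k))"
    proof -
      have sgn: "- k \<in> ?F \<longleftrightarrow> k \<notin> ?F" if "k \<in> ?J" for k
        by (rule uminus_FD_iff[OF finK pos a that])
      have "(\<Prod>k\<in>?K. if - k \<in> ?F then real_of_int (\<eta> (- k)) else of_int (\<eta> k))
          = (\<Prod>m\<in>?F. if - \<bar>m\<bar> \<in> ?F then real_of_int (\<eta> (- \<bar>m\<bar>)) else of_int (\<eta> \<bar>m\<bar>))"
        by (rule prod.reindex_bij_betw[OF bij_abs_FD[OF finK pos a], symmetric])
      also have "\<dots> = (\<Prod>m\<in>?F. of_int (\<eta> m))"
        using sgn FJ by (intro prod.cong refl) (auto simp: abs_if)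
      finally show ?thesis ..
    qed
    finally have "(\<Prod>k\<in>?K. of_int (\<eta> k)) * normalized_tensor ?K (pairing_of ?K \<alpha>) z = (- 1) ^ num_orbits ?F \<alpha> *
        (\<Prod>k\<in>?K. of_int (\<eta> k) * (if - k \<in> ?F then of_int (\<eta> (- k)) else of_int (\<eta> k)))"
      by (simp add: prod.distrib mult_ac)
    also have "(\<Prod>k\<in>?K. of_int (\<eta> k) * (if - k \<in> ?F then of_int (\<eta> (- k)) else of_int (\<eta> k)))
        = (\<Prod>k\<in>?K. if - k \<in> ?F then real_of_int (\<eta> k * \<eta> (- k)) else 1)"
    proof (intro prod.cong refl)
      fix k assume "k \<in> ?K"
      then have "\<eta> k = 1 \<or> \<eta> k = - 1"
        by (intro unit(2)) (simp add: pm_def)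
      then show "real_of_int (\<eta> k) * (if - k \<in> ?F then of_int (\<eta> (- k)) else of_int (\<eta> k))
          = (if - k \<in> ?F then real_of_int (\<eta> k * \<eta> (- k)) else 1)"
        by auto
    qed
    also have "\<dots> = (\<Prod>k | k \<in> ?K \<and> - k \<in> ?F. real_of_int (\<eta> k * \<eta> (- k)))"
      by (rule prod.inter_filter[OF finK, symmetric])
    finally show ?thesis
      unfolding if_P[OF True] .
  qed
qed

theorem proposition6p19:
  fixes M :: "'a measure"
    and n C :: nat
    and w :: "int \<Rightarrow> nat"
    and X :: "int \<Rightarrow> 'a \<Rightarrow> quat ^ 'n::finite ^ 'n"
    and \<iota> :: "int \<Rightarrow> 'n"
    and \<eta> :: "int \<Rightarrow> int"
  assumes "prob_space M"
    and "w \<in> {1..int n} \<rightarrow> {1..C}"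
    and "\<And>k. k \<in> {1..int n} \<Longrightarrow> X k \<in> borel_measurable M"
    and "sympl_general_position M n C w X"
    and "\<And>(i :: int \<Rightarrow> 'n) h. h \<in> pm {1..int n} \<rightarrow> {1, -1} \<Longrightarrow>
      integrable M (\<lambda>\<omega>. \<Prod>k\<in>{1..int n}. qmat_entry (X k \<omega>) (i k) (i (- k)) (h k) (h (- k)))"
    and "\<And>\<pi>. \<pi> \<in> PM {1..int n} \<Longrightarrow> integrable M (\<lambda>\<omega>. Re_tr n \<pi> (\<lambda>k. X k \<omega>))"
    and "\<eta> \<in> pm {1..int n} \<rightarrow> {1, -1}"
  shows "(\<integral>\<omega>. (\<Prod>k\<in>{1..int n}. qmat_entry (X k \<omega>) (\<iota> k) (\<iota> (- k)) (\<eta> k) (\<eta> (- k))) \<partial>M) =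
    (\<Sum>\<alpha> | \<alpha> \<in> PM {1..int n} \<and>
         (\<forall>k\<in>pm {1..int n}. \<iota> k = \<iota> (- \<alpha> k)) \<and>
         (\<forall>k\<in>pm {1..int n}. sgn k * \<eta> k = sgn (\<alpha> k) * \<eta> (- \<alpha> k)).
       (2 * of_nat CARD('n)) powi (int (num_orbits (pm {1..int n}) \<alpha>) div 2 - int n) *
       (\<Prod>k | k \<in> {1..int n} \<and> - k \<in> FD {1..int n} \<alpha>. of_int (\<eta> k * \<eta> (- k))) *
       f_coeff M n C w X \<alpha>)"
proof -
  note w = assms(2) and \<eta> = assms(7)
  note moments = assms(2-5)
  let ?K = "{1..int n}" and ?N = "CARD('n)" and ?I = "colour_class n w"
  let ?J = "pm ?K" and ?pp = "perm_prod C" and ?Fam = "colour_families n C w"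
  define x where "x = (2 * of_nat ?N :: complex)"
  have x: "x \<noteq> 0"
    by (simp add: x_def)
  have finK: "finite ?K" and pos: "\<And>i. i \<in> ?K \<Longrightarrow> 0 < i"
    by auto
  define z where "z k = (\<iota> k, sgn k * \<eta> k = 1)" for k
  define con where "con \<alpha> \<longleftrightarrow> (\<forall>k\<in>?J. \<iota> k = \<iota> (- \<alpha> k)) \<and>
    (\<forall>k\<in>?J. sgn k * \<eta> k = sgn (\<alpha> k) * \<eta> (- \<alpha> k))" for \<alpha>
  define sg where "sg \<alpha> = (\<Prod>k | k \<in> ?K \<and> - k \<in> FD ?K \<alpha>. complex_of_int (\<eta> k * \<eta> (- k)))" for \<alpha>
  define W where "W A B = complex_of_real (\<Prod>c\<in>{1..C}. Wg ?N (pm (?I c)) (pairing_of (?I c) (A c)) (pairing_of (?I c) (inv (B c))))"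
    for A B
  define ER where "ER \<pi> = (\<integral>\<omega>. Re_tr n \<pi> (\<lambda>k. X k \<omega>) \<partial>M)" for \<pi>
  define cyc where "cyc \<alpha> = num_orbits (FD ?K \<alpha>) \<alpha>" for \<alpha>
  define jb where "jb A B = (\<Sum>c\<in>{1..C}. join_blocks (pm (?I c)) (pairing_of (?I c) (A c)) (pairing_of (?I c) (inv (B c))))"
    for A B
  have cyc: "num_orbits ?J \<alpha> = 2 * cyc \<alpha>" if "\<alpha> \<in> PM ?K" for \<alpha>
    using num_orbits_PM[OF finK pos that] by (simp add: cyc_def)

  \<comment> \<open>\<open>\<eta>\<close> is the sign component of \<open>z\<close> on the rows and its negative on the columns.\<close>
  have entry: "qmat_entry B (\<iota> k) (\<iota> (- k)) (\<eta> k) (\<eta> (- k)) = of_int (\<eta> k) * twisted_entry B (z k) (z (- k))"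
    if "k \<in> ?K" for k and B :: "'n qmat"
  proof -
    have "k \<in> ?J" "- k \<in> ?J"
      using that by (auto simp: pm_def)
    then have "\<eta> k \<in> {1, -1}" "\<eta> (- k) \<in> {1, -1}"
      using \<eta> by blast+
    then have "bsgn_int (z k) = \<eta> k" "- bsgn_int (z (- k)) = \<eta> (- k)" "complex_of_real (bsgn (z k)) = of_int (\<eta> k)"
      "complex_of_int (\<eta> k) * of_int (\<eta> k) = 1"
      using that by (auto simp: z_def bsgn_int_def bsgn_def)
    then show ?thesis
      by (simp only: twisted_entry_eq mult.assoc[symmetric]) (simp add: z_def)
  qed

  have trace: "(\<Sum>y\<in>agree_off ?J z. of_real (normalized_tensor ?K (pairing_of ?K (inv \<pi>)) y) * moment M n X y)
      = (- 1) ^ cyc \<pi> * (x ^ cyc \<pi> * ER \<pi>)" if \<pi>: "\<pi> \<in> PM ?K" for \<pi>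
  proof -
    have "x ^ cyc \<pi> * ER \<pi> = (\<integral>\<omega>. x ^ cyc \<pi> * Re_tr n \<pi> (\<lambda>k. X k \<omega>) \<partial>M)"
      by (simp add: ER_def)
    also have "\<dots> = (\<integral>\<omega>. (- 1) ^ cyc \<pi> * (\<Sum>y\<in>agree_off ?J z. of_real (normalized_tensor ?K (pairing_of ?K (inv \<pi>)) y)
        * (\<Prod>k\<in>?K. twisted_entry (X k \<omega>) (y k) (y (- k)))) \<partial>M)"
      unfolding x_def cyc_def by (subst Re_tr_eq[OF \<pi>, of _ z]) simp
    also have "\<dots> = (- 1) ^ cyc \<pi> * (\<Sum>y\<in>agree_off ?J z. of_real (normalized_tensor ?K (pairing_of ?K (inv \<pi>)) y) * moment M n X y)"
    proof -
      have "(\<integral>\<omega>. (\<Sum>y\<in>agree_off ?J z. of_real (normalized_tensor ?K (pairing_of ?K (inv \<pi>)) y)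
          * (\<Prod>k\<in>?K. twisted_entry (X k \<omega>) (y k) (y (- k)))) \<partial>M)
        = (\<Sum>y\<in>agree_off ?J z. of_real (normalized_tensor ?K (pairing_of ?K (inv \<pi>)) y) * moment M n X y)"
      proof (subst Bochner_Integration.integral_sum)
        show "integrable M (\<lambda>\<omega>. complex_of_real (normalized_tensor ?K (pairing_of ?K (inv \<pi>)) y)
            * (\<Prod>k\<in>?K. twisted_entry (X k \<omega>) (y k) (y (- k))))" for y
          by (intro integrable_mult_right integrable_moment[OF moments])
      qed (simp only: moment_def integral_mult_right_zero)
      then show ?thesis
        by simp
    qed
    finally show ?thesis
      by (simp add: mult.assoc[symmetric] power_add[symmetric] flip: mult_2)
  qed

  have expansion: "moment M n X z = (\<Sum>A\<in>?Fam. \<Sum>B\<in>?Fam.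
      W A B * of_real (normalized_tensor ?K (pairing_of ?K (?pp A)) z) * ((- 1) ^ cyc (?pp B) * (x ^ cyc (?pp B) * ER (?pp B))))"
  proof -
    let ?P = "\<Pi>\<^sub>E c\<in>{1..C}. pairings (pm (?I c))"
    \<comment> \<open>The expansion over pairings is reindexed by the permutations \<open>\<alpha>\<^sub>c\<close> on the left and, because \<open>Re_tr\<close>
      belongs to the pairing of \<open>inv \<pi>\<close>, by the inverses of the \<open>\<pi>\<^sub>c\<close> on the right.\<close>
    define g where "g P Q = of_real ((\<Prod>c\<in>{1..C}. Wg ?N (pm (?I c)) (P c) (Q c)) * (\<Prod>c\<in>{1..C}. normalized_tensor (?I c) (P c) z)) *
      (\<Sum>y\<in>agree_off ?J z. of_real (\<Prod>c\<in>{1..C}. normalized_tensor (?I c) (Q c) y) * moment M n X y)" for P Q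
    have bij1: "bij_betw (pairing_of (?I c)) (PM (?I c)) (pairings (pm (?I c)))" for c
      by (rule bij_pairing_of[OF finite_colour_class colour_class_pos])
    have bij2: "bij_betw (\<lambda>a. pairing_of (?I c) (inv a)) (PM (?I c)) (pairings (pm (?I c)))" for c
      using bij_betw_trans[OF bij_inv_PM[OF finite_colour_class colour_class_pos] bij1[of c]] by (simp add: comp_def)
    have "moment M n X z = (\<Sum>P\<in>?P. \<Sum>Q\<in>?P. g P Q)"
      unfolding g_def by (rule moment_expansion[OF moments])
    also have "\<dots> = (\<Sum>A\<in>?Fam. \<Sum>Q\<in>?P. g (\<lambda>c\<in>{1..C}. pairing_of (?I c) (A c)) Q)"
      unfolding colour_families_def by (rule sum_PiE_reindex[OF bij1])
    also have "\<dots> = (\<Sum>A\<in>?Fam. \<Sum>B\<in>?Fam. g (\<lambda>c\<in>{1..C}. pairing_of (?I c) (A c)) (\<lambda>c\<in>{1..C}. pairing_of (?I c) (inv (B c))))"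
      unfolding colour_families_def by (intro sum.cong refl sum_PiE_reindex[OF bij2])
    also have "\<dots> = (\<Sum>A\<in>?Fam. \<Sum>B\<in>?Fam.
      W A B * of_real (normalized_tensor ?K (pairing_of ?K (?pp A)) z) * ((- 1) ^ cyc (?pp B) * (x ^ cyc (?pp B) * ER (?pp B))))"
    proof (intro sum.cong refl)
      fix A B assume A: "A \<in> ?Fam" and B: "B \<in> ?Fam"
      have "(\<Prod>c\<in>{1..C}. normalized_tensor (?I c) (pairing_of (?I c) (inv (B c))) y) = normalized_tensor ?K (pairing_of ?K (inv (?pp B))) y" for y :: "int \<Rightarrow> 'n \<times> bool"
        using prod_normalized_tensor_family[OF w inv_family[OF w B], of y] unfolding inv_perm_prod[OF w B]
        by (simp add: inv_family_def)
      moreover have "(\<Prod>c\<in>{1..C}. normalized_tensor (?I c) (pairing_of (?I c) (A c)) z) = normalized_tensor ?K (pairing_of ?K (?pp A)) z"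
        by (rule prod_normalized_tensor_family[OF w A])
      ultimately show "g (\<lambda>c\<in>{1..C}. pairing_of (?I c) (A c)) (\<lambda>c\<in>{1..C}. pairing_of (?I c) (inv (B c)))
          = W A B * of_real (normalized_tensor ?K (pairing_of ?K (?pp A)) z) * ((- 1) ^ cyc (?pp B) * (x ^ cyc (?pp B) * ER (?pp B)))"
        by (simp add: g_def W_def trace[OF perm_prod_PM[OF w B]])
    qed
    finally show ?thesis .
  qed

  have f: "f_coeff M n C w X (?pp A) = (\<Sum>B\<in>?Fam. (- 1) ^ n
      * (- x) powi (int (cyc (?pp A)) + int (cyc (?pp B)) + int (jb A B) - int n - 2 * int (cyc (?pp A)))
      * (- x) powi (2 * int n - int (jb A B)) * W A B * ER (?pp B))" if A: "A \<in> ?Fam" for A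
  proof -
    have the_A: "(THE A'. A' \<in> ?Fam \<and> ?pp A = ?pp A') = A"
    proof (rule the_equality)
      show "A' = A" if "A' \<in> ?Fam \<and> ?pp A = ?pp A'" for A'
        using perm_prod_inj[OF w A, of A'] that by simp
    qed (use A in simp)
    have "f_coeff M n C w X (?pp A) = (\<Sum>B\<in>?Fam. (- 1) ^ n *
        (- x) powi (euler_char n (?pp A) (?pp B) - int (num_orbits ?J (?pp A))) *
        (\<Prod>c\<in>{1..C}. of_real (wg ?N (pm (?I c)) (pairing_of (?I c) (A c)) (pairing_of (?I c) (inv (B c))))) * ER (?pp B))"
    proof -
      have ex: "\<exists>A'\<in>?Fam. ?pp A = ?pp A'"
        using A by blast
      show ?thesis
        unfolding f_coeff_def if_P[OF ex] Let_def the_A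
        by (simp add: pairing_of_def ER_def x_def)
    qed
    also have "\<dots> = (\<Sum>B\<in>?Fam. (- 1) ^ n
      * (- x) powi (int (cyc (?pp A)) + int (cyc (?pp B)) + int (jb A B) - int n - 2 * int (cyc (?pp A)))
      * (- x) powi (2 * int n - int (jb A B)) * W A B * ER (?pp B))"
    proof (intro sum.cong refl)
      fix B assume B: "B \<in> ?Fam"
      have "euler_char n (?pp A) (?pp B) - int (num_orbits ?J (?pp A))
          = int (cyc (?pp A)) + int (cyc (?pp B)) + int (jb A B) - int n - 2 * int (cyc (?pp A))"
        using cyc[OF perm_prod_PM[OF w A]] cyc[OF perm_prod_PM[OF w B]] num_orbits_inv_inv[OF w A B]
        by (simp add: euler_char_def jb_def)
      moreover have "(\<Prod>c\<in>{1..C}. complex_of_real (wg ?N (pm (?I c)) (pairing_of (?I c) (A c)) (pairing_of (?I c) (inv (B c)))))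
          = (- x) powi (2 * int n - int (jb A B)) * W A B"
        using prod_wg[OF w, of ?N "\<lambda>c. pairing_of (?I c) (A c)" "\<lambda>c. pairing_of (?I c) (inv (B c))"]
        by (simp add: x_def jb_def W_def)
      ultimately show "(- 1) ^ n * (- x) powi (euler_char n (?pp A) (?pp B) - int (num_orbits ?J (?pp A))) *
          (\<Prod>c\<in>{1..C}. of_real (wg ?N (pm (?I c)) (pairing_of (?I c) (A c)) (pairing_of (?I c) (inv (B c))))) * ER (?pp B)
        = (- 1) ^ n * (- x) powi (int (cyc (?pp A)) + int (cyc (?pp B)) + int (jb A B) - int n - 2 * int (cyc (?pp A)))
          * (- x) powi (2 * int n - int (jb A B)) * W A B * ER (?pp B)"
        by (simp only: mult.assoc)
    qed
    finally show ?thesis .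
  qed
  have f0: "f_coeff M n C w X \<alpha> = 0" if "\<alpha> \<notin> ?pp ` ?Fam" for \<alpha>
    using that unfolding f_coeff_def by auto

  have "(\<integral>\<omega>. (\<Prod>k\<in>?K. qmat_entry (X k \<omega>) (\<iota> k) (\<iota> (- k)) (\<eta> k) (\<eta> (- k))) \<partial>M)
      = (\<Prod>k\<in>?K. complex_of_int (\<eta> k)) * moment M n X z"
    unfolding moment_def by (simp add: entry prod.distrib)
  also have "\<dots> = (\<Sum>A\<in>?Fam. \<Sum>B\<in>?Fam. (if con (?pp A) then (- 1) ^ cyc (?pp A) * sg (?pp A) else 0)
      * W A B * ((- 1) ^ cyc (?pp B) * (x ^ cyc (?pp B) * ER (?pp B))))"
    unfolding expansion sum_distrib_left
  proof (intro sum.cong refl)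
    fix A B assume A: "A \<in> ?Fam" and "B \<in> ?Fam"
    have "complex_of_real ((\<Prod>k\<in>?K. of_int (\<eta> k)) * normalized_tensor ?K (pairing_of ?K (?pp A)) z)
        = (if con (?pp A) then (- 1) ^ cyc (?pp A) * sg (?pp A) else 0)"
      unfolding con_def cyc_def sg_def z_def[abs_def] normalized_tensor_at_index[OF perm_prod_PM[OF w A] \<eta>] by simp
    then have *: "(\<Prod>k\<in>?K. complex_of_int (\<eta> k)) * of_real (normalized_tensor ?K (pairing_of ?K (?pp A)) z)
        = (if con (?pp A) then (- 1) ^ cyc (?pp A) * sg (?pp A) else 0)"
      by simp
    show "(\<Prod>k\<in>?K. complex_of_int (\<eta> k)) * (W A B * of_real (normalized_tensor ?K (pairing_of ?K (?pp A)) z)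
        * ((- 1) ^ cyc (?pp B) * (x ^ cyc (?pp B) * ER (?pp B))))
      = (if con (?pp A) then (- 1) ^ cyc (?pp A) * sg (?pp A) else 0)
        * W A B * ((- 1) ^ cyc (?pp B) * (x ^ cyc (?pp B) * ER (?pp B)))"
      unfolding *[symmetric] by (simp only: mult_ac)
  qed
  also have "\<dots> = (\<Sum>A\<in>?Fam. if con (?pp A)
      then x powi (int (num_orbits ?J (?pp A)) div 2 - int n) * sg (?pp A) * f_coeff M n C w X (?pp A) else 0)"
  proof (intro sum.cong refl)
    fix A assume A: "A \<in> ?Fam"
    have "(\<Sum>B\<in>?Fam. (- 1) ^ cyc (?pp A) * sg (?pp A) * W A B * ((- 1) ^ cyc (?pp B) * (x ^ cyc (?pp B) * ER (?pp B))))
        = x powi (int (cyc (?pp A)) - int n) * sg (?pp A) * f_coeff M n C w X (?pp A)"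
      unfolding f[OF A] sum_distrib_left
    proof (intro sum.cong refl)
      fix B
      show "(- 1) ^ cyc (?pp A) * sg (?pp A) * W A B * ((- 1) ^ cyc (?pp B) * (x ^ cyc (?pp B) * ER (?pp B)))
        = x powi (int (cyc (?pp A)) - int n) * sg (?pp A) * ((- 1) ^ n
          * (- x) powi (int (cyc (?pp A)) + int (cyc (?pp B)) + int (jb A B) - int n - 2 * int (cyc (?pp A)))
          * (- x) powi (2 * int n - int (jb A B)) * W A B * ER (?pp B))"
        using arg_cong[OF coefficient_identity[OF x, of "cyc (?pp A)" "cyc (?pp B)" n "jb A B"],
            of "\<lambda>t. t * (sg (?pp A) * W A B * ER (?pp B))"]
        by (simp only: mult_ac)
    qed
    moreover have "int (num_orbits ?J (?pp A)) div 2 = int (cyc (?pp A))"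
      using cyc[OF perm_prod_PM[OF w A]] by simp
    ultimately show "(\<Sum>B\<in>?Fam. (if con (?pp A) then (- 1) ^ cyc (?pp A) * sg (?pp A) else 0)
        * W A B * ((- 1) ^ cyc (?pp B) * (x ^ cyc (?pp B) * ER (?pp B))))
      = (if con (?pp A) then x powi (int (num_orbits ?J (?pp A)) div 2 - int n) * sg (?pp A) * f_coeff M n C w X (?pp A) else 0)"
      by simp
  qed
  also have "\<dots> = (\<Sum>\<alpha>\<in>?pp ` ?Fam. if con \<alpha>
      then x powi (int (num_orbits ?J \<alpha>) div 2 - int n) * sg \<alpha> * f_coeff M n C w X \<alpha> else 0)"
    using perm_prod_inj[OF w] by (subst sum.reindex) (auto intro: inj_onI)
  also have "\<dots> = (\<Sum>\<alpha>\<in>PM ?K. if con \<alpha>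
      then x powi (int (num_orbits ?J \<alpha>) div 2 - int n) * sg \<alpha> * f_coeff M n C w X \<alpha> else 0)"
    using perm_prod_PM[OF w] f0 finite_PM[OF finK] by (intro sum.mono_neutral_left) auto
  also have "\<dots> = (\<Sum>\<alpha> | \<alpha> \<in> PM ?K \<and> con \<alpha>. x powi (int (num_orbits ?J \<alpha>) div 2 - int n) * sg \<alpha> * f_coeff M n C w X \<alpha>)"
    by (rule sum.inter_filter[OF finite_PM[OF finK], symmetric])
  finally show ?thesis
    unfolding con_def sg_def x_def .
qed

end
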